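(* Let $\gamma>0$ and let $A$ be the closed dissipative operator on $L^2(0,1)$ given by $$\mathcal{D}(A)=H^1_0(0,1),\qquad (Af)(x)=if'(x)+i\frac{\gamma}{x}f(x).$$ Let $$\mathcal{W}:=\Big\{v\in L^2(0,1):\ \big(x\mapsto\sqrt{x}\,v(x)\big)\in H^1_0(0,1)\dot{+}\mathrm{span}\{x^{\gamma+\frac12}\}\Big\}.$$ Then the maximally dissipative extensions of $A$ are precisely the operators $A_{v,\ell}$ given by $$\mathcal{D}(A_{v,\ell})=H^1_0(0,1)\dot{+}\mathrm{span}\{v\},\qquad A_{v,\ell}(f+\lambda v)= Af+\lambda\ell\quad(f\in H^1_0(0,1),\ \lambda\in\mathbb{C}),$$ where $v\in\mathcal{W}\setminus H^1_0(0,1)$ and $\ell\in L^2(0,1)$ satisfy $$\mathrm{Im}\langle v,\ell\rangle\geq\frac14\int_0^1\left|\sqrt{\frac{x}{\gamma}}\,\ell(x)-i\left(\sqrt{\frac{x}{\gamma}}\,v(x)\right)'+i\frac{2\gamma+1}{2\sqrt{\gamma x}}\,v(x)\right|^2\mathrm{d}x .$$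
   Context: Inner products are linear in the second component, so $\langle v,\ell\rangle=\int_0^1\overline{v(x)}\ell(x)\,\mathrm{d}x$. $H^1_0(0,1)=\{f\in H^1(0,1): f(0)=f(1)=0\}$, and $'$ denotes the weak derivative. A densely defined linear operator $T$ is dissipative if $\mathrm{Im}\langle f,Tf\rangle\geq0$ for all $f\in\mathcal{D}(T)$, and maximally dissipative if it is dissipative and has no non-trivial dissipative operator extension. $\dot{+}$ denotes an algebraic direct sum. *)

theory Defs
  imports "HOL-Analysis.Analysis"
begin

section \<open>The Hilbert space of square-integrable functions on the open unit interval\<close>

abbreviation unit_leb :: "real measure" where
  "unit_leb \<equiv> lebesgue_on {0<..<1}"

definition square_integrable :: "(real \<Rightarrow> complex) \<Rightarrow> bool" where
  "square_integrable f \<longleftrightarrow>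
     f \<in> borel_measurable unit_leb \<and> integrable unit_leb (\<lambda>x. (cmod (f x))\<^sup>2)"

definition l2_eq :: "(real \<Rightarrow> complex) \<Rightarrow> (real \<Rightarrow> complex) \<Rightarrow> bool" where
  "l2_eq f g \<longleftrightarrow> square_integrable f \<and> square_integrable g \<and> (AE x in unit_leb. f x = g x)"

lemma square_integrable_zero: "square_integrable (\<lambda>_. 0)"
  by (simp add: square_integrable_def)

lemma square_integrable_scale:
  assumes "square_integrable f"
  shows "square_integrable (\<lambda>x. c * f x)"
  using assms by (auto simp: square_integrable_def norm_mult power_mult_distrib)

lemma square_integrable_add:
  assumes f: "square_integrable f" and g: "square_integrable g"
  shows "square_integrable (\<lambda>x. f x + g x)"
proof -
  have [measurable]: "f \<in> borel_measurable unit_leb" "g \<in> borel_measurable unit_leb"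
    using f g by (auto simp: square_integrable_def)
  have "integrable unit_leb (\<lambda>x. 2 * (cmod (f x))\<^sup>2 + 2 * (cmod (g x))\<^sup>2)"
    using f g by (auto simp: square_integrable_def)
  moreover have bound: "(cmod (a + b))\<^sup>2 \<le> 2 * (cmod a)\<^sup>2 + 2 * (cmod b)\<^sup>2" for a b
  proof -
    have "(cmod (a + b))\<^sup>2 \<le> (cmod a + cmod b)\<^sup>2"
      by (intro power_mono norm_triangle_ineq) auto
    also have "\<dots> \<le> 2 * (cmod a)\<^sup>2 + 2 * (cmod b)\<^sup>2"
      using zero_le_power2[of "cmod a - cmod b"] by (simp add: power2_eq_square algebra_simps)
    finally show ?thesis .
  qed
  ultimately have "integrable unit_leb (\<lambda>x. (cmod (f x + g x))\<^sup>2)"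
    by (elim Bochner_Integration.integrable_bound) (auto intro!: AE_I2 order_trans[OF bound])
  then show ?thesis
    by (auto simp: square_integrable_def)
qed

lemma integrable_cnj_mult:
  assumes f: "square_integrable f" and g: "square_integrable g"
  shows "integrable unit_leb (\<lambda>x. cnj (f x) * g x)"
proof -
  have [measurable]: "f \<in> borel_measurable unit_leb" "g \<in> borel_measurable unit_leb"
    using f g by (auto simp: square_integrable_def)
  have "integrable unit_leb (\<lambda>x. (cmod (f x))\<^sup>2 + (cmod (g x))\<^sup>2)"
    using f g by (auto simp: square_integrable_def)
  moreover have "cmod a * cmod b \<le> (cmod a)\<^sup>2 + (cmod b)\<^sup>2" for a b
    using sum_squares_bound[of "cmod a" "cmod b"] mult_nonneg_nonneg[of "cmod a" "cmod b"]
    by (simp del: zero_le_mult_iff mult_nonneg_nonneg)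
  moreover have "(\<lambda>x. cnj (f x) * g x) \<in> borel_measurable unit_leb"
    by (intro borel_measurable_times borel_measurable_continuous_on[where f = cnj] continuous_intros)
      measurable
  ultimately show ?thesis
    by (elim Bochner_Integration.integrable_bound) (auto simp: norm_mult)
qed

quotient_type l2 = "real \<Rightarrow> complex" / partial: l2_eq
  morphisms l2_fun l2_of
proof (rule part_equivpI)
  show "\<exists>f. l2_eq f f"
    using square_integrable_zero by (auto simp: l2_eq_def)
  show "symp l2_eq"
    by (auto simp: symp_def l2_eq_def elim: eventually_mono)
  show "transp l2_eq"
  proof (rule transpI)
    fix f g h assume fg: "l2_eq f g" and gh: "l2_eq g h"
    have "AE x in unit_leb. f x = g x" "AE x in unit_leb. g x = h x"
      using fg gh by (auto simp: l2_eq_def)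
    then have "AE x in unit_leb. f x = h x"
      by eventually_elim simp
    with fg gh show "l2_eq f h" by (auto simp: l2_eq_def)
  qed
qed

text \<open>\<^term>\<open>l2_fun u\<close> is some representative of the class \<^term>\<open>u\<close>;
  \<^term>\<open>l2_of f\<close> is the class of \<^term>\<open>f\<close> and only meaningful for square-integrable
  \<^term>\<open>f\<close>.\<close>

lemma l2_fun_eq: "l2_eq (l2_fun u) (l2_fun u)"
  by (rule Quotient3_rep_reflp[OF Quotient3_l2])

lemma square_integrable_l2_fun: "square_integrable (l2_fun u)"
  using l2_fun_eq by (auto simp: l2_eq_def)

lemma l2_fun_l2_of:
  assumes "square_integrable f"
  shows "AE x in unit_leb. l2_fun (l2_of f) x = f x"
proof -
  have "l2_eq f f" using assms by (auto simp: l2_eq_def)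
  then have "l2_eq (l2_fun (l2_of f)) f"
    by (rule rep_abs_rsp_left[OF Quotient3_l2])
  then show ?thesis by (auto simp: l2_eq_def)
qed

lift_definition l2_scale :: "complex \<Rightarrow> l2 \<Rightarrow> l2"  (infixr "*\<^sub>C" 75)
  is "\<lambda>c f x. c * f x"
  by (auto simp: l2_eq_def square_integrable_scale elim: eventually_mono)

lift_definition l2_inner :: "l2 \<Rightarrow> l2 \<Rightarrow> complex"
  is "\<lambda>f g. LINT x|unit_leb. cnj (f x) * g x"
proof -
  fix f f' g g' assume A: "l2_eq f f'" "l2_eq g g'"
  have "AE x in unit_leb. f x = f' x" "AE x in unit_leb. g x = g' x"
    using A by (auto simp: l2_eq_def)
  then have "AE x in unit_leb. cnj (f x) * g x = cnj (f' x) * g' x"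
    by eventually_elim simp
  then show "(LINT x|unit_leb. cnj (f x) * g x) = (LINT x|unit_leb. cnj (f' x) * g' x)"
    using A by (intro integral_cong_AE borel_measurable_integrable integrable_cnj_mult)
      (auto simp: l2_eq_def)
qed

instantiation l2 :: real_vector
begin

lift_definition zero_l2 :: l2 is "\<lambda>_. 0"
  by (simp add: l2_eq_def square_integrable_zero)

lift_definition plus_l2 :: "l2 \<Rightarrow> l2 \<Rightarrow> l2" is "\<lambda>f g x. f x + g x"
  by (auto simp: l2_eq_def square_integrable_add elim: eventually_elim2)

definition uminus_l2 :: "l2 \<Rightarrow> l2" where "- u = (-1) *\<^sub>C u"

definition minus_l2 :: "l2 \<Rightarrow> l2 \<Rightarrow> l2" where "u - v = u + - (v :: l2)"

definition scaleR_l2 :: "real \<Rightarrow> l2 \<Rightarrow> l2" where "r *\<^sub>R u = complex_of_real r *\<^sub>C u"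

instance
proof
  fix u v w :: l2 and a b :: real
  show "u + v + w = u + (v + w)"
    by transfer (auto simp: l2_eq_def algebra_simps square_integrable_add)
  show "u + v = v + u"
    by transfer (auto simp: l2_eq_def algebra_simps square_integrable_add)
  show "0 + u = u"
    by transfer (auto simp: l2_eq_def)
  show "- u + u = 0"
    unfolding uminus_l2_def
    by transfer (auto simp: l2_eq_def square_integrable_zero)
  show "u - v = u + - v"
    by (simp add: minus_l2_def)
  show "a *\<^sub>R (u + v) = a *\<^sub>R u + a *\<^sub>R v"
    unfolding scaleR_l2_def
    by transfer (auto simp: l2_eq_def distrib_left intro!: square_integrable_add square_integrable_scale)
  show "(a + b) *\<^sub>R u = a *\<^sub>R u + b *\<^sub>R u"
    unfolding scaleR_l2_def of_real_add
    by transfer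
      (auto simp: l2_eq_def distrib_right
        intro!: square_integrable_add square_integrable_scale)
  show "a *\<^sub>R b *\<^sub>R u = (a * b) *\<^sub>R u"
    unfolding scaleR_l2_def of_real_mult
    by transfer (auto simp: l2_eq_def mult.assoc intro!: square_integrable_scale)
  show "1 *\<^sub>R u = u"
    unfolding scaleR_l2_def
    by transfer (auto simp: l2_eq_def)
qed

end

lemma l2_inner_commute: "l2_inner u v = cnj (l2_inner v u)"
  by transfer (subst Bochner_Integration.integral_cnj[symmetric], simp add: mult.commute)

lemma l2_inner_add_right: "l2_inner u (v + w) = l2_inner u v + l2_inner u w"
  by transfer (auto simp: l2_eq_def distrib_left integrable_cnj_mult)

lemma l2_inner_scale_right: "l2_inner u (c *\<^sub>C v) = c * l2_inner u v"
  by transfer (simp add: mult.left_commute)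

lemma l2_inner_self: "l2_inner u u = of_real (LINT x|unit_leb. (cmod (l2_fun u x))\<^sup>2)"
proof -
  have "l2_inner u u = (LINT x|unit_leb. cnj (l2_fun u x) * l2_fun u x)"
    by (simp add: l2_inner_def)
  also have "\<dots> = (LINT x|unit_leb. complex_of_real ((cmod (l2_fun u x))\<^sup>2))"
    by (intro Bochner_Integration.integral_cong refl)
      (simp only: complex_norm_square mult.commute)
  finally show ?thesis by (simp only: integral_complex_of_real)
qed

lemma l2_inner_self_eq_0_iff: "l2_inner u u = 0 \<longleftrightarrow> u = 0"
proof
  assume "l2_inner u u = 0"
  then have "(LINT x|unit_leb. (cmod (l2_fun u x))\<^sup>2) = 0"
    by (simp add: l2_inner_self)
  then have "AE x in unit_leb. (cmod (l2_fun u x))\<^sup>2 = 0"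
    using square_integrable_l2_fun[of u]
    by (subst (asm) integral_nonneg_eq_0_iff_AE) (auto simp: square_integrable_def)
  then have "l2_eq (l2_fun u) (\<lambda>_. 0)"
    using square_integrable_l2_fun[of u] square_integrable_zero
    by (auto simp: l2_eq_def)
  then have "l2_of (l2_fun u) = l2_of (\<lambda>_. 0)"
    by (rule Quotient3_rel_abs[OF Quotient3_l2])
  then show "u = 0"
    by (simp add: Quotient3_abs_rep[OF Quotient3_l2] zero_l2_def)
next
  assume "u = 0"
  then show "l2_inner u u = 0"
    using l2_inner_scale_right[of u 0 u] l2_inner_add_right[of u 0 0] by simp
qed

instantiation l2 :: real_inner
begin

definition inner_l2 :: "l2 \<Rightarrow> l2 \<Rightarrow> real" where "inner_l2 u v = Re (l2_inner u v)"
definition norm_l2 :: "l2 \<Rightarrow> real" where "norm_l2 u = sqrt (inner u u)"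
definition sgn_l2 :: "l2 \<Rightarrow> l2" where "sgn_l2 u = inverse (norm u) *\<^sub>R u"
definition dist_l2 :: "l2 \<Rightarrow> l2 \<Rightarrow> real" where "dist_l2 u v = norm (u - v)"
definition uniformity_l2 :: "(l2 \<times> l2) filter" where
  "uniformity_l2 = (INF e\<in>{0 <..}. principal {(x, y). dist x y < e})"
definition open_l2 :: "l2 set \<Rightarrow> bool" where
  "open_l2 U \<longleftrightarrow> (\<forall>x\<in>U. eventually (\<lambda>(x', y). x' = x \<longrightarrow> y \<in> U) uniformity)"

instance
proof
  fix u v w :: l2 and r :: real and U :: "l2 set"
  show "dist u v = norm (u - v)" by (rule dist_l2_def)
  show "sgn u = inverse (norm u) *\<^sub>R u" by (rule sgn_l2_def)
  show "(uniformity :: (l2 \<times> l2) filter) = (INF e\<in>{0 <..}. principal {(x, y). dist x y < e})"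
    by (rule uniformity_l2_def)
  show "open U \<longleftrightarrow> (\<forall>x\<in>U. \<forall>\<^sub>F (x', y) in uniformity. x' = x \<longrightarrow> y \<in> U)"
    by (rule open_l2_def)
  show comm: "inner u v = inner v u" for u v :: l2
    unfolding inner_l2_def by (subst l2_inner_commute) simp
  show "inner (u + v) w = inner u w + inner v w"
    unfolding comm[of _ w] by (simp add: inner_l2_def l2_inner_add_right)
  show "inner (r *\<^sub>R u) v = r * inner u v"
    unfolding comm[of _ v] by (simp add: inner_l2_def scaleR_l2_def l2_inner_scale_right)
  show "0 \<le> inner u u"
    by (simp add: inner_l2_def l2_inner_self)
  show "inner u u = 0 \<longleftrightarrow> u = 0"
    using l2_inner_self_eq_0_iff[of u] by (simp add: inner_l2_def l2_inner_self)
  show "norm u = sqrt (inner u u)" by (rule norm_l2_def)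
qed

end


section \<open>Dissipative operators\<close>

text \<open>An unbounded operator is represented by its graph, so that extension is inclusion.\<close>

type_synonym l2_op = "(l2 \<times> l2) set"

definition linear_op :: "l2_op \<Rightarrow> bool" where
  "linear_op T \<longleftrightarrow> single_valued T \<and> (0, 0) \<in> T \<and>
     (\<forall>(f, g)\<in>T. \<forall>(f', g')\<in>T. (f + f', g + g') \<in> T) \<and>
     (\<forall>(f, g)\<in>T. \<forall>c. (c *\<^sub>C f, c *\<^sub>C g) \<in> T)"

definition densely_defined :: "l2_op \<Rightarrow> bool" where
  "densely_defined T \<longleftrightarrow> closure (Domain T) = UNIV"

definition dissipative :: "l2_op \<Rightarrow> bool" where
  "dissipative T \<longleftrightarrow> linear_op T \<and> densely_defined T \<and> (\<forall>(f, g)\<in>T. Im (l2_inner f g) \<ge> 0)"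

definition maximally_dissipative :: "l2_op \<Rightarrow> bool" where
  "maximally_dissipative T \<longleftrightarrow> dissipative T \<and> (\<forall>S. dissipative S \<and> T \<subseteq> S \<longrightarrow> S = T)"


section \<open>Weak derivatives and Sobolev spaces on the unit interval\<close>

definition test_function :: "(real \<Rightarrow> real) \<Rightarrow> bool" where
  "test_function \<phi> \<longleftrightarrow> (\<forall>n. (deriv ^^ n) \<phi> differentiable_on UNIV) \<and>
     (\<exists>K. compact K \<and> K \<subseteq> {0<..<1} \<and> (\<forall>x. x \<notin> K \<longrightarrow> \<phi> x = 0))"

definition locally_integrable :: "(real \<Rightarrow> complex) \<Rightarrow> bool" where
  "locally_integrable f \<longleftrightarrow> (\<forall>K. compact K \<and> K \<subseteq> {0<..<1} \<longrightarrow> f absolutely_integrable_on K)"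

definition has_weak_deriv :: "(real \<Rightarrow> complex) \<Rightarrow> (real \<Rightarrow> complex) \<Rightarrow> bool" where
  "has_weak_deriv f g \<longleftrightarrow> locally_integrable f \<and> locally_integrable g \<and>
     (\<forall>\<phi>. test_function \<phi> \<longrightarrow>
        (LINT x|unit_leb. deriv \<phi> x *\<^sub>R f x) = - (LINT x|unit_leb. \<phi> x *\<^sub>R g x))"

text \<open>The weak derivative is unique almost everywhere on the unit interval when it exists;
  an arbitrary version of it is chosen.\<close>

definition weak_deriv :: "(real \<Rightarrow> complex) \<Rightarrow> real \<Rightarrow> complex" where
  "weak_deriv f = (SOME g. has_weak_deriv f g)"

definition H1 :: "l2 set" where
  "H1 = {f. \<exists>g. square_integrable g \<and> has_weak_deriv (l2_fun f) g}"

text \<open>The boundary values of an \<^term>\<open>H1\<close> function are those of its continuous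
  representative on the closed interval.\<close>

definition H10 :: "l2 set" where
  "H10 = {f \<in> H1. \<exists>F. continuous_on {0..1} F \<and> (AE x in unit_leb. l2_fun f x = F x) \<and>
                      F 0 = 0 \<and> F 1 = 0}"


section \<open>The operator and its one-dimensional extensions\<close>

text \<open>By Hardy's inequality the function on the right-hand side is square-integrable for all
  \<^term>\<open>f \<in> H10\<close>.\<close>

definition A_fun :: "real \<Rightarrow> l2 \<Rightarrow> l2" where
  "A_fun \<gamma> f = l2_of (\<lambda>x. \<i> * weak_deriv (l2_fun f) x + \<i> * of_real (\<gamma> / x) * l2_fun f x)"

definition A_op :: "real \<Rightarrow> l2_op" where
  "A_op \<gamma> = {(f, A_fun \<gamma> f) | f. f \<in> H10}"

text \<open>The sum is automatically direct, because the continuous function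
  \<open>x powr (\<gamma> + 1/2)\<close> takes the value 1 at 1.\<close>

definition W :: "real \<Rightarrow> l2 set" where
  "W \<gamma> = {v. l2_of (\<lambda>x. of_real (sqrt x) * l2_fun v x) \<in>
             {h + c *\<^sub>C l2_of (\<lambda>x. of_real (x powr (\<gamma> + 1/2))) | h c. h \<in> H10}}"

text \<open>The sum in the domain is direct, and the operator well defined, if
  \<^term>\<open>v \<notin> H10\<close>.\<close>

definition A_ext :: "real \<Rightarrow> l2 \<Rightarrow> l2 \<Rightarrow> l2_op" where
  "A_ext \<gamma> v l = {(f + c *\<^sub>C v, A_fun \<gamma> f + c *\<^sub>C l) | f c. f \<in> H10}"

text \<open>For \<^term>\<open>v \<in> W \<gamma>\<close> the integrand is integrable, so the Bochner integral agrees with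
  the extended-valued integral.\<close>

definition defect :: "real \<Rightarrow> l2 \<Rightarrow> l2 \<Rightarrow> real" where
  "defect \<gamma> v l = (LINT x|unit_leb. (cmod (
       of_real (sqrt (x / \<gamma>)) * l2_fun l x
       - \<i> * weak_deriv (\<lambda>y. of_real (sqrt (y / \<gamma>)) * l2_fun v y) x
       + \<i> * of_real ((2 * \<gamma> + 1) / (2 * sqrt (\<gamma> * x))) * l2_fun v x))\<^sup>2)"

end

theory Submission
  imports Defs
begin

text \<open>For \<open>f\<close> in the domain of \<open>A\<close> one has \<open>Im \<langle>f, A f\<rangle> = \<parallel>(\<gamma>/x)^(1/2) f\<parallel>\<^sup>2\<close>, and the range of \<open>A + i\<close> is
  the orthogonal complement of \<open>x^\<gamma> exp x\<close>. Since \<open>S + i\<close> is injective for dissipative \<open>S\<close>, every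
  proper dissipative extension of \<open>A\<close> adds exactly one dimension, spanned by some \<open>(v, l)\<close>, and is
  therefore maximal. Dissipativity of \<open>A + span (v, l)\<close> says that the antilinear form
  \<open>f \<mapsto> \<langle>f, l\<rangle> - \<langle>A f, v\<rangle>\<close> is bounded by \<open>2 (Im \<langle>v, l\<rangle>)^(1/2) \<parallel>(\<gamma>/x)^(1/2) f\<parallel>\<close>. By the Riesz
  representation theorem it is then \<open>f \<mapsto> \<langle>(\<gamma>/x)^(1/2) f, w\<rangle>\<close> with \<open>\<parallel>w\<parallel>\<^sup>2 \<le> 4 Im \<langle>v, l\<rangle>\<close>. This is a
  first-order differential equation for \<open>v\<close> in the weak sense; the dual Hardy inequality
  gives the regularity of \<open>x^(1/2) v\<close>, and \<open>w\<close> is the integrand of the defect.\<close>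

section \<open>Test functions\<close>

text \<open>Each singular equation that occurs has the form \<open>F' = (\<alpha> / x) F + k\<close>
  with \<open>k\<close> square-integrable. One estimate, \<open>hardy_square_integrable\<close>,
  puts \<open>F / x\<close> into L2 as soon as \<open>|F|^2 = O(x)\<close> and
  \<open>\<alpha> \<noteq> 1/2\<close>: the value \<open>\<alpha> = 0\<close> is Hardy's inequality
  on \<open>H10\<close>, \<open>\<alpha> = - \<gamma>\<close> makes \<open>A + i\<close> solvable on
  the complement of its normal vector, and \<open>\<alpha> = \<gamma> + 1/2\<close> gives the
  regularity of \<open>x^(1/2) v\<close>. In the last two cases the bound \<open>O(x)\<close> comes
  from Cauchy-Schwarz after division by a homogeneous solution; positivity of \<gamma> makes the
  weights left over monotone or explicitly integrable. The formal adjoint of \<open>A\<close> is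
  \<open>i v' - i (\<gamma> / x) v\<close>, which annihilates \<open>x^\<gamma>\<close>; times
  \<open>x^(1/2)\<close> this is the power in \<open>W\<close>. The constant 1/4 is a discriminant:
  \<open>N^2 - c d N + c^2 E\<close> is nonnegative for all \<open>N, c \<ge> 0\<close> exactly if
  \<open>d^2 \<le> 4 E\<close>. Here \<open>N\<close> stands for the weighted norm of
  \<open>f\<close>, \<open>d\<close> for the norm of \<open>w\<close>, and \<open>E\<close> for the
  imaginary part of the form at \<open>(v, l)\<close>.\<close>

definition smooth :: "(real \<Rightarrow> real) \<Rightarrow> bool" where
  "smooth f \<longleftrightarrow> (\<forall>n. (deriv ^^ n) f differentiable_on UNIV)"

text \<open>Smoothness is the largest predicate that implies differentiability and is stable under
  \<open>deriv\<close>, so it suffices to exhibit a stable family containing the function.\<close>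

lemma smooth_coinduct:
  assumes "P f"
    and step: "\<And>f. P f \<Longrightarrow> f differentiable_on UNIV \<and> P (deriv f)"
  shows "smooth f"
proof -
  have "P ((deriv ^^ n) f)" for n
    by (induction n) (use assms in auto)
  then show ?thesis
    using step by (auto simp: smooth_def)
qed

lemma smooth_differentiable: "smooth f \<Longrightarrow> f differentiable_on UNIV"
  unfolding smooth_def by (metis funpow_0)

lemma smooth_deriv: "smooth f \<Longrightarrow> smooth (deriv f)"
  unfolding smooth_def by (metis funpow_Suc_right comp_apply)

lemma smooth_has_deriv: "smooth f \<Longrightarrow> (f has_real_derivative deriv f x) (at x)"
  using smooth_differentiable[of f]
  by (auto simp: differentiable_on_def DERIV_deriv_iff_real_differentiable)

lemma smooth_of_deriv:
  assumes "\<And>x. (f has_real_derivative g x) (at x)" and "smooth g"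
  shows "smooth f"
proof (rule smooth_coinduct[of "\<lambda>h. h = f \<or> smooth h"])
  fix h assume h: "h = f \<or> smooth h"
  have "deriv f = g"
    using assms(1) by (auto intro: DERIV_imp_deriv)
  moreover have "f differentiable_on UNIV"
    using assms(1) by (auto simp: differentiable_on_def real_differentiable_def intro: has_field_derivative_at_within)
  ultimately show "h differentiable_on UNIV \<and> (deriv h = f \<or> smooth (deriv h))"
    using h assms smooth_deriv smooth_differentiable by auto
qed auto

lemma smooth_add:
  assumes "smooth f" "smooth g"
  shows "smooth (\<lambda>x. f x + g x)"
proof (rule smooth_coinduct[of "\<lambda>h. \<exists>f g. smooth f \<and> smooth g \<and> h = (\<lambda>x. f x + g x)"])
  fix h :: "real \<Rightarrow> real"
  assume "\<exists>f g. smooth f \<and> smooth g \<and> h = (\<lambda>x. f x + g x)"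
  then obtain f g where fg: "smooth f" "smooth g" and h: "h = (\<lambda>x. f x + g x)" by blast
  have D: "(h has_real_derivative deriv f x + deriv g x) (at x)" for x
    unfolding h by (intro DERIV_add smooth_has_deriv fg)
  then have "deriv h = (\<lambda>x. deriv f x + deriv g x)"
    by (auto intro: DERIV_imp_deriv)
  moreover have "h differentiable_on UNIV"
    using D by (auto simp: differentiable_on_def real_differentiable_def)
  ultimately show "h differentiable_on UNIV \<and>
      (\<exists>f g. smooth f \<and> smooth g \<and> deriv h = (\<lambda>x. f x + g x))"
    using fg smooth_deriv by blast
qed (use assms in blast)

lemma smooth_affine:
  assumes "smooth f"
  shows "smooth (\<lambda>x. c * f (r * x + s))"
proof (rule smooth_coinduct[of "\<lambda>h. \<exists>f c. smooth f \<and> h = (\<lambda>x. c * f (r * x + s))"])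
  fix h :: "real \<Rightarrow> real"
  assume "\<exists>f c. smooth f \<and> h = (\<lambda>x. c * f (r * x + s))"
  then obtain f c where f: "smooth f" and h: "h = (\<lambda>x. c * f (r * x + s))" by blast
  have D: "(h has_real_derivative (c * r) * deriv f (r * x + s)) (at x)" for x
  proof -
    have "((\<lambda>x. f (r * x + s)) has_real_derivative deriv f (r * x + s) * r) (at x)"
      by (rule DERIV_chain2[OF smooth_has_deriv[OF f]]) (auto intro!: derivative_eq_intros)
    from DERIV_cmult[OF this, of c] show ?thesis
      by (simp add: h mult_ac)
  qed
  then have "deriv h = (\<lambda>x. (c * r) * deriv f (r * x + s))"
    by (auto intro: DERIV_imp_deriv)
  moreover have "h differentiable_on UNIV"
    using D by (auto simp: differentiable_on_def real_differentiable_def)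
  ultimately show "h differentiable_on UNIV \<and>
      (\<exists>f c. smooth f \<and> deriv h = (\<lambda>x. c * f (r * x + s)))"
    using f smooth_deriv by blast
qed (use assms in blast)

text \<open>Writing \<open>y = 1 / (x (1 - x))\<close>, the functions \<open>p(x) y^k exp(-y)\<close> with a polynomial
  \<open>p\<close>, cut off to the unit interval, are closed under differentiation.\<close>

definition bump :: "real poly \<Rightarrow> nat \<Rightarrow> real \<Rightarrow> real" where
  "bump p k x = (if 0 < x \<and> x < 1
     then poly p x * (1 / (x * (1 - x))) ^ k * exp (- (1 / (x * (1 - x)))) else 0)"

text \<open>The exponential beats two more powers of \<open>1 / (x (1 - x))\<close> than the
  function contains. The surplus is a factor \<open>(x (1 - x))^2\<close>, which vanishes
  quadratically at both ends of the interval; this makes the extension by 0 differentiable at every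
  point outside the open interval.\<close>

lemma bump_bound:
  obtains C where "\<And>x y. x \<le> 0 \<or> 1 \<le> x \<Longrightarrow> \<bar>bump p k y\<bar> \<le> C * (y - x)\<^sup>2"
proof -
  have "bounded (poly p ` {0..1})"
    by (intro compact_imp_bounded compact_continuous_image continuous_intros) auto
  then obtain B where B: "\<And>x. x \<in> {0..1} \<Longrightarrow> \<bar>poly p x\<bar> \<le> B"
    unfolding bounded_iff by (metis imageI real_norm_def)
  have B0: "B \<ge> 0" using B[of 0] by simp
  have main: "\<bar>bump p k y\<bar> \<le> (B * real (k + 2) ^ (k + 2)) * (y - x)\<^sup>2" if x: "x \<le> 0 \<or> 1 \<le> x" for x y
  proof (cases "0 < y \<and> y < 1")
    case True
    define q where "q = y * (1 - y)"
    define z where "z = 1 / q"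
    have q: "q > 0" using True by (simp add: q_def)
    then have z: "z > 0" by (simp add: z_def)
    \<comment> \<open>This is \<open>t \<le> exp t\<close> at \<open>t = z / (k + 2)\<close>, raised
      to the power \<open>k + 2\<close>.\<close>
    have "(z / real (k + 2)) ^ (k + 2) \<le> exp (z / real (k + 2)) ^ (k + 2)"
      using z exp_ge_add_one_self[of "z / real (k + 2)"]
      by (intro power_mono order_trans[OF _ exp_ge_add_one_self]) auto
    also have "\<dots> = exp z"
      by (rule exp_divide_power_eq) simp
    finally have "z ^ (k + 2) \<le> real (k + 2) ^ (k + 2) * exp z"
      by (simp add: power_divide divide_le_eq mult.commute del: of_nat_add power_Suc)
    then have "z ^ (k + 2) * exp (- z) \<le> real (k + 2) ^ (k + 2)"
      by (simp add: exp_minus divide_le_eq flip: divide_inverse del: of_nat_add power_Suc)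
    then have "z ^ (k + 2) * exp (- z) * q ^ 2 \<le> real (k + 2) ^ (k + 2) * q ^ 2"
      by (rule mult_right_mono) simp
    then have "z ^ k * exp (- z) * (z ^ 2 * q ^ 2) \<le> real (k + 2) ^ (k + 2) * q ^ 2"
      unfolding power_add[of z k 2] by (simp only: mult_ac)
    then have 1: "z ^ k * exp (- z) \<le> real (k + 2) ^ (k + 2) * q ^ 2"
      using q by (simp add: z_def flip: power_mult_distrib)
    have "q \<le> \<bar>y - x\<bar>"
    proof (cases "x \<le> 0")
      case True
      have "q \<le> y" using \<open>0 < y \<and> y < 1\<close> by (auto simp: q_def mult_le_cancel_left1)
      then show ?thesis using True \<open>0 < y \<and> y < 1\<close> by auto
    next
      case False
      then have "1 \<le> x" using x by auto
      moreover have "q \<le> 1 - y" using \<open>0 < y \<and> y < 1\<close> by (auto simp: q_def mult_le_cancel_right1)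
      ultimately show ?thesis using \<open>0 < y \<and> y < 1\<close> by auto
    qed
    then have 2: "q ^ 2 \<le> (y - x)\<^sup>2"
      using q abs_le_square_iff[of q "y - x"] by simp
    have "\<bar>bump p k y\<bar> = \<bar>poly p y\<bar> * (z ^ k * exp (- z))"
      using True z by (simp add: bump_def abs_mult z_def q_def)
    also have "\<dots> \<le> B * (real (k + 2) ^ (k + 2) * (y - x)\<^sup>2)"
      using True z by (intro mult_mono B order_trans[OF 1] mult_left_mono 2 B0) auto
    finally show ?thesis by (simp add: mult_ac)
  next
    case False
    then have "bump p k y = 0" by (auto simp: bump_def)
    then show ?thesis using B0 by simp
  qed
  show thesis by (rule that[OF main])
qed

text \<open>With \<open>q = x (1 - x)\<close>, the derivative of \<open>1 / q\<close> is
  \<open>- (1 - 2 x) / q^2\<close>; the polynomial arises by pulling the common factor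
  \<open>(1 / q)^(k + 2)\<close> out of the three product-rule terms. \<open>[:0, 1, -1:]\<close> is
  \<open>q\<close> and \<open>[:1, -2:]\<close> its derivative.\<close>

lemma bump_has_deriv:
  "(bump p k has_real_derivative
     bump (pderiv p * [:0, 1, -1:] ^ 2 - of_nat k * p * [:1, -2:] * [:0, 1, -1:]
        + p * [:1, -2:]) (k + 2) x) (at x)"
proof (cases "0 < x \<and> x < 1")
  case True
  define q where "q = x * (1 - x)"
  have q: "q > 0" using True by (simp add: q_def)
  have Dq: "((\<lambda>x. 1 / (x * (1 - x))) has_real_derivative - (1 - 2 * x) / q\<^sup>2) (at x)"
  proof -
    have "((\<lambda>x. x * (1 - x)) has_real_derivative 1 - 2 * x) (at x)"
      by (auto intro!: derivative_eq_intros)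
    from DERIV_inverse_fun[OF this] have "((\<lambda>x. inverse (x * (1 - x))) has_real_derivative
        - (inverse q * (1 - 2 * x) * inverse q)) (at x)"
      using True by (simp add: q_def mult_ac)
    also have "- (inverse q * (1 - 2 * x) * inverse q) = - (1 - 2 * x) / q\<^sup>2"
      using q by (simp add: divide_simps power2_eq_square)
    finally show ?thesis
      by (simp add: inverse_eq_divide)
  qed
  have "((\<lambda>x. poly p x * (1 / (x * (1 - x))) ^ k * exp (- (1 / (x * (1 - x))))) has_real_derivative
      (poly (pderiv p) x * (1 / q) ^ k
         + (of_nat k * (- (1 - 2 * x) / q\<^sup>2 * (1 / q) ^ (k - Suc 0))) * poly p x) * exp (- (1 / q))
      + (exp (- (1 / q)) * (- (- (1 - 2 * x) / q\<^sup>2))) * (poly p x * (1 / q) ^ k)) (at x)"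
    unfolding q_def
    by (intro DERIV_mult poly_DERIV DERIV_power DERIV_fun_exp DERIV_minus Dq[unfolded q_def])
  also have "(poly (pderiv p) x * (1 / q) ^ k
         + (of_nat k * (- (1 - 2 * x) / q\<^sup>2 * (1 / q) ^ (k - Suc 0))) * poly p x) * exp (- (1 / q))
      + (exp (- (1 / q)) * (- (- (1 - 2 * x) / q\<^sup>2))) * (poly p x * (1 / q) ^ k)
     = bump (pderiv p * [:0, 1, -1:] ^ 2 - of_nat k * p * [:1, -2:] * [:0, 1, -1:]
        + p * [:1, -2:]) (k + 2) x"
  proof -
    define r where "r = (1 / q) ^ (k + 2)"
    have a: "(1 / q) ^ k = q\<^sup>2 * r"
      using q by (simp add: r_def power_add power2_eq_square)
    \<comment> \<open>For \<open>k = 0\<close> the truncated exponent is wrong, but the factor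
      \<open>of_nat k\<close> removes the term.\<close>
    have b: "of_nat k * (c * (1 / q) ^ (k - Suc 0)) = of_nat k * (c * (q ^ 3 * r))" for c
      using q by (cases k) (auto simp: r_def power_add power2_eq_square power3_eq_cube)
    have e: "poly [:0, 1, -1:] x = q" "poly [:1, -2:] x = 1 - 2 * x"
      by (simp_all add: q_def algebra_simps)
    have alg: "(P' * (q\<^sup>2 * r) + n * (- c / q\<^sup>2 * (q ^ 3 * r)) * P) * E
        + (E * (- (- c / q\<^sup>2))) * (P * (q\<^sup>2 * r)) = (P' * q\<^sup>2 - n * P * c * q + P * c) * r * E"
      for P P' n c E :: real
      using q by (simp add: field_simps power2_eq_square power3_eq_cube)
    have "bump (pderiv p * [:0, 1, -1:] ^ 2 - of_nat k * p * [:1, -2:] * [:0, 1, -1:]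
        + p * [:1, -2:]) (k + 2) x
      = (poly (pderiv p) x * q\<^sup>2 - of_nat k * poly p x * (1 - 2 * x) * q + poly p x * (1 - 2 * x))
          * r * exp (- (1 / q))"
      unfolding bump_def if_P[OF True] poly_add poly_diff poly_mult poly_power e poly_of_nat
        q_def[symmetric] r_def by simp
    then show ?thesis
      unfolding a b alg by simp
  qed
  finally have D: "((\<lambda>x. poly p x * (1 / (x * (1 - x))) ^ k * exp (- (1 / (x * (1 - x))))) has_real_derivative
      bump (pderiv p * [:0, 1, -1:] ^ 2 - of_nat k * p * [:1, -2:] * [:0, 1, -1:]
        + p * [:1, -2:]) (k + 2) x) (at x)" .
  show ?thesis
    by (rule has_field_derivative_transform_within_open[OF D, of "{0<..<1}"])
      (use True in \<open>auto simp: bump_def\<close>)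
next
  case False
  obtain C where C: "\<And>x y. x \<le> 0 \<or> 1 \<le> x \<Longrightarrow> \<bar>bump p k y\<bar> \<le> C * (y - x)\<^sup>2"
    using bump_bound[of p k] by blast
  have x: "bump p k x = 0" "x \<le> 0 \<or> 1 \<le> x" using False by (auto simp: bump_def)
  have "((\<lambda>y. (bump p k y - bump p k x) / (y - x)) \<longlongrightarrow> 0) (at x)"
  proof (rule Lim_null_comparison[where g = "\<lambda>y. C * \<bar>y - x\<bar>"])
    show "\<forall>\<^sub>F y in at x. norm ((bump p k y - bump p k x) / (y - x)) \<le> C * \<bar>y - x\<bar>"
      using C[OF x(2)] unfolding eventually_at_filter x
      by (auto intro!: always_eventually simp: divide_le_eq power2_eq_square mult.assoc)
    show "((\<lambda>y. C * \<bar>y - x\<bar>) \<longlongrightarrow> 0) (at x)"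
      by (auto intro!: tendsto_eq_intros)
  qed
  then have "(bump p k has_real_derivative 0) (at x)"
    by (simp add: has_field_derivative_iff)
  moreover have "bump p' k' x = 0" for p' k'
    using False by (auto simp: bump_def)
  ultimately show ?thesis
    by (simp only:)
qed

lemma smooth_bump: "smooth (bump p k)"
proof (rule smooth_coinduct[of "\<lambda>f. \<exists>p k. f = bump p k"])
  fix f assume "\<exists>p k. f = bump p k"
  then obtain p k where f: "f = bump p k" by blast
  show "f differentiable_on UNIV \<and> (\<exists>p k. deriv f = bump p k)"
    unfolding f using DERIV_imp_deriv[OF bump_has_deriv[of p k]]
    by (auto simp: fun_eq_iff differentiable_on_def real_differentiable_def
        intro!: bump_has_deriv exI)
qed blast

text \<open>For negative \<open>x\<close> the interval is empty and the integral is 0, which is the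
  correct primitive because \<open>g\<close> vanishes there. So the formula is differentiable across
  0 as well.\<close>

lemma primitive_from_0:
  fixes g :: "real \<Rightarrow> real"
  assumes "continuous_on UNIV g" and "\<And>x. x \<le> 0 \<Longrightarrow> g x = 0"
  shows "((\<lambda>x. integral {0..x} g) has_real_derivative g x) (at x)"
proof (cases "x < 0")
  case True
  have "((\<lambda>x. 0) has_real_derivative g x) (at x)"
    using True assms by auto
  then show ?thesis
    by (rule has_field_derivative_transform_within_open[of _ _ _ "{..<0}"]) (use True in auto)
next
  case False
  have int: "g integrable_on {a..b}" for a b
    by (rule integrable_continuous_real) (use assms(1) continuous_on_subset in blast)
  \<comment> \<open>The base point -1 makes 0 an interior point.\<close>
  have "((\<lambda>u. integral {-1..u} g) has_vector_derivative g x) (at x within {-1..x+1})"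
    using False by (intro integral_has_vector_derivative continuous_on_subset[OF assms(1)]) auto
  then have *: "((\<lambda>u. integral {-1..u} g) has_real_derivative g x) (at x)"
    using False by (simp add: has_real_derivative_iff_has_vector_derivative at_within_Icc_at)
  show ?thesis
  proof (rule has_field_derivative_transform_within_open[OF *, of "{-1<..}"])
    fix y :: real assume "y \<in> {-1<..}"
    show "integral {-1..y} g = integral {0..y} g"
    proof (cases "y < 0")
      case True
      have "integral {-1..y} g = integral {-1..y} (\<lambda>_. 0)"
        by (rule Henstock_Kurzweil_Integration.integral_cong) (use assms True in auto)
      then show ?thesis using True by simp
    next
      case False
      have "integral {-1..0} g = integral {-1..0} (\<lambda>_. 0)"
        using Henstock_Kurzweil_Integration.integral_cong[of "{-1..0}" g "\<lambda>_. 0"] assms(2) by simp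
      then show ?thesis
        using Henstock_Kurzweil_Integration.integral_combine[of "-1" 0 y g] int False by simp
    qed
  qed (use False in auto)
qed

text \<open>\<open>\<sigma>\<close> is the normalized primitive of a bump and \<open>\<tau>\<close>
  a primitive of \<open>\<sigma>\<close>. Scaled differences of such ramps are test functions whose
  derivatives approximate differences of indicator functions. The constant \<open>C\<close> is what
  the ramp loses during its transition; it cancels in those differences.\<close>

lemma smooth_ramp:
  obtains \<sigma> \<tau> :: "real \<Rightarrow> real" and C where
    "smooth \<tau>" "\<And>x. (\<tau> has_real_derivative \<sigma> x) (at x)" "continuous_on UNIV \<sigma>"
    "\<And>x. 0 \<le> \<sigma> x \<and> \<sigma> x \<le> 1" "\<And>x. x \<le> 0 \<Longrightarrow> \<sigma> x = 0" "\<And>x. x \<ge> 1 \<Longrightarrow> \<sigma> x = 1"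
    "\<And>x. x \<le> 0 \<Longrightarrow> \<tau> x = 0" "\<And>x. x \<ge> 1 \<Longrightarrow> \<tau> x = x - C"
proof -
  define b where "b = bump 1 0"
  have b: "smooth b" "\<And>x. b x \<ge> 0" "\<And>x. x \<le> 0 \<Longrightarrow> b x = 0" "\<And>x. x \<ge> 1 \<Longrightarrow> b x = 0" "b (1/2) > 0"
    by (auto simp: b_def smooth_bump bump_def)
  have cont: "continuous_on UNIV f" if "\<And>x. (f has_real_derivative f' x) (at x)" for f f'
    using that by (meson DERIV_isCont continuous_at_imp_continuous_on)
  have bc: "continuous_on UNIV b" by (rule cont[OF smooth_has_deriv[OF b(1)]])
  have int: "b integrable_on {x..y}" for x y
    by (rule integrable_continuous_real) (use bc continuous_on_subset in blast)
  define I where "I = integral {0..1} b"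
  have "I \<noteq> 0"
  proof
    assume "I = 0"
    then have "(b has_integral 0) (cbox 0 1)"
      using int[of 0 1] unfolding I_def by (metis box_real(2) integrable_integral)
    then have "b (1/2) = 0"
      by (rule has_integral_0_cbox_imp_0[rotated 2]) (use b bc in \<open>auto intro: continuous_on_subset\<close>)
    then show False using b by simp
  qed
  moreover have "I \<ge> 0" unfolding I_def by (rule integral_nonneg[OF int]) (use b in auto)
  ultimately have I: "I > 0" by simp
  define \<sigma> where "\<sigma> x = integral {0..x} b / I" for x
  define \<tau> where "\<tau> x = integral {0..x} \<sigma>" for x
  have D\<sigma>: "(\<sigma> has_real_derivative b x / I) (at x)" for x
    unfolding \<sigma>_def by (intro DERIV_cdivide primitive_from_0 bc b)
  have sc: "continuous_on UNIV \<sigma>" by (rule cont[OF D\<sigma>])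
  have s1: "\<sigma> x = 1" if "x \<ge> 1" for x
  proof -
    have "integral {1..x} b = integral {1..x} (\<lambda>_. 0)"
      using b by (intro Henstock_Kurzweil_Integration.integral_cong) auto
    then have "integral {0..x} b = I"
      using Henstock_Kurzweil_Integration.integral_combine[of 0 1 x b] int that by (simp add: I_def)
    then show ?thesis using I by (simp add: \<sigma>_def)
  qed
  have s0: "\<sigma> x = 0" if "x \<le> 0" for x
    using that by (cases "x = 0") (auto simp: \<sigma>_def)
  have mono: "\<sigma> x \<le> \<sigma> y" if "x \<le> y" for x y
    by (rule DERIV_nonneg_imp_nondecreasing[OF that]) (use D\<sigma> b I in \<open>auto intro!: exI\<close>)
  have s01: "0 \<le> \<sigma> x \<and> \<sigma> x \<le> 1" for x
    using mono[of "min x 0" x] mono[of x "max x 1"] s0[of "min x 0"] s1[of "max x 1"] by auto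
  have D\<tau>: "(\<tau> has_real_derivative \<sigma> x) (at x)" for x
    unfolding \<tau>_def by (intro primitive_from_0 sc s0)
  have "smooth \<tau>"
    by (rule smooth_of_deriv[OF D\<tau> smooth_of_deriv[OF D\<sigma>]])
       (use smooth_affine[OF b(1), of "1/I" 1 0] in simp)
  moreover have "\<tau> x = x - (1 - \<tau> 1)" if "x \<ge> 1" for x
  proof -
    have int\<sigma>: "\<sigma> integrable_on {x..y}" for x y
      by (rule integrable_continuous_real) (use sc continuous_on_subset in blast)
    have "integral {1..x} \<sigma> = integral {1..x} (\<lambda>_. 1)"
      using s1 by (intro Henstock_Kurzweil_Integration.integral_cong) auto
    then show ?thesis
      using Henstock_Kurzweil_Integration.integral_combine[of 0 1 x \<sigma>] int\<sigma> that by (simp add: \<tau>_def)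
  qed
  moreover have "\<tau> x = 0" if "x \<le> 0" for x
    using that by (cases "x = 0") (auto simp: \<tau>_def)
  ultimately show thesis
    using that[of \<tau> \<sigma> "1 - \<tau> 1"] D\<tau> sc s01 s0 s1 by blast
qed

section \<open>Weak derivatives and absolutely continuous functions\<close>

lemma AE_unit_leb_iff:
  "(AE x in unit_leb. P x) \<longleftrightarrow> (\<exists>N. negligible N \<and> (\<forall>x\<in>{0<..<1} - N. P x))"
proof
  assume "AE x in unit_leb. P x"
  then have "AE x in lebesgue. x \<in> {0<..<1} \<longrightarrow> P x"
    by (subst (asm) AE_restrict_space_iff) auto
  then obtain N where "{x \<in> space lebesgue. \<not> (x \<in> {0<..<1} \<longrightarrow> P x)} \<subseteq> N"
      "emeasure lebesgue N = 0" "N \<in> sets lebesgue"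
    by (rule AE_E)
  then show "\<exists>N. negligible N \<and> (\<forall>x\<in>{0<..<1} - N. P x)"
    by (intro exI[of _ N]) (auto simp: negligible_iff_null_sets null_sets_def)
next
  assume "\<exists>N. negligible N \<and> (\<forall>x\<in>{0<..<1} - N. P x)"
  then obtain N where N: "negligible N" "\<And>x. x \<in> {0<..<1} - N \<Longrightarrow> P x" by blast
  then have "AE x in lebesgue. x \<notin> N"
    by (intro AE_not_in) (simp add: negligible_iff_null_sets)
  then have "AE x in lebesgue. x \<in> {0<..<1} \<longrightarrow> P x"
    by eventually_elim (use N in auto)
  then show "AE x in unit_leb. P x"
    by (subst AE_restrict_space_iff) auto
qed

lemma AE_unit_lebI: "(\<And>x. 0 < x \<Longrightarrow> x < 1 \<Longrightarrow> P x) \<Longrightarrow> AE x in unit_leb. P x"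
  by (rule AE_I2) (simp add: space_restrict_space)

lemma indicator_integral_unit_leb:
  fixes p :: "real \<Rightarrow> 'a::euclidean_space"
  assumes "p absolutely_integrable_on S" "S \<in> sets lebesgue" "S \<subseteq> {0<..<1}"
  shows "integrable unit_leb (\<lambda>x. indicator S x *\<^sub>R p x)"
    and "(LINT x|unit_leb. indicator S x *\<^sub>R p x) = integral S p"
proof -
  have eq: "(\<lambda>x. (indicat_real {0<..<1} x * indicat_real S x) *\<^sub>R p x) = (\<lambda>x. indicat_real S x *\<^sub>R p x)"
    using assms(3) by (auto simp: fun_eq_iff indicator_def)
  show "integrable unit_leb (\<lambda>x. indicator S x *\<^sub>R p x)"
    using assms(1) by (subst integrable_restrict_space) (auto simp: eq set_integrable_def)
  show "(LINT x|unit_leb. indicator S x *\<^sub>R p x) = integral S p"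
    using set_lebesgue_integral_eq_integral(2)[OF assms(1)]
    by (subst integral_restrict_space) (auto simp: eq set_lebesgue_integral_def)
qed

lemma integrable_unit_leb_iff: "integrable unit_leb f \<longleftrightarrow> f absolutely_integrable_on {0<..<1}"
  by (subst integrable_restrict_space) (auto simp: set_integrable_def)

lemma integral_unit_leb:
  fixes f :: "real \<Rightarrow> 'a::euclidean_space"
  shows "integrable unit_leb f \<Longrightarrow> (LINT x|unit_leb. f x) = integral {0<..<1} f"
  by (rule lebesgue_integral_eq_integral) auto

lemma locally_integrable_iff:
  "locally_integrable p \<longleftrightarrow> (\<forall>a b. 0 < a \<longrightarrow> b < 1 \<longrightarrow> p absolutely_integrable_on {a..b})"
proof
  assume p: "locally_integrable p"
  show "\<forall>a b. 0 < a \<longrightarrow> b < 1 \<longrightarrow> p absolutely_integrable_on {a..b}"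
  proof (intro allI impI)
    fix a b :: real assume "0 < a" "b < 1"
    then have "compact {a..b}" "{a..b} \<subseteq> {0<..<1}" by auto
    then show "p absolutely_integrable_on {a..b}"
      using p unfolding locally_integrable_def by blast
  qed
next
  assume p: "\<forall>a b. 0 < a \<longrightarrow> b < 1 \<longrightarrow> p absolutely_integrable_on {a..b}"
  show "locally_integrable p"
    unfolding locally_integrable_def
  proof (intro allI impI)
    fix K :: "real set" assume K: "compact K \<and> K \<subseteq> {0<..<1}"
    show "p absolutely_integrable_on K"
    proof (cases "K = {}")
      case False
      obtain a where a: "a \<in> K" "\<And>x. x \<in> K \<Longrightarrow> a \<le> x"
        using compact_attains_inf[of K] K False by blast
      obtain b where b: "b \<in> K" "\<And>x. x \<in> K \<Longrightarrow> x \<le> b"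
        using compact_attains_sup[of K] K False by blast
      have "0 < a" "b < 1"
        using a(1) b(1) K by auto
      then have "p absolutely_integrable_on {a..b}"
        using p by blast
      then show ?thesis
        by (rule set_integrable_subset) (use a b K in \<open>auto simp: compact_imp_closed borel_closed\<close>)
    qed auto
  qed
qed

lemma locally_integrableD:
  "locally_integrable p \<Longrightarrow> 0 < a \<Longrightarrow> b < 1 \<Longrightarrow> p absolutely_integrable_on {a..b}"
  by (simp add: locally_integrable_iff)

text \<open>Lebesgue differentiation is applied to the truncations of \<open>p\<close> to countably
  many compact intervals exhausting the open interval; the exceptional sets are then united.\<close>

lemma locally_integrable_averages:
  assumes p: "locally_integrable p"
  obtains N where "negligible N"
    "\<And>x e. x \<in> {0<..<1} - N \<Longrightarrow> e > 0 \<Longrightarrow>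
       \<exists>d>0. \<forall>h. 0 < h \<and> h < d \<longrightarrow> norm (integral {x..x+h} p /\<^sub>R h - p x) < e"
proof -
  define K where "K n = {1 / real (n + 2)..1 - 1 / real (n + 2)}" for n
  define q where "q n x = (if x \<in> K n then p x else 0)" for n x
  have "\<exists>N. negligible N \<and> (\<forall>x e. x \<notin> N \<and> 0 < e \<longrightarrow>
      (\<exists>d>0. \<forall>h. 0 < h \<and> h < d \<longrightarrow> norm (integral {x..x+h} (q n) /\<^sub>R h - q n x) < e))" for n
  proof -
    have "p absolutely_integrable_on K n"
      unfolding K_def by (rule locally_integrableD[OF p]) auto
    then have "q n absolutely_integrable_on UNIV"
      unfolding q_def by (simp add: absolutely_integrable_restrict_UNIV)
    then have "q n integrable_on UNIV"
      by (rule set_lebesgue_integral_eq_integral(1))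
    then have "q n integrable_on cbox a b" for a b
      by (rule integrable_on_subcbox) auto
    from integrable_ccontinuous_explicit[OF this] obtain N where "negligible N"
      "\<And>x e. x \<notin> N \<Longrightarrow> 0 < e \<Longrightarrow> \<exists>d>0. \<forall>h. 0 < h \<and> h < d \<longrightarrow>
         norm (integral (cbox x (x + h *\<^sub>R One)) (q n) /\<^sub>R h ^ DIM(real) - q n x) < e"
      by blast
    then show ?thesis
      by (intro exI[of _ N]) simp
  qed
  then obtain N where N: "\<And>n. negligible (N n)"
    "\<And>n x e. x \<notin> N n \<Longrightarrow> 0 < e \<Longrightarrow>
      \<exists>d>0. \<forall>h. 0 < h \<and> h < d \<longrightarrow> norm (integral {x..x+h} (q n) /\<^sub>R h - q n x) < e"
    by metis
  show thesis
  proof (rule that)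
    show "negligible (\<Union>n. N n)"
      using N(1) by blast
    fix x e :: real assume x: "x \<in> {0<..<1} - (\<Union>n. N n)" and e: "e > 0"
    obtain n where n: "1 / real (n + 2) < min x (1 - x)"
    proof -
      obtain n where "inverse (real (Suc n)) < min x (1 - x)"
        using reals_Archimedean[of "min x (1 - x)"] x by auto
      moreover have "1 / real (n + 2) \<le> inverse (real (Suc n))"
        by (simp add: divide_simps)
      ultimately have "1 / real (n + 2) < min x (1 - x)" by linarith
      then show thesis by (rule that)
    qed
    obtain d where d: "d > 0" "\<And>h. 0 < h \<Longrightarrow> h < d \<Longrightarrow> norm (integral {x..x+h} (q n) /\<^sub>R h - q n x) < e"
      using N(2)[of x n e] x e by blast
    show "\<exists>d>0. \<forall>h. 0 < h \<and> h < d \<longrightarrow> norm (integral {x..x+h} p /\<^sub>R h - p x) < e"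
    proof (intro exI[of _ "min d (1 - x - 1 / real (n + 2))"] conjI allI impI)
      show "0 < min d (1 - x - 1 / real (n + 2))" using n d by auto
      fix h assume h: "0 < h \<and> h < min d (1 - x - 1 / real (n + 2))"
      have "{x..x+h} \<subseteq> K n" "x \<in> K n" using n h by (auto simp: K_def)
      then have "integral {x..x+h} (q n) = integral {x..x+h} p" "q n x = p x"
        using h by (auto intro!: Henstock_Kurzweil_Integration.integral_cong simp: q_def)
      then show "norm (integral {x..x+h} p /\<^sub>R h - p x) < e"
        using d(2)[of h] h by auto
    qed
  qed
qed

text \<open>At any two Lebesgue points the averages over intervals of the same length agree, and
  they converge to the two values of \<open>p\<close>.\<close>

lemma AE_const_of_equal_integrals:
  assumes p: "locally_integrable p"
    and eq: "\<And>a c h. 0 < a \<Longrightarrow> 0 < c \<Longrightarrow> 0 < h \<Longrightarrow> a + h < 1 \<Longrightarrow> c + h < 1 \<Longrightarrow>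
       integral {a..a+h} p = integral {c..c+h} p"
  obtains k where "AE x in unit_leb. p x = k"
proof -
  obtain N where N: "negligible N"
    "\<And>x e. x \<in> {0<..<1} - N \<Longrightarrow> e > 0 \<Longrightarrow>
       \<exists>d>0. \<forall>h. 0 < h \<and> h < d \<longrightarrow> norm (integral {x..x+h} p /\<^sub>R h - p x) < e"
    using locally_integrable_averages[OF p] by metis
  have same: "p x = p y" if x: "x \<in> {0<..<1} - N" and y: "y \<in> {0<..<1} - N" for x y
  proof (rule ccontr)
    assume "p x \<noteq> p y"
    then have e: "norm (p x - p y) / 2 > 0" by simp
    obtain d where d: "d > 0"
      "\<And>h. 0 < h \<Longrightarrow> h < d \<Longrightarrow> norm (integral {x..x+h} p /\<^sub>R h - p x) < norm (p x - p y) / 2"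
      using N(2)[OF x e] by blast
    obtain d' where d': "d' > 0"
      "\<And>h. 0 < h \<Longrightarrow> h < d' \<Longrightarrow> norm (integral {y..y+h} p /\<^sub>R h - p y) < norm (p x - p y) / 2"
      using N(2)[OF y e] by blast
    define h where "h = min (min d d') (min (1 - x) (1 - y)) / 2"
    have h0: "0 < h" "h \<le> d / 2" "h \<le> d' / 2" "h \<le> (1 - x) / 2" "h \<le> (1 - y) / 2"
      using d(1) d'(1) x y by (simp_all add: h_def)
    have h: "0 < h" "h < d" "h < d'" "x + h < 1" "y + h < 1"
      using h0 d(1) d'(1) x y by auto
    have "integral {x..x+h} p = integral {y..y+h} p"
      using x y h by (intro eq) auto
    then have "norm (p x - p y) < norm (p x - p y) / 2 + norm (p x - p y) / 2"
      using d(2)[OF h(1,2)] d'(2)[OF h(1,3)]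
      by (metis norm_diff_triangle_less norm_minus_commute)
    then show False by simp
  qed
  show thesis
  proof (cases "{0<..<1} - N = {}")
    case True
    then show ?thesis
      using N(1) that[of 0] unfolding AE_unit_leb_iff by blast
  next
    case False
    then obtain x where "x \<in> {0<..<1} - N" by blast
    then show ?thesis
      using N(1) that[of "p x"] same unfolding AE_unit_leb_iff by blast
  qed
qed

lemma AE_zero_of_zero_integrals:
  assumes p: "locally_integrable p"
    and zero: "\<And>a b. 0 < a \<Longrightarrow> a < b \<Longrightarrow> b < 1 \<Longrightarrow> integral {a..b} p = 0"
  shows "AE x in unit_leb. p x = 0"
proof -
  obtain k where k: "AE x in unit_leb. p x = k"
    by (rule AE_const_of_equal_integrals[OF p]) (use zero in auto)
  then obtain N where N: "negligible N" "\<forall>x\<in>{0<..<1} - N. p x = k"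
    unfolding AE_unit_leb_iff by blast
  have "integral {1/4..3/4::real} (\<lambda>x. k) = integral {1/4..3/4} p"
    by (rule integral_spike[OF N(1)]) (use N(2) in auto)
  then have "k = 0"
    using zero[of "1/4" "3/4"] by simp
  with k show ?thesis by simp
qed

section \<open>The du Bois-Reymond lemma\<close>

lemma test_functionI:
  assumes "smooth \<phi>" and "0 < a" "b < 1" "\<And>x. x \<le> a \<Longrightarrow> \<phi> x = 0" "\<And>x. x \<ge> b \<Longrightarrow> \<phi> x = 0"
  shows "test_function \<phi>"
  unfolding test_function_def
proof (intro conjI exI[of _ "{a..b}"] allI impI)
  show "(deriv ^^ n) \<phi> differentiable_on UNIV" for n
    using assms(1) by (simp add: smooth_def)
  show "{a..b} \<subseteq> {0<..<1}" using assms by auto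
  show "\<phi> x = 0" if "x \<notin> {a..b}" for x
    using that assms(4,5)[of x] by force
qed auto

text \<open>Derivatives of test functions have mean zero, so a single indicator cannot be
  approximated by them boundedly. The difference of the indicators of two intervals of equal length
  can, and this yields equality of the two integrals of \<open>p\<close>.\<close>

lemma du_Bois_Reymond:
  assumes p: "locally_integrable p"
    and zero: "\<And>\<phi>. test_function \<phi> \<Longrightarrow> (LINT x|unit_leb. deriv \<phi> x *\<^sub>R p x) = 0"
  obtains k where "AE x in unit_leb. p x = k"
proof (rule AE_const_of_equal_integrals[OF p])
  fix a c h :: real assume ac: "0 < a" "0 < c" "0 < h" "a + h < 1" "c + h < 1"
  obtain \<sigma> \<tau> :: "real \<Rightarrow> real" and C where
    ramp: "smooth \<tau>" "\<And>x. (\<tau> has_real_derivative \<sigma> x) (at x)" "continuous_on UNIV \<sigma>"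
    "\<And>x. 0 \<le> \<sigma> x \<and> \<sigma> x \<le> 1" "\<And>x. x \<le> 0 \<Longrightarrow> \<sigma> x = 0" "\<And>x. x \<ge> 1 \<Longrightarrow> \<sigma> x = 1"
    "\<And>x. x \<le> 0 \<Longrightarrow> \<tau> x = 0" "\<And>x. x \<ge> 1 \<Longrightarrow> \<tau> x = x - C"
    using smooth_ramp by metis
  define m where "m = min a c"
  define M where "M = (1 + (max a c + h)) / 2"
  \<comment> \<open>The transition starting at \<open>y\<close> ends at \<open>y + e n\<close>; this
    choice keeps the rightmost one below \<open>M\<close>.\<close>
  define e where "e n = (M - (max a c + h)) / real (Suc n)" for n
  have mM: "0 < m" "M < 1" "max a c + h < M" using ac by (auto simp: m_def M_def)
  have e: "e n > 0" "max a c + h + e n \<le> M" for n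
  proof -
    show "e n > 0" using mM by (simp add: e_def)
    have "e n \<le> M - (max a c + h)"
      using mM divide_left_mono[of 1 "real (Suc n)" "M - (max a c + h)"] by (simp add: e_def)
    then show "max a c + h + e n \<le> M" by simp
  qed
  have e0: "e \<longlonglongrightarrow> 0"
    unfolding e_def by (rule LIMSEQ_Suc[OF lim_const_over_n])
  \<comment> \<open>Each ramp has slope 0 before its corner and slope 1 after its transition. Beyond
    \<open>M\<close> the four lines cancel in slope and in intercept, because both intervals have
    length \<open>h\<close>.\<close>
  define \<phi> where "\<phi> n x = e n * \<tau> (1 / e n * x + (- a / e n)) + (- e n * \<tau> (1 / e n * x + (- (a + h) / e n))
     + (- e n * \<tau> (1 / e n * x + (- c / e n)) + e n * \<tau> (1 / e n * x + (- (c + h) / e n))))" for n x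
  define s where "s n x = \<sigma> (1 / e n * x + (- a / e n)) - \<sigma> (1 / e n * x + (- (a + h) / e n))
     - \<sigma> (1 / e n * x + (- c / e n)) + \<sigma> (1 / e n * x + (- (c + h) / e n))" for n x
  have arg: "1 / e n * x + (- y / e n) = (x - y) / e n" for n x y
    by (simp add: diff_divide_distrib)
  have small: "(x - y) / e n \<le> 0" if "x \<le> m" "y \<in> {a, a + h, c, c + h}" for x y n
    using that e(1)[of n] ac by (auto simp: m_def divide_le_0_iff)
  have large: "(x - y) / e n \<ge> 1" if "x \<ge> M" "y \<in> {a, a + h, c, c + h}" for x y n
    using that e[of n] ac by (auto simp: le_divide_eq)
  have test: "test_function (\<phi> n)" for n
  proof (rule test_functionI[of _ m M])
    show "smooth (\<phi> n)"
      unfolding \<phi>_def by (intro smooth_add smooth_affine ramp(1))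
    show "\<phi> n x = 0" if "x \<le> m" for x
      unfolding \<phi>_def arg using small[OF that] ramp(7) by simp
    show "\<phi> n x = 0" if "x \<ge> M" for x
    proof -
      have t: "e n * \<tau> ((x - y) / e n) = x - y - e n * C" if "y \<in> {a, a + h, c, c + h}" for y
        using e(1)[of n] ramp(8)[OF large[OF \<open>x \<ge> M\<close> that], of n] by (simp add: field_simps)
      show ?thesis
        unfolding \<phi>_def arg using t[of a] t[of "a + h"] t[of c] t[of "c + h"] by simp
    qed
  qed (use mM in auto)
  have deriv: "deriv (\<phi> n) x = s n x" for n x
  proof (rule DERIV_imp_deriv)
    have e0': "e n \<noteq> 0" using e(1)[of n] by linarith
    have *: "((\<lambda>x. k * \<tau> (1 / e n * x + y)) has_real_derivative k * (\<sigma> (1 / e n * x + y) * (1 / e n))) (at x)" for k y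
      by (intro DERIV_cmult DERIV_chain2[OF ramp(2)]) (auto intro!: derivative_eq_intros simp: e0')
    have "(\<phi> n has_real_derivative
        e n * (\<sigma> (1 / e n * x + (- a / e n)) * (1 / e n))
        + (- e n * (\<sigma> (1 / e n * x + (- (a + h) / e n)) * (1 / e n))
        + (- e n * (\<sigma> (1 / e n * x + (- c / e n)) * (1 / e n))
        + e n * (\<sigma> (1 / e n * x + (- (c + h) / e n)) * (1 / e n))))) (at x)"
      unfolding \<phi>_def by (rule DERIV_add *)+
    then show "(\<phi> n has_real_derivative s n x) (at x)"
      using e0' by (simp add: s_def algebra_simps)
  qed
  \<comment> \<open>All \<open>s n\<close> vanish outside \<open>{m..M}\<close>, so cutting
    \<open>p\<close> there changes no product and supplies the integrable majorant.\<close>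
  define p0 where "p0 x = indicator {m..M} x *\<^sub>R p x" for x
  have "p absolutely_integrable_on {m..M}"
    using mM by (intro locally_integrableD[OF p]) auto
  then have p0: "integrable unit_leb p0"
    unfolding p0_def by (intro indicator_integral_unit_leb) (use mM in auto)
  have s_out: "s n x = 0" if "x \<notin> {m..M}" for n x
  proof (cases "x \<le> m")
    case True
    then show ?thesis unfolding s_def arg using small[OF True] ramp(5) by simp
  next
    case False
    then have "x \<ge> M" using that by auto
    then show ?thesis unfolding s_def arg using large ramp(6) by simp
  qed
  have s_meas: "s n \<in> borel_measurable unit_leb" for n
  proof -
    have "continuous_on UNIV (s n)"
      unfolding s_def by (intro continuous_intros continuous_on_compose2[OF ramp(3)]) auto
    then show ?thesis
      by (intro continuous_imp_measurable_on_sets_lebesgue) (auto intro: continuous_on_subset)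
  qed
  \<comment> \<open>At a corner the step is 0 for every \<open>n\<close>, hence the limiting
    intervals are open on the left.\<close>
  define s0 where "s0 x = indicator {a<..a+h} x - (indicator {c<..c+h} x :: real)" for x
  have step: "(\<lambda>n. \<sigma> (1 / e n * x + (- y / e n))) \<longlonglongrightarrow> (if y < x then 1 else 0)" for x y
  proof (cases "y < x")
    case True
    have "\<forall>\<^sub>F n in sequentially. e n < x - y"
      using e0 True by (intro order_tendstoD) auto
    then have "\<forall>\<^sub>F n in sequentially. \<sigma> (1 / e n * x + (- y / e n)) = 1"
    proof eventually_elim
      case (elim n)
      then show ?case
        unfolding arg using e(1)[of n] by (intro ramp(6)) (simp add: le_divide_eq)
    qed
    then show ?thesis using True by (simp add: tendsto_eventually)
  next
    case False
    then have "\<sigma> (1 / e n * x + (- y / e n)) = 0" for n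
      unfolding arg using e(1)[of n] by (intro ramp(5)) (simp add: divide_le_0_iff)
    then show ?thesis using False by simp
  qed
  have s_lim: "(\<lambda>n. s n x) \<longlonglongrightarrow> s0 x" for x
  proof -
    have "(\<lambda>n. s n x) \<longlonglongrightarrow> (if a < x then 1 else 0) - (if a + h < x then 1 else 0)
        - (if c < x then 1 else 0) + (if c + h < x then 1 else 0)"
      unfolding s_def by (intro tendsto_intros step)
    also have "(if a < x then 1 else 0) - (if a + h < x then 1 else 0)
        - (if c < x then 1 else 0) + (if c + h < x then 1 else 0) = s0 x"
      using ac by (auto simp: s0_def indicator_def)
    finally show ?thesis .
  qed
  have "(\<lambda>n. LINT x|unit_leb. s n x *\<^sub>R p0 x) \<longlonglongrightarrow> (LINT x|unit_leb. s0 x *\<^sub>R p0 x)"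
  proof (rule integral_dominated_convergence[where w = "\<lambda>x. 4 * norm (p0 x)"])
    have "s0 \<in> borel_measurable lborel"
      unfolding s0_def by measurable
    then have "s0 \<in> borel_measurable unit_leb"
      by (intro measurable_restrict_space1 measurable_completion)
    then show "(\<lambda>x. s0 x *\<^sub>R p0 x) \<in> borel_measurable unit_leb"
      using p0 by (intro borel_measurable_scaleR) auto
    show "(\<lambda>x. s n x *\<^sub>R p0 x) \<in> borel_measurable unit_leb" for n
      using p0 s_meas by (intro borel_measurable_scaleR) auto
    show "integrable unit_leb (\<lambda>x. 4 * norm (p0 x))"
      using p0 by simp
    show "AE x in unit_leb. (\<lambda>n. s n x *\<^sub>R p0 x) \<longlonglongrightarrow> s0 x *\<^sub>R p0 x"
      by (intro always_eventually allI tendsto_intros s_lim)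
    have "\<bar>s n x\<bar> \<le> 4" for n x
      unfolding s_def using ramp(4) by (smt (verit))
    then show "AE x in unit_leb. norm (s n x *\<^sub>R p0 x) \<le> 4 * norm (p0 x)" for n
      by (auto intro!: always_eventually mult_right_mono)
  qed
  moreover have "(LINT x|unit_leb. s n x *\<^sub>R p0 x) = 0" for n
  proof -
    have "(\<lambda>x. s n x *\<^sub>R p0 x) = (\<lambda>x. deriv (\<phi> n) x *\<^sub>R p x)"
      using s_out[of _ n] by (auto simp: fun_eq_iff deriv p0_def indicator_def)
    then show ?thesis using zero[OF test] by simp
  qed
  ultimately have lim: "(LINT x|unit_leb. s0 x *\<^sub>R p0 x) = 0"
    by (simp add: LIMSEQ_const_iff)
  have piece: "integrable unit_leb (\<lambda>x. indicator {y<..y+h} x *\<^sub>R p x)"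
      "(LINT x|unit_leb. indicator {y<..y+h} x *\<^sub>R p x) = integral {y..y+h} p" if "y \<in> {a, c}" for y
  proof -
    have "p absolutely_integrable_on {y..y+h}"
      using that ac by (intro locally_integrableD[OF p]) auto
    then have *: "p absolutely_integrable_on {y<..y+h}"
      by (rule set_integrable_subset) auto
    have "integral {y<..y+h} p = integral {y..y+h} p"
      by (rule integral_subset_negligible) (auto intro: negligible_subset[of "{y}"])
    moreover have "{y<..y+h} \<subseteq> {0<..<1}" using that ac by auto
    ultimately show "integrable unit_leb (\<lambda>x. indicator {y<..y+h} x *\<^sub>R p x)"
      "(LINT x|unit_leb. indicator {y<..y+h} x *\<^sub>R p x) = integral {y..y+h} p"
      using indicator_integral_unit_leb[OF *] that ac by auto
  qed
  have "(\<lambda>x. s0 x *\<^sub>R p0 x) = (\<lambda>x. indicator {a<..a+h} x *\<^sub>R p x - indicator {c<..c+h} x *\<^sub>R p x)"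
    using ac mM by (auto simp: fun_eq_iff s0_def p0_def indicator_def m_def)
  then show "integral {a..a+h} p = integral {c..c+h} p"
    using lim piece[of a] piece[of c] by simp
qed (rule that)

section \<open>Calculus of locally absolutely continuous functions\<close>

text \<open>Local absolute continuity in integral form. Only compact subintervals of the open
  interval enter, so functions that are singular at 0, such as negative powers, are included;
  \<open>f\<close> matters up to null sets, \<open>F\<close> pointwise.\<close>

definition ac_deriv :: "(real \<Rightarrow> complex) \<Rightarrow> (real \<Rightarrow> complex) \<Rightarrow> bool" where
  "ac_deriv F f \<longleftrightarrow> (\<forall>a b. 0 < a \<longrightarrow> a \<le> b \<longrightarrow> b < 1 \<longrightarrow>
     f absolutely_integrable_on {a..b} \<and> F b - F a = integral {a..b} f)"

lemma ac_deriv_integral: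
  "ac_deriv F f \<Longrightarrow> 0 < a \<Longrightarrow> a \<le> b \<Longrightarrow> b < 1 \<Longrightarrow> F b - F a = integral {a..b} f"
  by (simp add: ac_deriv_def)

lemma ac_deriv_locally_integrable: "ac_deriv F f \<Longrightarrow> locally_integrable f"
  unfolding locally_integrable_iff
proof (intro allI impI)
  fix a b :: real assume "ac_deriv F f" "0 < a" "b < 1"
  then show "f absolutely_integrable_on {a..b}"
    by (cases "a \<le> b") (auto simp: ac_deriv_def)
qed

lemma ac_deriv_continuous:
  assumes "ac_deriv F f"
  shows "continuous_on {0<..<1} F"
proof (rule continuous_at_imp_continuous_on, intro ballI)
  fix x :: real assume x: "x \<in> {0<..<1}"
  define a b where "a = x / 2" and "b = (1 + x) / 2"
  have ab: "0 < a" "a < x" "x < b" "b < 1" using x by (auto simp: a_def b_def)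
  have "f absolutely_integrable_on {a..b}"
    using assms ab by (simp add: ac_deriv_def)
  then have "f integrable_on {a..b}"
    by (rule set_lebesgue_integral_eq_integral(1))
  then have "continuous_on {a..b} (\<lambda>x. F a + integral {a..x} f)"
    by (intro continuous_intros indefinite_integral_continuous_1)
  moreover have "F a + integral {a..y} f = F y" if "y \<in> {a..b}" for y
    using ac_deriv_integral[OF assms, of a y] that ab by (simp add: algebra_simps)
  ultimately have "continuous_on {a..b} F"
    by (rule continuous_on_eq)
  then show "isCont F x"
    by (rule continuous_on_interior) (use ab in auto)
qed

lemma continuous_borel_measurable_unit_leb:
  fixes F :: "real \<Rightarrow> 'a::euclidean_space"
  shows "continuous_on {0<..<1} F \<Longrightarrow> F \<in> borel_measurable unit_leb"
  by (rule continuous_imp_measurable_on_sets_lebesgue) auto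

lemma locally_integrable_mult_continuous:
  assumes f: "locally_integrable f" and G: "continuous_on {0<..<1} G"
  shows "locally_integrable (\<lambda>x. f x * G x)"
  unfolding locally_integrable_iff
proof (intro allI impI)
  fix a b :: real assume ab: "0 < a" "b < 1"
  have c: "continuous_on {a..b} G"
    using G by (rule continuous_on_subset) (use ab in auto)
  have "(\<lambda>x. G x * f x) absolutely_integrable_on {a..b}"
  proof (rule absolutely_integrable_bounded_measurable_product[OF bilinear_times])
    show "G \<in> borel_measurable (lebesgue_on {a..b})"
      by (rule continuous_imp_measurable_on_sets_lebesgue[OF c]) auto
    show "bounded (G ` {a..b})"
      by (intro compact_imp_bounded compact_continuous_image c) auto
  qed (use locally_integrableD[OF f ab] in auto)
  then show "(\<lambda>x. f x * G x) absolutely_integrable_on {a..b}"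
    by (simp add: mult.commute)
qed

lemma locally_integrable_continuous:
  assumes "continuous_on {0<..<1} F"
  shows "locally_integrable F"
  unfolding locally_integrable_iff
  by (intro allI impI absolutely_integrable_continuous_real continuous_on_subset[OF assms]) auto

lemma locally_integrable_add:
  "locally_integrable f \<Longrightarrow> locally_integrable g \<Longrightarrow> locally_integrable (\<lambda>x. f x + g x)"
  unfolding locally_integrable_def by (auto intro: set_integral_add)

lemma locally_integrable_diff:
  "locally_integrable f \<Longrightarrow> locally_integrable g \<Longrightarrow> locally_integrable (\<lambda>x. f x - g x)"
  unfolding locally_integrable_def by (auto intro: set_integral_diff)

lemma locally_integrable_cmult:
  "locally_integrable f \<Longrightarrow> locally_integrable (\<lambda>x. c * f x)"
  unfolding locally_integrable_def by (auto intro: set_integrable_mult_right)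

lemma locally_integrable_AE_cong:
  assumes "locally_integrable f" "AE x in unit_leb. f x = g x"
  shows "locally_integrable g"
proof -
  obtain N where N: "negligible N" "\<forall>x\<in>{0<..<1} - N. f x = g x"
    using assms(2) unfolding AE_unit_leb_iff by blast
  show ?thesis
    unfolding locally_integrable_iff
  proof (intro allI impI)
    fix a b :: real assume ab: "0 < a" "b < 1"
    show "g absolutely_integrable_on {a..b}"
      by (rule absolutely_integrable_spike[OF locally_integrableD[OF assms(1) ab] N(1)])
        (use N(2) ab in auto)
  qed
qed

lemma locally_integrable_integrable_on:
  "locally_integrable f \<Longrightarrow> 0 < a \<Longrightarrow> b < 1 \<Longrightarrow> f integrable_on {a..b}"
  by (intro set_lebesgue_integral_eq_integral(1) locally_integrableD)

lemma ac_derivI: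
  assumes "locally_integrable f"
    and "\<And>a b. 0 < a \<Longrightarrow> a < b \<Longrightarrow> b < 1 \<Longrightarrow> F b - F a = integral {a..b} f"
  shows "ac_deriv F f"
  unfolding ac_deriv_def
proof (intro allI impI conjI)
  fix a b :: real assume ab: "0 < a" "a \<le> b" "b < 1"
  then show "f absolutely_integrable_on {a..b}"
    by (intro locally_integrableD[OF assms(1)])
  show "F b - F a = integral {a..b} f"
    using assms(2)[of a b] ab by (cases "a = b") auto
qed

lemma ac_deriv_add:
  assumes "ac_deriv F f" "ac_deriv G g"
  shows "ac_deriv (\<lambda>x. F x + G x) (\<lambda>x. f x + g x)"
proof (rule ac_derivI)
  note li = ac_deriv_locally_integrable[OF assms(1)] ac_deriv_locally_integrable[OF assms(2)]
  show "locally_integrable (\<lambda>x. f x + g x)"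
    by (intro locally_integrable_add li)
  fix a b :: real assume ab: "0 < a" "a < b" "b < 1"
  have "integral {a..b} (\<lambda>x. f x + g x) = integral {a..b} f + integral {a..b} g"
    using ab by (intro Henstock_Kurzweil_Integration.integral_add locally_integrable_integrable_on li) auto
  then show "F b + G b - (F a + G a) = integral {a..b} (\<lambda>x. f x + g x)"
    using ac_deriv_integral[OF assms(1), of a b] ac_deriv_integral[OF assms(2), of a b] ab
    by (simp add: algebra_simps)
qed

lemma ac_deriv_const: "ac_deriv (\<lambda>x. c) (\<lambda>x. 0)"
  by (simp add: ac_deriv_def)

lemma ac_deriv_linear:
  assumes "ac_deriv F f" and h: "bounded_linear h"
  shows "ac_deriv (\<lambda>x. h (F x)) (\<lambda>x. h (f x))"
proof (rule ac_derivI)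
  note li = ac_deriv_locally_integrable[OF assms(1)]
  show "locally_integrable (\<lambda>x. h (f x))"
    unfolding locally_integrable_iff
  proof (intro allI impI)
    fix a b :: real assume ab: "0 < a" "b < 1"
    from absolutely_integrable_linear[OF locally_integrableD[OF li ab] h]
    show "(\<lambda>x. h (f x)) absolutely_integrable_on {a..b}"
      by (simp add: o_def)
  qed
  fix a b :: real assume ab: "0 < a" "a < b" "b < 1"
  have "integral {a..b} (h \<circ> f) = h (integral {a..b} f)"
    using ab by (intro integral_linear locally_integrable_integrable_on li h) auto
  then show "h (F b) - h (F a) = integral {a..b} (\<lambda>x. h (f x))"
    using ac_deriv_integral[OF assms(1), of a b] ab
    by (simp add: o_def flip: linear_diff[OF bounded_linear.linear[OF h]])
qed

lemma ac_deriv_cmult: "ac_deriv F f \<Longrightarrow> ac_deriv (\<lambda>x. c * F x) (\<lambda>x. c * f x)"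
  using ac_deriv_linear[OF _ bounded_linear_mult_right] .

lemma ac_deriv_cnj: "ac_deriv F f \<Longrightarrow> ac_deriv (\<lambda>x. cnj (F x)) (\<lambda>x. cnj (f x))"
  using ac_deriv_linear[OF _ bounded_linear_cnj] .

lemma ac_deriv_cong:
  assumes "ac_deriv F f" and FG: "\<And>x. 0 < x \<Longrightarrow> x < 1 \<Longrightarrow> G x = F x"
    and fg: "AE x in unit_leb. f x = g x"
  shows "ac_deriv G g"
proof (rule ac_derivI)
  show "locally_integrable g"
    by (rule locally_integrable_AE_cong[OF ac_deriv_locally_integrable[OF assms(1)] fg])
  fix a b :: real assume ab: "0 < a" "a < b" "b < 1"
  obtain N where N: "negligible N" "\<forall>x\<in>{0<..<1} - N. f x = g x"
    using fg unfolding AE_unit_leb_iff by blast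
  have "integral {a..b} g = integral {a..b} f"
    by (rule integral_spike[OF N(1)]) (use N(2) ab in auto)
  then show "G b - G a = integral {a..b} g"
    using ac_deriv_integral[OF assms(1), of a b] FG[of a] FG[of b] ab by simp
qed

text \<open>Cut the interval into equal pieces shorter than \<open>d\<close> and telescope. It lets
  an error estimate that holds only on short intervals be summed.\<close>

lemma norm_increment_le_of_local:
  fixes D :: "real \<Rightarrow> 'a::real_normed_vector" and N :: "real \<Rightarrow> real"
  assumes "a \<le> b" "d > 0"
    and local: "\<And>s t. a \<le> s \<Longrightarrow> s \<le> t \<Longrightarrow> t \<le> b \<Longrightarrow> t - s < d \<Longrightarrow> norm (D t - D s) \<le> N t - N s"
  shows "norm (D b - D a) \<le> N b - N a"
proof -
  obtain n where n: "(b - a) / d < real n"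
    using reals_Archimedean2 by blast
  with assms have n0: "n > 0"
    by (cases n) (auto simp: divide_less_0_iff)
  define x where "x k = a + real k * ((b - a) / real n)" for k
  have step: "x (Suc k) - x k = (b - a) / real n" for k
    by (simp add: x_def distrib_right del: times_divide_eq_right)
  have small: "(b - a) / real n < d"
    using n n0 assms(2) by (simp add: divide_less_eq mult.commute)
  have "k \<le> n \<Longrightarrow> norm (D (x k) - D a) \<le> N (x k) - N a" for k
  proof (induction k)
    case 0
    then show ?case by (simp add: x_def)
  next
    case (Suc k)
    have "real (Suc k) * ((b - a) / real n) \<le> real n * ((b - a) / real n)"
      using Suc assms(1) by (intro mult_right_mono) auto
    then have xb: "x (Suc k) \<le> b" using n0 by (simp add: x_def)
    have "0 \<le> (b - a) / real n"
      using assms(1) by simp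
    then have ak: "a \<le> x k" and kk: "x k \<le> x (Suc k)"
      using step[of k] by (simp add: x_def del: times_divide_eq_right) (use \<open>0 \<le> (b - a) / real n\<close> step[of k] in linarith)
    have "norm (D (x (Suc k)) - D (x k)) \<le> N (x (Suc k)) - N (x k)"
      using xb ak kk step[of k] small by (intro local) auto
    moreover have "norm (D (x k) - D a) \<le> N (x k) - N a"
      using Suc by simp
    ultimately show ?case
      using norm_triangle_ineq[of "D (x (Suc k)) - D (x k)" "D (x k) - D a"] by simp
  qed
  from this[of n] show ?thesis
    using n0 by (simp add: x_def)
qed

text \<open>On short intervals the increment of \<open>F G\<close> differs from the integral of \<open>f G + F g\<close> by at
  most a small multiple of the integral of \<open>\<bar>f\<bar> + \<bar>g\<bar>\<close>, and these errors add up.\<close>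

lemma ac_deriv_mult:
  assumes F: "ac_deriv F f" and G: "ac_deriv G g"
  shows "ac_deriv (\<lambda>x. F x * G x) (\<lambda>x. f x * G x + F x * g x)"
proof (rule ac_derivI)
  note f = ac_deriv_locally_integrable[OF F] and g = ac_deriv_locally_integrable[OF G]
  note cF = ac_deriv_continuous[OF F] and cG = ac_deriv_continuous[OF G]
  define h where "h x = f x * G x + F x * g x" for x
  have "locally_integrable (\<lambda>x. F x * g x)"
    using locally_integrable_mult_continuous[OF g cF] by (simp add: mult.commute)
  then have hl: "locally_integrable h"
    unfolding h_def by (rule locally_integrable_add[OF locally_integrable_mult_continuous[OF f cG]])
  then show "locally_integrable (\<lambda>x. f x * G x + F x * g x)" by (simp add: h_def[abs_def])
  fix a b :: real assume ab: "0 < a" "a < b" "b < 1"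
  define D where "D t = F t * G t - integral {a..t} h" for t
  define n where "n x = norm (f x) + norm (g x)" for x
  have ni: "n integrable_on {s..t}" if "a \<le> s" "t \<le> b" for s t
    unfolding n_def using that ab locally_integrableD[OF f, of s t] locally_integrableD[OF g, of s t]
    by (intro integrable_add) (auto simp: absolutely_integrable_on_def)
  define N where "N t = integral {a..t} n" for t
  have small: "norm (D b - D a) \<le> e * N b" if e: "e > 0" for e
  proof -
    have sub: "{a..b} \<subseteq> {0<..<1}" using ab by auto
    have "uniformly_continuous_on {a..b} F" "uniformly_continuous_on {a..b} G"
      by (intro compact_uniformly_continuous continuous_on_subset[OF cF] continuous_on_subset[OF cG] sub; simp)+
    then obtain d1 d2 where d: "d1 > 0" "d2 > 0"
      "\<forall>x\<in>{a..b}. \<forall>y\<in>{a..b}. dist y x < d1 \<longrightarrow> dist (F y) (F x) < e"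
      "\<forall>x\<in>{a..b}. \<forall>y\<in>{a..b}. dist y x < d2 \<longrightarrow> dist (G y) (G x) < e"
      unfolding uniformly_continuous_on_def using e by blast
    have "norm (D b - D a) \<le> e * N b - e * N a"
    proof (rule norm_increment_le_of_local)
      show "min d1 d2 > 0" "a \<le> b" using d ab by auto
      fix s t assume st: "a \<le> s" "s \<le> t" "t \<le> b" "t - s < min d1 d2"
      have fi: "f integrable_on {s..t}" and gi: "g integrable_on {s..t}" and hi: "h integrable_on {s..t}"
        using ab st f g hl by (auto intro!: locally_integrable_integrable_on)
      have "integral {a..s} h + integral {s..t} h = integral {a..t} h"
        by (rule Henstock_Kurzweil_Integration.integral_combine)
          (use ab st hl in \<open>auto intro!: locally_integrable_integrable_on\<close>)
      \<comment> \<open>The discrete product rule takes \<open>G\<close> at the right end and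
        \<open>F\<close> at the left end; both differ by at most \<open>e\<close> from their values
        inside the short interval.\<close>
      then have "D t - D s = (F t - F s) * G t + F s * (G t - G s) - integral {s..t} h"
        by (simp add: D_def algebra_simps)
      also have "\<dots> = integral {s..t} f * G t + F s * integral {s..t} g - integral {s..t} h"
        using ac_deriv_integral[OF F, of s t] ac_deriv_integral[OF G, of s t] st ab by simp
      also have "\<dots> = integral {s..t} (\<lambda>x. f x * G t + F s * g x - h x)"
        by (rule integral_unique[symmetric], intro has_integral_diff has_integral_add
            has_integral_mult_left has_integral_mult_right integrable_integral fi gi hi)
      finally have eq: "D t - D s = integral {s..t} (\<lambda>x. f x * G t + F s * g x - h x)" .
      have "norm (integral {s..t} (\<lambda>x. f x * G t + F s * g x - h x)) \<le> integral {s..t} (\<lambda>x. e * n x)"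
      proof (rule integral_norm_bound_integral)
        show "(\<lambda>x. f x * G t + F s * g x - h x) integrable_on {s..t}"
          using fi gi hi
          by (intro integrable_diff integrable_add integrable_on_mult_left integrable_on_mult_right)
        show "(\<lambda>x. e * n x) integrable_on {s..t}"
          using ni st by (intro integrable_on_mult_right) auto
        fix x assume x: "x \<in> {s..t}"
        have "dist (G t) (G x) < e"
          by (rule d(4)[rule_format]) (use x st in \<open>auto simp: dist_norm\<close>)
        moreover have "dist (F s) (F x) < e"
          by (rule d(3)[rule_format]) (use x st in \<open>auto simp: dist_norm\<close>)
        ultimately have "norm (G t - G x) \<le> e" "norm (F s - F x) \<le> e"
          by (simp_all add: dist_norm)
        then have "norm (f x * (G t - G x)) + norm ((F s - F x) * g x) \<le> norm (f x) * e + e * norm (g x)"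
          unfolding norm_mult by (intro add_mono mult_mono) (use e in auto)
        moreover have "f x * G t + F s * g x - h x = f x * (G t - G x) + (F s - F x) * g x"
          by (simp add: h_def algebra_simps)
        ultimately show "norm (f x * G t + F s * g x - h x) \<le> e * n x"
          using norm_triangle_ineq[of "f x * (G t - G x)" "(F s - F x) * g x"]
          by (simp add: n_def algebra_simps)
      qed
      also have "\<dots> = e * N t - e * N s"
      proof -
        have "N t = N s + integral {s..t} n"
          using Henstock_Kurzweil_Integration.integral_combine[of a s t n] ni st by (simp add: N_def)
        then show ?thesis by (simp add: distrib_left)
      qed
      finally show "norm (D t - D s) \<le> e * N t - e * N s"
        unfolding eq .
    qed
    then show ?thesis by (simp add: N_def)
  qed
  have "N b \<ge> 0"
    unfolding N_def by (rule integral_nonneg[OF ni]) (auto simp: n_def)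
  have "norm (D b - D a) \<le> 0"
  proof (rule field_le_epsilon)
    fix e :: real assume e: "e > 0"
    \<comment> \<open>The summand 1 covers the case \<open>N b = 0\<close>.\<close>
    have "norm (D b - D a) \<le> e / (N b + 1) * N b"
      using \<open>N b \<ge> 0\<close> e by (intro small) simp
    also have "\<dots> \<le> e"
      using \<open>N b \<ge> 0\<close> e mult_left_mono[of "N b" "N b + 1" e] by (simp add: divide_le_eq)
    finally show "norm (D b - D a) \<le> 0 + e" by simp
  qed
  then have "F b * G b = F a * G a + integral {a..b} h" by (simp add: D_def diff_eq_eq)
  then show "F b * G b - F a * G a = integral {a..b} (\<lambda>x. f x * G x + F x * g x)"
    by (simp add: h_def[abs_def])
qed

lemma ac_deriv_C1:
  assumes "\<And>x. 0 < x \<Longrightarrow> x < 1 \<Longrightarrow> (F has_vector_derivative f x) (at x)"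
    and "continuous_on {0<..<1} f"
  shows "ac_deriv F f"
proof (rule ac_derivI)
  show "locally_integrable f"
    by (rule locally_integrable_continuous[OF assms(2)])
  fix a b :: real assume ab: "0 < a" "a < b" "b < 1"
  have "(f has_integral (F b - F a)) {a..b}"
    by (rule fundamental_theorem_of_calculus)
      (use ab assms(1) in \<open>auto intro: has_vector_derivative_at_within\<close>)
  then show "F b - F a = integral {a..b} f"
    by (simp add: integral_unique)
qed

lemma ac_deriv_of_real:
  assumes "\<And>x. 0 < x \<Longrightarrow> x < 1 \<Longrightarrow> (F has_real_derivative f x) (at x)"
    and "continuous_on {0<..<1} f"
  shows "ac_deriv (\<lambda>x. of_real (F x)) (\<lambda>x. of_real (f x))"
proof (rule ac_deriv_C1)
  fix x :: real assume "0 < x" "x < 1"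
  then have "(F has_real_derivative f x) (at x)"
    by (rule assms(1))
  then show "((\<lambda>x. complex_of_real (F x)) has_vector_derivative complex_of_real (f x)) (at x)"
    by (rule has_vector_derivative_of_real)
qed (use assms(2) in \<open>intro continuous_intros\<close>)

lemma ac_deriv_powr: "ac_deriv (\<lambda>x. of_real (x powr a)) (\<lambda>x. of_real (a * x powr (a - 1)))"
  by (rule ac_deriv_of_real) (auto intro!: derivative_eq_intros continuous_intros simp: field_simps)

section \<open>Weak derivatives are derivatives of absolutely continuous representatives\<close>

lemma integral_unit_leb_of_support:
  fixes f :: "real \<Rightarrow> complex"
  assumes "locally_integrable f" "0 < a" "b < 1" "\<And>x. x \<notin> {a..b} \<Longrightarrow> f x = 0"
  shows "integrable unit_leb f" "(LINT x|unit_leb. f x) = integral {a..b} f"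
proof -
  have eq: "(\<lambda>x. indicator {a..b} x *\<^sub>R f x) = f"
    using assms(4) by (auto simp: fun_eq_iff indicator_def)
  have "f absolutely_integrable_on {a..b}" "{a..b} \<in> sets lebesgue" "{a..b} \<subseteq> {0<..<1}"
    using assms(2,3) locally_integrableD[OF assms(1-3)] by auto
  from indicator_integral_unit_leb[OF this] show "integrable unit_leb f"
    "(LINT x|unit_leb. f x) = integral {a..b} f"
    by (simp_all add: eq)
qed

text \<open>Using an open interval around the support makes both functions vanish at
  \<open>a\<close> and \<open>b\<close> themselves, so integration by parts over
  \<open>{a..b}\<close> has no boundary terms.\<close>

lemma test_function_support:
  assumes "test_function \<phi>"
  obtains a b where "0 < a" "a < b" "b < 1"
    "\<And>x. x \<notin> {a<..<b} \<Longrightarrow> \<phi> x = 0" "\<And>x. x \<notin> {a<..<b} \<Longrightarrow> deriv \<phi> x = 0"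
proof -
  obtain K where K: "compact K" "K \<subseteq> {0<..<1}" "\<And>x. x \<notin> K \<Longrightarrow> \<phi> x = 0"
    using assms unfolding test_function_def by blast
  obtain a b where ab: "0 < a" "a < b" "b < 1" "K \<subseteq> {a<..<b}"
  proof (cases "K = {}")
    case True
    then show ?thesis using that[of "1/4" "1/2"] by simp
  next
    case False
    obtain x where x: "x \<in> K" "\<And>y. y \<in> K \<Longrightarrow> x \<le> y"
      using compact_attains_inf[OF K(1) False] by blast
    obtain z where z: "z \<in> K" "\<And>y. y \<in> K \<Longrightarrow> y \<le> z"
      using compact_attains_sup[OF K(1) False] by blast
    have "0 < x" "x \<le> z" "z < 1" using x z K(2) by auto
    then show ?thesis
      using x(2) z(2) by (intro that[of "x / 2" "(1 + z) / 2"]) force+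
  qed
  show thesis
  proof (rule that[OF ab(1-3)])
    show "\<phi> x = 0" if "x \<notin> {a<..<b}" for x
      using that ab(4) K(3) by blast
    show "deriv \<phi> x = 0" if "x \<notin> {a<..<b}" for x
    proof -
      have "((\<lambda>_. 0) has_real_derivative 0) (at x)" by simp
      then have "(\<phi> has_real_derivative 0) (at x)"
        by (rule has_field_derivative_transform_within_open[of _ _ _ "- K"])
          (use K ab(4) that in \<open>auto intro: open_Compl compact_imp_closed\<close>)
      then show ?thesis by (rule DERIV_imp_deriv)
    qed
  qed
qed

lemma test_function_has_deriv:
  assumes "test_function \<phi>"
  shows "(\<phi> has_real_derivative deriv \<phi> x) (at x)" and "continuous_on UNIV (deriv \<phi>)"
proof -
  have "smooth \<phi>" using assms by (simp add: test_function_def smooth_def)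
  then show "(\<phi> has_real_derivative deriv \<phi> x) (at x)" and "continuous_on UNIV (deriv \<phi>)"
    using smooth_has_deriv smooth_differentiable[OF smooth_deriv]
    by (auto intro: differentiable_imp_continuous_on)
qed

lemma test_function_ac_deriv:
  "test_function \<phi> \<Longrightarrow> ac_deriv (\<lambda>x. of_real (\<phi> x)) (\<lambda>x. of_real (deriv \<phi> x))"
  using test_function_has_deriv[of \<phi>]
  by (intro ac_deriv_of_real) (auto intro: continuous_on_subset)

lemma test_function_integrable:
  assumes \<phi>: "test_function \<phi>" and f: "locally_integrable f"
  shows "integrable unit_leb (\<lambda>x. \<phi> x *\<^sub>R f x)" "integrable unit_leb (\<lambda>x. deriv \<phi> x *\<^sub>R f x)"
proof -
  obtain a b where ab: "0 < a" "a < b" "b < 1"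
    "\<And>x. x \<notin> {a<..<b} \<Longrightarrow> \<phi> x = 0" "\<And>x. x \<notin> {a<..<b} \<Longrightarrow> deriv \<phi> x = 0"
    using test_function_support[OF \<phi>] by blast
  have "continuous_on {0<..<1} (\<lambda>x. complex_of_real (deriv \<phi> x))"
    by (intro continuous_intros continuous_on_subset[OF test_function_has_deriv(2)[OF \<phi>]]) auto
  from locally_integrable_mult_continuous[OF f this]
  show "integrable unit_leb (\<lambda>x. deriv \<phi> x *\<^sub>R f x)"
    by (intro integral_unit_leb_of_support[OF _ ab(1,3)]) (use ab(5) in \<open>auto simp: scaleR_conv_of_real mult.commute\<close>)
  from locally_integrable_mult_continuous[OF f ac_deriv_continuous[OF test_function_ac_deriv[OF \<phi>]]]
  show "integrable unit_leb (\<lambda>x. \<phi> x *\<^sub>R f x)"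
    by (intro integral_unit_leb_of_support[OF _ ab(1,3)]) (use ab(4) in \<open>auto simp: scaleR_conv_of_real mult.commute\<close>)
qed

text \<open>Integrate the product rule for \<open>\<phi> F\<close> over an interval that contains
  the support of \<open>\<phi>\<close>.\<close>

lemma has_weak_deriv_of_ac_deriv:
  assumes F: "ac_deriv F g"
  shows "has_weak_deriv F g"
  unfolding has_weak_deriv_def
proof (intro conjI allI impI)
  show lF: "locally_integrable F"
    by (rule locally_integrable_continuous[OF ac_deriv_continuous[OF F]])
  show lg: "locally_integrable g"
    by (rule ac_deriv_locally_integrable[OF F])
  fix \<phi> assume \<phi>: "test_function \<phi>"
  obtain a b where ab: "0 < a" "a < b" "b < 1"
    "\<And>x. x \<notin> {a<..<b} \<Longrightarrow> \<phi> x = 0" "\<And>x. x \<notin> {a<..<b} \<Longrightarrow> deriv \<phi> x = 0"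
    using test_function_support[OF \<phi>] by blast
  have M: "ac_deriv (\<lambda>x. of_real (\<phi> x) * F x) (\<lambda>x. of_real (deriv \<phi> x) * F x + of_real (\<phi> x) * g x)"
    by (rule ac_deriv_mult[OF test_function_ac_deriv[OF \<phi>] F])
  have "(LINT x|unit_leb. deriv \<phi> x *\<^sub>R F x) + (LINT x|unit_leb. \<phi> x *\<^sub>R g x)
      = (LINT x|unit_leb. of_real (deriv \<phi> x) * F x + of_real (\<phi> x) * g x)"
    using test_function_integrable[OF \<phi> lF] test_function_integrable[OF \<phi> lg]
    by (simp add: scaleR_conv_of_real)
  also have "\<dots> = integral {a..b} (\<lambda>x. of_real (deriv \<phi> x) * F x + of_real (\<phi> x) * g x)"
    by (rule integral_unit_leb_of_support[OF ac_deriv_locally_integrable[OF M] ab(1,3)]) (use ab in auto)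
  also have "\<dots> = of_real (\<phi> b) * F b - of_real (\<phi> a) * F a"
    using ac_deriv_integral[OF M ab(1) _ ab(3)] ab(2) by simp
  also have "\<dots> = 0"
    using ab(4) by simp
  finally show "(LINT x|unit_leb. deriv \<phi> x *\<^sub>R F x) = - (LINT x|unit_leb. \<phi> x *\<^sub>R g x)"
    by (simp add: eq_neg_iff_add_eq_0)
qed

text \<open>The primitive is based at the interior point 1/2, because \<open>g\<close> need not be
  integrable up to 0 or 1.\<close>

lemma ac_deriv_exists:
  assumes g: "locally_integrable g"
  obtains G where "ac_deriv G g"
proof -
  define G where "G x = (if x \<ge> 1/2 then integral {1/2..x} g else - integral {x..1/2} g)" for x
  have comb: "integral {a..c} g + integral {c..b} g = integral {a..b} g"
    if "0 < a" "a \<le> c" "c \<le> b" "b < 1" for a b c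
    by (rule Henstock_Kurzweil_Integration.integral_combine)
      (use that in \<open>auto intro: locally_integrable_integrable_on[OF g]\<close>)
  have "ac_deriv G g"
  proof (rule ac_derivI[OF g])
    fix a b :: real assume ab: "0 < a" "a < b" "b < 1"
    show "G b - G a = integral {a..b} g"
    proof (cases "1/2 \<le> a \<or> b < 1/2")
      case True
      then show ?thesis
        using comb[of "1/2" a b] comb[of a b "1/2"] ab by (auto simp: G_def algebra_simps)
    next
      case False
      then show ?thesis
        using comb[of a "1/2" b] ab by (auto simp: G_def algebra_simps)
    qed
  qed
  then show thesis by (rule that)
qed

text \<open>The difference of \<open>f\<close> and any primitive of \<open>g\<close> has weak
  derivative 0 and is constant by \<open>du_Bois_Reymond\<close>; the constant is absorbed into
  \<open>F\<close>.\<close>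

lemma ac_deriv_of_has_weak_deriv:
  assumes fg: "has_weak_deriv f g"
  obtains F where "ac_deriv F g" "AE x in unit_leb. f x = F x"
proof -
  have f: "locally_integrable f" and g: "locally_integrable g"
    using fg by (auto simp: has_weak_deriv_def)
  obtain G where G: "ac_deriv G g" using ac_deriv_exists[OF g] by blast
  note wG = has_weak_deriv_of_ac_deriv[OF G]
  then have lG: "locally_integrable G" by (simp add: has_weak_deriv_def)
  obtain k where k: "AE x in unit_leb. f x - G x = k"
  proof (rule du_Bois_Reymond[of "\<lambda>x. f x - G x"])
    show "locally_integrable (\<lambda>x. f x - G x)"
      by (rule locally_integrable_diff[OF f lG])
    fix \<phi> assume \<phi>: "test_function \<phi>"
    have "(LINT x|unit_leb. deriv \<phi> x *\<^sub>R (f x - G x))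
        = (LINT x|unit_leb. deriv \<phi> x *\<^sub>R f x) - (LINT x|unit_leb. deriv \<phi> x *\<^sub>R G x)"
      using test_function_integrable[OF \<phi> f] test_function_integrable[OF \<phi> lG]
      by (simp add: scaleR_diff_right)
    also have "\<dots> = 0"
      using fg wG \<phi> by (simp add: has_weak_deriv_def)
    finally show "(LINT x|unit_leb. deriv \<phi> x *\<^sub>R (f x - G x)) = 0" .
  qed
  have "ac_deriv (\<lambda>x. G x + k) (\<lambda>x. g x + 0)"
    by (rule ac_deriv_add[OF G ac_deriv_const])
  moreover have "AE x in unit_leb. f x = G x + k"
    using k by eventually_elim (auto simp: algebra_simps)
  ultimately show thesis
    using that[of "\<lambda>x. G x + k"] by simp
qed

text \<open>The set where \<open>F\<close> and \<open>G\<close> differ is open and negligible, hence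
  empty.\<close>

lemma continuous_AE_eq:
  fixes F G :: "real \<Rightarrow> 'a::t2_space"
  assumes "continuous_on {0<..<1} F" "continuous_on {0<..<1} G"
    and "AE x in unit_leb. F x = G x" and "0 < x" "x < 1"
  shows "F x = G x"
proof (rule ccontr)
  assume ne: "F x \<noteq> G x"
  obtain N where N: "negligible N" "\<forall>x\<in>{0<..<1} - N. F x = G x"
    using assms(3) unfolding AE_unit_leb_iff by blast
  have op: "open {x \<in> {0<..<1}. F x \<noteq> G x}"
  proof -
    have "continuous_on {0<..<1} (\<lambda>x. (F x, G x))"
      by (intro continuous_intros assms)
    moreover have "open {p::'a \<times> 'a. fst p \<noteq> snd p}"
      by (intro open_Collect_neq continuous_intros)
    ultimately have "open ({0<..<1} \<inter> (\<lambda>x. (F x, G x)) -` {p. fst p \<noteq> snd p})"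
      by (intro continuous_open_preimage) auto
    moreover have "{0<..<1} \<inter> (\<lambda>x. (F x, G x)) -` {p. fst p \<noteq> snd p} = {x \<in> {0<..<1}. F x \<noteq> G x}"
      by auto
    ultimately show ?thesis by simp
  qed
  have "{x \<in> {0<..<1}. F x \<noteq> G x} \<subseteq> N" using N by auto
  then have "negligible {x \<in> {0<..<1}. F x \<noteq> G x}"
    by (rule negligible_subset[OF N(1)])
  then show False
    using open_not_negligible[OF op] ne assms by auto
qed

lemma ac_deriv_unique:
  assumes F: "ac_deriv F f" and G: "ac_deriv G g" and FG: "AE x in unit_leb. F x = G x"
  shows "\<And>x. 0 < x \<Longrightarrow> x < 1 \<Longrightarrow> F x = G x" and "AE x in unit_leb. f x = g x"
proof -
  show eq: "F x = G x" if "0 < x" "x < 1" for x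
    by (rule continuous_AE_eq[OF ac_deriv_continuous[OF F] ac_deriv_continuous[OF G] FG that])
  note li = ac_deriv_locally_integrable[OF F] ac_deriv_locally_integrable[OF G]
  have "AE x in unit_leb. f x - g x = 0"
  proof (rule AE_zero_of_zero_integrals)
    show "locally_integrable (\<lambda>x. f x - g x)"
      by (rule locally_integrable_diff[OF li])
    fix a b :: real assume ab: "0 < a" "a < b" "b < 1"
    have "integral {a..b} (\<lambda>x. f x - g x) = integral {a..b} f - integral {a..b} g"
      using ab by (intro Henstock_Kurzweil_Integration.integral_diff locally_integrable_integrable_on li)
    then show "integral {a..b} (\<lambda>x. f x - g x) = 0"
      using ac_deriv_integral[OF F, of a b] ac_deriv_integral[OF G, of a b] ab eq[of a] eq[of b] by simp
  qed
  then show "AE x in unit_leb. f x = g x" by simp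
qed

lemma has_weak_deriv_AE_cong:
  assumes "has_weak_deriv F g" and f: "AE x in unit_leb. f x = F x"
  shows "has_weak_deriv f g"
  unfolding has_weak_deriv_def
proof (intro conjI allI impI)
  have lF: "locally_integrable F" using assms by (simp add: has_weak_deriv_def)
  show lf: "locally_integrable f"
    by (rule locally_integrable_AE_cong[OF lF]) (use f in \<open>auto elim: eventually_mono\<close>)
  show "locally_integrable g" using assms by (simp add: has_weak_deriv_def)
  fix \<phi> assume \<phi>: "test_function \<phi>"
  have "(LINT x|unit_leb. deriv \<phi> x *\<^sub>R f x) = (LINT x|unit_leb. deriv \<phi> x *\<^sub>R F x)"
    using test_function_integrable[OF \<phi> lF] test_function_integrable[OF \<phi> lf] f
    by (intro integral_cong_AE) (auto elim: eventually_mono)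
  then show "(LINT x|unit_leb. deriv \<phi> x *\<^sub>R f x) = - (LINT x|unit_leb. \<phi> x *\<^sub>R g x)"
    using assms \<phi> by (simp add: has_weak_deriv_def)
qed

text \<open>Replaces the arbitrary choice in \<open>weak_deriv\<close> by a concrete derivative;
  \<open>A_fun\<close> and \<open>defect\<close> are computed through it.\<close>

lemma weak_deriv_eq:
  assumes F: "ac_deriv F g" and f: "AE x in unit_leb. f x = F x"
  shows "AE x in unit_leb. weak_deriv f x = g x"
proof -
  have "has_weak_deriv f g"
    by (rule has_weak_deriv_AE_cong[OF has_weak_deriv_of_ac_deriv[OF F] f])
  then have "has_weak_deriv f (weak_deriv f)"
    unfolding weak_deriv_def by (rule someI[of "has_weak_deriv f"])
  then obtain G where G: "ac_deriv G (weak_deriv f)" "AE x in unit_leb. f x = G x"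
    using ac_deriv_of_has_weak_deriv by blast
  have "AE x in unit_leb. G x = F x"
    using f G(2) by eventually_elim simp
  then show ?thesis
    by (rule ac_deriv_unique(2)[OF G(1) F])
qed

section \<open>The Hilbert space\<close>

lemma integrable_const_unit_leb: "integrable unit_leb (\<lambda>x. c::'a::euclidean_space)"
  unfolding integrable_unit_leb_iff by (rule absolutely_integrable_on_const) simp

lemma measure_unit_leb: "measure unit_leb {0<..<1} = 1"
  by (simp add: measure_restrict_space)

lemma square_integrable_measurable: "square_integrable f \<Longrightarrow> f \<in> borel_measurable unit_leb"
  by (simp add: square_integrable_def)

lemma square_integrable_bound:
  assumes g: "square_integrable g" and f: "f \<in> borel_measurable unit_leb"
    and le: "AE x in unit_leb. cmod (f x) \<le> C * cmod (g x)"
  shows "square_integrable f"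
proof -
  have "integrable unit_leb (\<lambda>x. C\<^sup>2 * (cmod (g x))\<^sup>2)"
    using g by (simp add: square_integrable_def)
  then have "integrable unit_leb (\<lambda>x. (cmod (f x))\<^sup>2)"
  proof (rule Bochner_Integration.integrable_bound)
    show "(\<lambda>x. (cmod (f x))\<^sup>2) \<in> borel_measurable unit_leb"
      using f by measurable
    show "AE x in unit_leb. norm ((cmod (f x))\<^sup>2) \<le> norm (C\<^sup>2 * (cmod (g x))\<^sup>2)"
      using le
    proof eventually_elim
      case (elim x)
      then have "(cmod (f x))\<^sup>2 \<le> (C * cmod (g x))\<^sup>2"
        by (intro power_mono) auto
      then show ?case by (simp add: power_mult_distrib)
    qed
  qed
  with f show ?thesis by (simp add: square_integrable_def)
qed

lemma square_integrable_const: "square_integrable (\<lambda>x. c)"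
  using integrable_const_unit_leb by (simp add: square_integrable_def)

lemma square_integrable_uminus: "square_integrable f \<Longrightarrow> square_integrable (\<lambda>x. - f x)"
  using square_integrable_scale[of f "-1"] by simp

lemma square_integrable_diff:
  "square_integrable f \<Longrightarrow> square_integrable g \<Longrightarrow> square_integrable (\<lambda>x. f x - g x)"
  using square_integrable_add[of f "\<lambda>x. - g x"] square_integrable_uminus[of g] by simp

lemma square_integrable_mult_bounded:
  assumes "square_integrable g" "h \<in> borel_measurable unit_leb"
    and "\<And>x. 0 < x \<Longrightarrow> x < 1 \<Longrightarrow> cmod (h x) \<le> C"
  shows "square_integrable (\<lambda>x. h x * g x)"
proof (rule square_integrable_bound[OF assms(1), of _ C])
  show "(\<lambda>x. h x * g x) \<in> borel_measurable unit_leb"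
    by (rule borel_measurable_times[OF assms(2) square_integrable_measurable[OF assms(1)]])
  show "AE x in unit_leb. cmod (h x * g x) \<le> C * cmod (g x)"
    by (rule AE_unit_lebI) (auto simp: norm_mult intro!: mult_right_mono assms(3))
qed

lemma square_integrable_mult_continuous:
  assumes "square_integrable g" "continuous_on {0<..<1} h"
    and "\<And>x. 0 < x \<Longrightarrow> x < 1 \<Longrightarrow> cmod (h x) \<le> C"
  shows "square_integrable (\<lambda>x. h x * g x)"
  by (rule square_integrable_mult_bounded[OF assms(1) _ assms(3)])
    (use assms(2) in \<open>auto intro: continuous_borel_measurable_unit_leb\<close>)

lemma square_integrable_integrable:
  assumes "square_integrable f"
  shows "integrable unit_leb f"
  using integrable_cnj_mult[OF square_integrable_const[of 1] assms] by simp

lemma square_integrable_locally_integrable: "square_integrable f \<Longrightarrow> locally_integrable f"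
  unfolding locally_integrable_iff
  by (intro allI impI set_integrable_subset[OF square_integrable_integrable[unfolded integrable_unit_leb_iff]]) auto

lemma l2_of_l2_fun: "l2_of (l2_fun u) = u"
  by (rule Quotient3_abs_rep[OF Quotient3_l2])

lemma l2_of_eqI:
  "square_integrable f \<Longrightarrow> square_integrable g \<Longrightarrow> AE x in unit_leb. f x = g x \<Longrightarrow> l2_of f = l2_of g"
  by (rule Quotient3_rel_abs[OF Quotient3_l2]) (simp add: l2_eq_def)

lemma l2_eqI: "AE x in unit_leb. l2_fun u x = l2_fun v x \<Longrightarrow> u = v"
  using l2_of_eqI[of "l2_fun u" "l2_fun v"] by (simp add: square_integrable_l2_fun l2_of_l2_fun)

lemma l2_fun_zero: "AE x in unit_leb. l2_fun 0 x = 0"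
  unfolding zero_l2_def using l2_fun_l2_of[OF square_integrable_zero] by simp

lemma l2_fun_add: "AE x in unit_leb. l2_fun (u + v) x = l2_fun u x + l2_fun v x"
  unfolding plus_l2_def
  using l2_fun_l2_of[OF square_integrable_add[OF square_integrable_l2_fun[of u] square_integrable_l2_fun[of v]]]
  by simp

lemma l2_fun_scale: "AE x in unit_leb. l2_fun (c *\<^sub>C u) x = c * l2_fun u x"
  unfolding l2_scale_def
  using l2_fun_l2_of[OF square_integrable_scale[OF square_integrable_l2_fun[of u]]] by simp

lemma l2_fun_diff: "AE x in unit_leb. l2_fun (u - v) x = l2_fun u x - l2_fun v x"
  unfolding minus_l2_def uminus_l2_def
  using l2_fun_add[of u "(-1) *\<^sub>C v"] l2_fun_scale[of "-1" v] by eventually_elim simp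

lemma l2_scale_add: "c *\<^sub>C (u + v) = c *\<^sub>C u + c *\<^sub>C v"
  by (rule l2_eqI)
    (use l2_fun_scale[of c "u + v"] l2_fun_add[of u v] l2_fun_add[of "c *\<^sub>C u" "c *\<^sub>C v"]
      l2_fun_scale[of c u] l2_fun_scale[of c v] in \<open>eventually_elim, simp add: algebra_simps\<close>)

lemma l2_add_scale: "(c + d) *\<^sub>C u = c *\<^sub>C u + d *\<^sub>C u"
  by (rule l2_eqI)
    (use l2_fun_scale[of "c + d" u] l2_fun_add[of "c *\<^sub>C u" "d *\<^sub>C u"]
      l2_fun_scale[of c u] l2_fun_scale[of d u] in \<open>eventually_elim, simp add: algebra_simps\<close>)

lemma l2_scale_scale: "c *\<^sub>C d *\<^sub>C u = (c * d) *\<^sub>C u"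
  by (rule l2_eqI)
    (use l2_fun_scale[of "c * d" u] l2_fun_scale[of c "d *\<^sub>C u"] l2_fun_scale[of d u]
      in \<open>eventually_elim, simp add: algebra_simps\<close>)

lemma l2_scale_one: "1 *\<^sub>C u = u"
  by (rule l2_eqI) (use l2_fun_scale[of 1 u] in simp)

lemma l2_scale_zero: "0 *\<^sub>C u = 0" "c *\<^sub>C 0 = 0"
proof -
  show "0 *\<^sub>C u = 0"
    by (rule l2_eqI) (use l2_fun_scale[of 0 u] l2_fun_zero in \<open>eventually_elim, simp\<close>)
  show "c *\<^sub>C 0 = 0"
    by (rule l2_eqI) (use l2_fun_scale[of c 0] l2_fun_zero in \<open>eventually_elim, simp\<close>)
qed

lemma l2_scale_diff: "c *\<^sub>C (u - v) = c *\<^sub>C u - c *\<^sub>C v"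
  by (simp add: minus_l2_def uminus_l2_def l2_scale_add l2_scale_scale)

lemma l2_inner_zero_right: "l2_inner u 0 = 0"
  using l2_inner_scale_right[of u 0 0] by (simp add: l2_scale_zero)

lemma l2_inner_diff_right: "l2_inner u (v - w) = l2_inner u v - l2_inner u w"
  by (simp add: minus_l2_def uminus_l2_def l2_inner_add_right l2_inner_scale_right)

lemma l2_inner_add_left: "l2_inner (u + v) w = l2_inner u w + l2_inner v w"
  by (metis l2_inner_commute l2_inner_add_right complex_cnj_add)

lemma l2_inner_scale_left: "l2_inner (c *\<^sub>C u) w = cnj c * l2_inner u w"
  by (metis l2_inner_commute l2_inner_scale_right complex_cnj_mult)

lemma l2_inner_fun: "l2_inner u v = (LINT x|unit_leb. cnj (l2_fun u x) * l2_fun v x)"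
  by (simp add: l2_inner_def)

lemma l2_inner_AE:
  assumes "AE x in unit_leb. l2_fun u x = f x" "AE x in unit_leb. l2_fun v x = g x"
    and "f \<in> borel_measurable unit_leb" "g \<in> borel_measurable unit_leb"
  shows "l2_inner u v = (LINT x|unit_leb. cnj (f x) * g x)"
  unfolding l2_inner_fun
proof (rule integral_cong_AE)
  show "(\<lambda>x. cnj (l2_fun u x) * l2_fun v x) \<in> borel_measurable unit_leb"
    by (intro borel_measurable_integrable integrable_cnj_mult square_integrable_l2_fun)
  show "(\<lambda>x. cnj (f x) * g x) \<in> borel_measurable unit_leb"
    using assms(3,4) borel_measurable_continuous_on[OF _ assms(3), of cnj]
    by (intro borel_measurable_times) (auto intro: continuous_intros)
  show "AE x in unit_leb. cnj (l2_fun u x) * l2_fun v x = cnj (f x) * g x"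
    using assms(1,2) by eventually_elim simp
qed

lemma l2_norm_power2: "(norm u)\<^sup>2 = (LINT x|unit_leb. (cmod (l2_fun u x))\<^sup>2)"
  by (simp add: norm_l2_def inner_l2_def l2_inner_self)

lemma l2_inner_self_norm: "l2_inner u u = of_real ((norm u)\<^sup>2)"
  by (simp add: l2_inner_self l2_norm_power2)

lemma l2_norm_power2_AE:
  assumes "AE x in unit_leb. l2_fun u x = f x" "f \<in> borel_measurable unit_leb"
  shows "(norm u)\<^sup>2 = (LINT x|unit_leb. (cmod (f x))\<^sup>2)"
  unfolding l2_norm_power2
proof (rule integral_cong_AE)
  show "(\<lambda>x. (cmod (l2_fun u x))\<^sup>2) \<in> borel_measurable unit_leb"
    using square_integrable_measurable[OF square_integrable_l2_fun[of u]] by measurable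
  show "(\<lambda>x. (cmod (f x))\<^sup>2) \<in> borel_measurable unit_leb"
    using assms(2) by measurable
  show "AE x in unit_leb. (cmod (l2_fun u x))\<^sup>2 = (cmod (f x))\<^sup>2"
    using assms(1) by eventually_elim simp
qed

lemma l2_norm_scale: "norm (c *\<^sub>C u) = cmod c * norm u"
proof -
  have "complex_of_real ((norm (c *\<^sub>C u))\<^sup>2) = (c * cnj c) * l2_inner u u"
    by (simp only: l2_inner_self_norm[symmetric] l2_inner_scale_left l2_inner_scale_right mult_ac)
  also have "\<dots> = of_real ((cmod c * norm u)\<^sup>2)"
    by (simp only: l2_inner_self_norm complex_norm_square[symmetric] power_mult_distrib of_real_mult)
  finally have "complex_of_real ((norm (c *\<^sub>C u))\<^sup>2) = of_real ((cmod c * norm u)\<^sup>2)" .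
  then have "(norm (c *\<^sub>C u))\<^sup>2 = (cmod c * norm u)\<^sup>2"
    by (simp only: of_real_eq_iff)
  then show ?thesis
    by (rule power2_eq_imp_eq) auto
qed

text \<open>Rotating \<open>v\<close> by a phase makes the product real and nonnegative, so the
  inequality for the real inner product applies.\<close>

lemma l2_Cauchy_Schwarz: "cmod (l2_inner u v) \<le> norm u * norm v"
proof (cases "l2_inner u v = 0")
  case False
  define c where "c = cnj (l2_inner u v) / of_real (cmod (l2_inner u v))"
  have c: "cmod c = 1" using False by (simp add: c_def norm_divide)
  have "c * l2_inner u v = of_real (cmod (l2_inner u v))"
    using False by (simp add: c_def mult.commute power2_eq_square flip: complex_norm_square)
  then have "cmod (l2_inner u v) = inner u (c *\<^sub>C v)"
    by (simp add: inner_l2_def l2_inner_scale_right)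
  also have "\<dots> \<le> norm u * norm (c *\<^sub>C v)"
    by (rule norm_cauchy_schwarz)
  finally show ?thesis by (simp add: l2_norm_scale c)
qed simp

lemma integral_Cauchy_Schwarz:
  assumes f: "square_integrable f" and g: "square_integrable g"
  shows "(cmod (LINT x|unit_leb. cnj (f x) * g x))\<^sup>2
    \<le> (LINT x|unit_leb. (cmod (f x))\<^sup>2) * (LINT x|unit_leb. (cmod (g x))\<^sup>2)"
proof -
  have "cmod (l2_inner (l2_of f) (l2_of g)) \<le> norm (l2_of f) * norm (l2_of g)"
    by (rule l2_Cauchy_Schwarz)
  then have "(cmod (l2_inner (l2_of f) (l2_of g)))\<^sup>2 \<le> (norm (l2_of f))\<^sup>2 * (norm (l2_of g))\<^sup>2"
    unfolding power_mult_distrib[symmetric] by (rule power_mono) simp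
  then show ?thesis
    unfolding l2_inner_AE[OF l2_fun_l2_of[OF f] l2_fun_l2_of[OF g] square_integrable_measurable[OF f]
        square_integrable_measurable[OF g]]
      l2_norm_power2_AE[OF l2_fun_l2_of[OF f] square_integrable_measurable[OF f]]
      l2_norm_power2_AE[OF l2_fun_l2_of[OF g] square_integrable_measurable[OF g]] .
qed

section \<open>Completeness and the Riesz representation theorem\<close>

text \<open>The interval has measure 1, so the mean is at most the quadratic mean; integrating
  \<open>2 e t \<le> t^2 + e^2\<close> shows it directly.\<close>

lemma integral_norm_le_of_l2_norm:
  assumes "norm u \<le> e" "e > 0"
  shows "(LINT x|unit_leb. cmod (l2_fun u x)) \<le> e"
proof -
  have sq: "square_integrable (l2_fun u)" by (rule square_integrable_l2_fun)
  have i: "integrable unit_leb (\<lambda>x. cmod (l2_fun u x))" "integrable unit_leb (\<lambda>x. (cmod (l2_fun u x))\<^sup>2)"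
    using square_integrable_integrable[OF sq] sq by (auto simp: square_integrable_def)
  have "(LINT x|unit_leb. cmod (l2_fun u x)) \<le> (LINT x|unit_leb. (cmod (l2_fun u x))\<^sup>2 / (2 * e) + e / 2)"
  proof (rule integral_mono)
    show "integrable unit_leb (\<lambda>x. (cmod (l2_fun u x))\<^sup>2 / (2 * e) + e / 2)"
      by (intro Bochner_Integration.integrable_add Bochner_Integration.integrable_divide i
          integrable_const_unit_leb)
    show "cmod (l2_fun u x) \<le> (cmod (l2_fun u x))\<^sup>2 / (2 * e) + e / 2" for x
      using zero_le_power2[of "cmod (l2_fun u x) - e"] assms(2)
      by (simp add: field_simps power2_eq_square)
  qed (rule i)
  also have "\<dots> = (norm u)\<^sup>2 / (2 * e) + e / 2"
    using i integrable_const_unit_leb[of "e / 2"] by (simp add: l2_norm_power2 measure_unit_leb)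
  also have "\<dots> \<le> e\<^sup>2 / (2 * e) + e / 2"
    using assms by (intro add_mono divide_right_mono power_mono) auto
  also have "\<dots> = e" using assms(2) by (simp add: power2_eq_square)
  finally show ?thesis .
qed

text \<open>Riesz--Fischer: a rapidly convergent subsequence converges almost everywhere, and Fatou's
  lemma identifies its pointwise limit as the limit in the mean.\<close>

lemma l2_Cauchy_convergent:
  fixes X :: "nat \<Rightarrow> l2"
  assumes "Cauchy X"
  obtains L where "X \<longlonglongrightarrow> L"
proof -
  have "\<exists>M. \<forall>m\<ge>M. \<forall>k\<ge>M. norm (X m - X k) < (1/2) ^ n" for n
    using assms[unfolded Cauchy_altdef2 Cauchy_def] CauchyD[OF assms, of "(1/2) ^ n"] by auto
  then obtain M where M: "\<And>n m k. m \<ge> M n \<Longrightarrow> k \<ge> M n \<Longrightarrow> norm (X m - X k) < (1/2) ^ n"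
    by metis
  \<comment> \<open>Taking \<open>max\<close> with the successor keeps the indices strictly
    increasing while \<open>r n \<ge> M n\<close>.\<close>
  define r where "r = rec_nat (M 0) (\<lambda>n rn. max (Suc rn) (M (Suc n)))"
  have rS: "r (Suc n) = max (Suc (r n)) (M (Suc n))" for n by (simp add: r_def)
  have r: "strict_mono r"
    by (rule strict_monoI_Suc) (simp add: rS)
  have rM: "r n \<ge> M n" for n
    by (cases n) (simp_all add: rS, simp add: r_def)
  have rapid: "norm (X (r m) - X (r n)) < (1/2) ^ n" if "m \<ge> n" for m n
    using that rM[of n] strict_mono_mono[OF r] by (intro M) (auto simp: mono_def intro: order_trans)
  define f where "f n = l2_fun (X (r n))" for n
  have f: "square_integrable (f n)" for n
    unfolding f_def by (rule square_integrable_l2_fun)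
  have fm[measurable]: "f n \<in> borel_measurable unit_leb" for n
    by (rule square_integrable_measurable[OF f])
  have diff: "AE x in unit_leb. l2_fun (X (r m) - X (r n)) x = f m x - f n x" for m n
    unfolding f_def by (rule l2_fun_diff)
  have dist: "(LINT x|unit_leb. (cmod (f m x - f n x))\<^sup>2) = (norm (X (r m) - X (r n)))\<^sup>2" for m n
    by (rule l2_norm_power2_AE[symmetric, OF diff]) measurable
  have "AE x in unit_leb. (\<Sum>n. ennreal (cmod (f (Suc n) x - f n x))) \<noteq> \<infinity>"
  proof (rule nn_integral_noteq_infinite)
    show "(\<lambda>x. \<Sum>n. ennreal (cmod (f (Suc n) x - f n x))) \<in> borel_measurable unit_leb"
      by measurable
    have "(\<integral>\<^sup>+x. (\<Sum>n. ennreal (cmod (f (Suc n) x - f n x))) \<partial>unit_leb)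
        = (\<Sum>n. (\<integral>\<^sup>+x. ennreal (cmod (f (Suc n) x - f n x)) \<partial>unit_leb))"
      by (rule nn_integral_suminf) measurable
    also have "\<dots> \<le> (\<Sum>n. ennreal ((1/2) ^ n))"
    proof (intro suminf_le allI summableI)
      fix n
      have "(\<integral>\<^sup>+x. ennreal (cmod (f (Suc n) x - f n x)) \<partial>unit_leb)
          = ennreal (LINT x|unit_leb. cmod (f (Suc n) x - f n x))"
        by (rule nn_integral_eq_integral)
          (use square_integrable_integrable[OF square_integrable_diff[OF f f]] in auto)
      also have "(LINT x|unit_leb. cmod (f (Suc n) x - f n x))
          = (LINT x|unit_leb. cmod (l2_fun (X (r (Suc n)) - X (r n)) x))"
      proof (rule integral_cong_AE)
        show "AE x in unit_leb. cmod (f (Suc n) x - f n x) = cmod (l2_fun (X (r (Suc n)) - X (r n)) x)"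
          using diff[of "Suc n" n] by eventually_elim simp
        show "(\<lambda>x. cmod (l2_fun (X (r (Suc n)) - X (r n)) x)) \<in> borel_measurable unit_leb"
          using square_integrable_measurable[OF square_integrable_l2_fun[of "X (r (Suc n)) - X (r n)"]]
          by measurable
      qed measurable
      also have "\<dots> \<le> (1/2) ^ n"
        using rapid[of n "Suc n"] by (intro integral_norm_le_of_l2_norm) auto
      finally show "(\<integral>\<^sup>+x. ennreal (cmod (f (Suc n) x - f n x)) \<partial>unit_leb) \<le> ennreal ((1/2) ^ n)"
        by (simp add: ennreal_leI)
    qed
    also have "\<dots> = ennreal (\<Sum>n. (1/2) ^ n)"
      by (rule suminf_ennreal2) (auto intro: summable_geometric)
    finally show "(\<integral>\<^sup>+x. (\<Sum>n. ennreal (cmod (f (Suc n) x - f n x))) \<partial>unit_leb) \<noteq> \<infinity>"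
      by (auto simp: top_unique)
  qed
  then have conv: "AE x in unit_leb. (\<lambda>n. f n x) \<longlonglongrightarrow> lim (\<lambda>n. f n x)"
  proof eventually_elim
    case (elim x)
    then have "summable (\<lambda>n. cmod (f (Suc n) x - f n x))"
      by (intro summable_suminf_not_top) auto
    then have "summable (\<lambda>n. f (Suc n) x - f n x)"
      by (rule summable_norm_cancel)
    then have "(\<lambda>n. \<Sum>i<n. f (Suc i) x - f i x) \<longlonglongrightarrow> (\<Sum>n. f (Suc n) x - f n x)"
      by (rule summable_LIMSEQ)
    then have "(\<lambda>n. (f n x - f 0 x) + f 0 x) \<longlonglongrightarrow> (\<Sum>n. f (Suc n) x - f n x) + f 0 x"
      using sum_lessThan_telescope[of "\<lambda>n. f n x"] by (intro tendsto_intros) simp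
    then show ?case by (auto simp: convergent_LIMSEQ_iff[symmetric] convergent_def)
  qed
  \<comment> \<open>\<open>lim\<close> has an unspecified value where the sequence diverges, which
    happens only on a null set.\<close>
  define g where "g x = lim (\<lambda>n. f n x)" for x
  have gm[measurable]: "g \<in> borel_measurable unit_leb"
    unfolding g_def by (rule borel_measurable_lim_metric) measurable
  have fatou: "(\<integral>\<^sup>+x. ennreal ((cmod (g x - f n x))\<^sup>2) \<partial>unit_leb) \<le> ennreal (((1/2) ^ n)\<^sup>2)" for n
  proof -
    have "(\<integral>\<^sup>+x. ennreal ((cmod (g x - f n x))\<^sup>2) \<partial>unit_leb)
        = (\<integral>\<^sup>+x. liminf (\<lambda>m. ennreal ((cmod (f m x - f n x))\<^sup>2)) \<partial>unit_leb)"
    proof (rule nn_integral_cong_AE)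
      show "AE x in unit_leb. ennreal ((cmod (g x - f n x))\<^sup>2) = liminf (\<lambda>m. ennreal ((cmod (f m x - f n x))\<^sup>2))"
        using conv
      proof eventually_elim
        case (elim x)
        have "(\<lambda>m. ennreal ((cmod (f m x - f n x))\<^sup>2)) \<longlonglongrightarrow> ennreal ((cmod (g x - f n x))\<^sup>2)"
          unfolding g_def by (intro tendsto_ennrealI tendsto_intros elim)
        then show ?case
          by (intro lim_imp_Liminf[symmetric]) auto
      qed
    qed
    also have "\<dots> \<le> liminf (\<lambda>m. \<integral>\<^sup>+x. ennreal ((cmod (f m x - f n x))\<^sup>2) \<partial>unit_leb)"
      by (rule nn_integral_liminf) measurable
    also have "\<dots> \<le> liminf (\<lambda>m. ennreal (((1/2) ^ n)\<^sup>2))"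
    proof (rule Liminf_mono)
      show "\<forall>\<^sub>F m in sequentially. (\<integral>\<^sup>+x. ennreal ((cmod (f m x - f n x))\<^sup>2) \<partial>unit_leb) \<le> ennreal (((1/2) ^ n)\<^sup>2)"
        using eventually_ge_at_top[of n]
      proof eventually_elim
        case (elim m)
        have "(\<integral>\<^sup>+x. ennreal ((cmod (f m x - f n x))\<^sup>2) \<partial>unit_leb)
            = ennreal (LINT x|unit_leb. (cmod (f m x - f n x))\<^sup>2)"
          by (rule nn_integral_eq_integral)
            (use square_integrable_diff[OF f f, of m n] in \<open>auto simp: square_integrable_def\<close>)
        also have "\<dots> \<le> ennreal (((1/2) ^ n)\<^sup>2)"
          unfolding dist using rapid[OF elim] by (intro ennreal_leI power_mono) auto
        finally show ?case .
      qed
    qed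
    also have "\<dots> = ennreal (((1/2) ^ n)\<^sup>2)"
      by (rule Liminf_const) simp
    finally show ?thesis .
  qed
  have gf: "square_integrable (\<lambda>x. g x - f n x)" for n
    unfolding square_integrable_def
  proof
    show "integrable unit_leb (\<lambda>x. (cmod (g x - f n x))\<^sup>2)"
      using fatou[of n] by (intro integrableI_bounded) (auto intro: le_less_trans)
  qed measurable
  have g: "square_integrable g"
    using square_integrable_add[OF gf[of 0] f[of 0]] by simp
  have close: "norm (X (r n) - l2_of g) \<le> (1/2) ^ n" for n
  proof -
    have "AE x in unit_leb. l2_fun (l2_of g - X (r n)) x = g x - f n x"
      using l2_fun_diff[of "l2_of g" "X (r n)"] l2_fun_l2_of[OF g]
      by eventually_elim (simp add: f_def)
    then have "(norm (l2_of g - X (r n)))\<^sup>2 = (LINT x|unit_leb. (cmod (g x - f n x))\<^sup>2)"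
      by (rule l2_norm_power2_AE) measurable
    moreover have "ennreal (LINT x|unit_leb. (cmod (g x - f n x))\<^sup>2) \<le> ennreal (((1/2) ^ n)\<^sup>2)"
      using fatou[of n] gf[of n]
      by (subst nn_integral_eq_integral[symmetric]) (auto simp: square_integrable_def)
    ultimately have "(norm (l2_of g - X (r n)))\<^sup>2 \<le> ((1/2) ^ n)\<^sup>2"
      by (simp add: ennreal_le_iff)
    then show ?thesis
      by (subst norm_minus_commute) (rule power2_le_imp_le, auto)
  qed
  have "(\<lambda>n. X (r n) - l2_of g) \<longlonglongrightarrow> 0"
    by (rule Lim_null_comparison[where g = "\<lambda>n. (1/2) ^ n"])
      (use close in \<open>auto intro: LIMSEQ_power_zero\<close>)
  then have "(X \<circ> r) \<longlonglongrightarrow> l2_of g"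
    unfolding o_def by (simp add: LIM_zero_iff)
  then have "X \<longlonglongrightarrow> l2_of g"
    by (rule Cauchy_converges_subseq[OF assms r])
  then show thesis by (rule that)
qed

text \<open>For small \<open>t\<close> of sign opposite to \<open>a\<close> the linear term wins.
  With the chosen \<open>t\<close> the quadratic term is at most \<open>- t * a\<close>, which gives
  back only half of what the linear term takes away; adding 1 to the absolute value of
  \<open>b\<close> avoids division by 0.\<close>

lemma quadratic_nonneg_imp_zero:
  fixes a b :: real
  assumes "\<And>t. 0 \<le> 2 * t * a + t\<^sup>2 * b"
  shows "a = 0"
proof (rule ccontr)
  assume a: "a \<noteq> 0"
  define t where "t = - a / (\<bar>b\<bar> + 1)"
  have "t\<^sup>2 * b \<le> t\<^sup>2 * (\<bar>b\<bar> + 1)" by (intro mult_left_mono) auto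
  also have "\<dots> = - t * a" by (simp add: t_def power2_eq_square)
  finally have "0 \<le> t * a" using assms[of t] by simp
  moreover have "t * a = - (a\<^sup>2 / (\<bar>b\<bar> + 1))" by (simp add: t_def power2_eq_square)
  moreover have "a\<^sup>2 / (\<bar>b\<bar> + 1) > 0" using a by (intro divide_pos_pos) auto
  ultimately show False by linarith
qed

text \<open>The representing vector is the limit of a minimizing sequence of \<open>\<parallel>L x\<parallel>\<^sup>2 - 2 \<phi> x\<close>.\<close>

lemma l2_riesz:
  fixes L :: "'b::real_vector \<Rightarrow> l2" and \<phi> :: "'b \<Rightarrow> real"
  assumes S: "subspace S"
    and L: "\<And>x y. x \<in> S \<Longrightarrow> y \<in> S \<Longrightarrow> L (x + y) = L x + L y" "\<And>c x. x \<in> S \<Longrightarrow> L (c *\<^sub>R x) = c *\<^sub>R L x"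
    and \<phi>: "\<And>x y. x \<in> S \<Longrightarrow> y \<in> S \<Longrightarrow> \<phi> (x + y) = \<phi> x + \<phi> y" "\<And>c x. x \<in> S \<Longrightarrow> \<phi> (c *\<^sub>R x) = c * \<phi> x"
    and bound: "\<And>x. x \<in> S \<Longrightarrow> \<bar>\<phi> x\<bar> \<le> C * norm (L x)"
  obtains w where "\<And>x. x \<in> S \<Longrightarrow> \<phi> x = inner (L x) w" "norm w \<le> C \<or> w = 0" "w \<in> closure (L ` S)"
proof -
  define J where "J x = (norm (L x))\<^sup>2 - 2 * \<phi> x" for x
  define I where "I = Inf (J ` S)"
  have S0: "0 \<in> S" using S by (rule subspace_0)
  have lower: "J x \<ge> - C\<^sup>2" if "x \<in> S" for x
  proof -
    have "2 * \<phi> x \<le> 2 * (C * norm (L x))" using bound[OF that] by linarith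
    also have "\<dots> \<le> (norm (L x))\<^sup>2 + C\<^sup>2"
      using zero_le_power2[of "norm (L x) - C"] by (simp add: power2_eq_square algebra_simps)
    finally show ?thesis by (simp add: J_def)
  qed
  have bdd: "bdd_below (J ` S)"
    using lower by (intro bdd_belowI[of _ "- C\<^sup>2"]) auto
  have JI: "I \<le> J x" if "x \<in> S" for x
    unfolding I_def by (intro cInf_lower bdd imageI that)
  have "\<exists>x\<in>S. J x < I + inverse (real (Suc n))" for n
  proof -
    have "I < I + inverse (real (Suc n))" by simp
    then show ?thesis
      unfolding I_def using cInf_lessD[of "J ` S" "Inf (J ` S) + inverse (real (Suc n))"] S0 by auto
  qed
  then obtain x where x: "\<And>n. x n \<in> S" "\<And>n. J (x n) < I + inverse (real (Suc n))"
    by metis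
  \<comment> \<open>Parallelogram identity: the linear parts of \<open>J\<close> cancel, and
    bounding \<open>J\<close> at the midpoint from below by \<open>I\<close> makes the images under
    \<open>L\<close> of a minimizing sequence Cauchy.\<close>
  have par: "(norm (L y - L z))\<^sup>2 = 2 * J y + 2 * J z - 4 * J ((1/2) *\<^sub>R (y + z))" if "y \<in> S" "z \<in> S" for y z
  proof -
    have yz: "y + z \<in> S" using S that by (rule subspace_add)
    show ?thesis
      unfolding J_def L(2)[OF yz] \<phi>(2)[OF yz] L(1)[OF that] \<phi>(1)[OF that] power2_norm_eq_inner
      by (simp add: inner_add_left inner_add_right inner_diff_left inner_diff_right inner_commute algebra_simps)
  qed
  have close: "(norm (L (x m) - L (x n)))\<^sup>2 \<le> 2 * inverse (real (Suc m)) + 2 * inverse (real (Suc n))" for m n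
  proof -
    have "(1/2) *\<^sub>R (x m + x n) \<in> S"
      using S x(1) by (intro subspace_scale subspace_add)
    from JI[OF this] show ?thesis
      unfolding par[OF x(1) x(1)] using x(2)[of m] x(2)[of n] by simp
  qed
  have "Cauchy (\<lambda>n. L (x n))"
  proof (rule CauchyI)
    fix e :: real assume e: "e > 0"
    obtain N where N: "inverse (real (Suc N)) < e\<^sup>2 / 4"
      using reals_Archimedean[of "e\<^sup>2 / 4"] e by auto
    show "\<exists>M. \<forall>m\<ge>M. \<forall>n\<ge>M. norm (L (x m) - L (x n)) < e"
    proof (intro exI allI impI)
      fix m n assume "m \<ge> N" "n \<ge> N"
      then have "inverse (real (Suc m)) \<le> inverse (real (Suc N))" "inverse (real (Suc n)) \<le> inverse (real (Suc N))"
        by (simp_all add: le_imp_inverse_le)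
      then have "(norm (L (x m) - L (x n)))\<^sup>2 < e\<^sup>2"
        using close[of m n] N by linarith
      then show "norm (L (x m) - L (x n)) < e"
        by (rule power_less_imp_less_base) (use e in simp)
    qed
  qed
  then obtain w where w: "(\<lambda>n. L (x n)) \<longlonglongrightarrow> w"
    by (rule l2_Cauchy_convergent)
  have JxI: "(\<lambda>n. J (x n)) \<longlonglongrightarrow> I"
  proof (rule tendsto_sandwich[of "\<lambda>n. I" _ _ "\<lambda>n. I + inverse (real (Suc n))"])
    show "(\<lambda>n. I + inverse (real (Suc n))) \<longlonglongrightarrow> I"
      using tendsto_add[OF tendsto_const LIMSEQ_inverse_real_of_nat, of I] by simp
    show "\<forall>\<^sub>F n in sequentially. J (x n) \<le> I + inverse (real (Suc n))"
      using x(2) by (intro always_eventually allI less_imp_le)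
  qed (use JI x(1) in auto)
  have rep: "\<phi> z = inner (L z) w" if z: "z \<in> S" for z
  proof -
    \<comment> \<open>First variation: \<open>J (x n + t z) \<ge> I\<close> is expanded in
      \<open>t\<close>, and then \<open>n\<close> tends to infinity. A minimizer in \<open>S\<close>
      itself may fail to exist, so only the limit \<open>w\<close> of the images is used.\<close>
    have "0 \<le> 2 * t * (inner w (L z) - \<phi> z) + t\<^sup>2 * (norm (L z))\<^sup>2" for t
    proof (rule tendsto_lowerbound[where F = sequentially])
      show "(\<lambda>n. (J (x n) - I) + 2 * t * (inner (L (x n)) (L z) - \<phi> z) + t\<^sup>2 * (norm (L z))\<^sup>2)
          \<longlonglongrightarrow> 2 * t * (inner w (L z) - \<phi> z) + t\<^sup>2 * (norm (L z))\<^sup>2"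
        by (rule tendsto_eq_intros JxI w refl | simp)+
      have "0 \<le> (J (x n) - I) + 2 * t * (inner (L (x n)) (L z) - \<phi> z) + t\<^sup>2 * (norm (L z))\<^sup>2" for n
      proof -
        have tz: "t *\<^sub>R z \<in> S" using S z by (rule subspace_scale)
        have "x n + t *\<^sub>R z \<in> S" using S x(1) tz by (rule subspace_add)
        from JI[OF this] show ?thesis
          unfolding J_def L(1)[OF x(1) tz] \<phi>(1)[OF x(1) tz] L(2)[OF z] \<phi>(2)[OF z] power2_norm_eq_inner
          by (simp add: inner_add_left inner_add_right inner_commute power2_eq_square algebra_simps)
      qed
      then show "\<forall>\<^sub>F n in sequentially. 0 \<le> (J (x n) - I) + 2 * t * (inner (L (x n)) (L z) - \<phi> z) + t\<^sup>2 * (norm (L z))\<^sup>2"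
        by simp
    qed simp
    then have "inner w (L z) - \<phi> z = 0"
      by (rule quadratic_nonneg_imp_zero)
    then show ?thesis by (simp add: inner_commute)
  qed
  show thesis
  proof (rule that[OF rep])
    show "w \<in> closure (L ` S)"
      unfolding closure_sequential using w x(1) by (intro exI[of _ "\<lambda>n. L (x n)"]) auto
    \<comment> \<open>The representation is tested on the minimizing sequence itself, whose images
      converge to \<open>w\<close>; cancelling \<open>norm w\<close> requires
      \<open>w \<noteq> 0\<close>.\<close>
    have "inner w w \<le> C * norm w"
    proof (rule tendsto_le[OF _ tendsto_mult[OF tendsto_const tendsto_norm[OF w]] tendsto_inner[OF w tendsto_const]])
      have "inner (L (x n)) w \<le> C * norm (L (x n))" for n
        using bound[OF x(1)[of n]] rep[OF x(1)[of n]] by linarith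
      then show "\<forall>\<^sub>F n in sequentially. inner (L (x n)) w \<le> C * norm (L (x n))" by simp
    qed simp
    then show "norm w \<le> C \<or> w = 0"
      using mult_right_le_imp_le[of "norm w" "norm w" C]
      by (cases "w = 0") (simp_all add: power2_eq_square flip: power2_norm_eq_inner)
  qed
qed

section \<open>Improper integrals over the unit interval\<close>

text \<open>The shift by 2 keeps the interval nonempty: for \<open>n = 0\<close> it is the point
  1/2.\<close>

definition exhaust :: "nat \<Rightarrow> real set" where
  "exhaust n = {1 / real (n + 2)..1 - 1 / real (n + 2)}"

lemma exhaust_bounds: "0 < 1 / real (n + 2)" "1 / real (n + 2) \<le> 1 - 1 / real (n + 2)" "1 - 1 / real (n + 2) < 1"
  by (auto simp: field_simps)

lemma exhaust_subset: "exhaust n \<subseteq> {0<..<1}"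
proof
  fix x assume "x \<in> exhaust n"
  then have "1 / real (n + 2) \<le> x" "x \<le> 1 - 1 / real (n + 2)"
    by (auto simp: exhaust_def)
  then show "x \<in> {0<..<1}"
    using exhaust_bounds(1,3)[of n] by (simp only: greaterThanLessThan_iff) linarith
qed

lemma exhaust_mono: "m \<le> n \<Longrightarrow> exhaust m \<subseteq> exhaust n"
  using frac_le[of 1 1 "real (m + 2)" "real (n + 2)"] by (auto simp: exhaust_def)

lemma exhaust_eventually:
  assumes "0 < x" "x < 1"
  shows "\<forall>\<^sub>F n in sequentially. x \<in> exhaust n"
proof -
  have "(\<lambda>n. 1 / real (n + 2)) \<longlonglongrightarrow> 0"
    using LIMSEQ_ignore_initial_segment[OF lim_const_over_n, of 1 2] by simp
  then have "\<forall>\<^sub>F n in sequentially. 1 / real (n + 2) < min x (1 - x)"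
    by (rule order_tendstoD) (use assms in auto)
  then show ?thesis
    by eventually_elim (auto simp: exhaust_def)
qed

lemma exhaust_indicator_tendsto:
  fixes f :: "real \<Rightarrow> 'a::real_normed_vector"
  assumes "0 < x" "x < 1"
  shows "(\<lambda>n. indicator (exhaust n) x *\<^sub>R f x) \<longlonglongrightarrow> f x"
  by (rule tendsto_eventually, rule eventually_mono[OF exhaust_eventually[OF assms]]) simp

lemma exhaust_limits:
  "filterlim (\<lambda>n. 1 / real (n + 2)) (at_right 0) sequentially"
  "filterlim (\<lambda>n. 1 - 1 / real (n + 2)) (at_left 1) sequentially"
proof -
  have l: "(\<lambda>n. 1 / real (n + 2)) \<longlonglongrightarrow> 0"
    using LIMSEQ_ignore_initial_segment[OF lim_const_over_n, of 1 2] by simp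
  show "filterlim (\<lambda>n. 1 / real (n + 2)) (at_right 0) sequentially"
    unfolding filterlim_at using l by (auto intro!: always_eventually)
  have "(\<lambda>n. 1 - 1 / real (n + 2)) \<longlonglongrightarrow> 1 - 0"
    by (intro tendsto_intros l)
  then show "filterlim (\<lambda>n. 1 - 1 / real (n + 2)) (at_left 1) sequentially"
    unfolding filterlim_at by (auto intro!: always_eventually)
qed

lemma exhaust_integral:
  fixes f :: "real \<Rightarrow> 'a::euclidean_space"
  assumes "f absolutely_integrable_on exhaust n"
  shows "integrable unit_leb (\<lambda>x. indicator (exhaust n) x *\<^sub>R f x)"
    "(LINT x|unit_leb. indicator (exhaust n) x *\<^sub>R f x) = integral (exhaust n) f"
proof -
  have "exhaust n \<in> sets lebesgue" "exhaust n \<subseteq> {0<..<1}"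
    using exhaust_subset[of n] by (auto simp: exhaust_def)
  from indicator_integral_unit_leb[OF assms this]
  show "integrable unit_leb (\<lambda>x. indicator (exhaust n) x *\<^sub>R f x)"
    "(LINT x|unit_leb. indicator (exhaust n) x *\<^sub>R f x) = integral (exhaust n) f" .
qed

lemma integrable_absolutely_integrable_on_Icc:
  fixes f :: "real \<Rightarrow> 'a::euclidean_space"
  assumes "integrable unit_leb f" "0 < a" "b < 1"
  shows "f absolutely_integrable_on {a..b}"
  by (rule set_integrable_subset[OF assms(1)[unfolded integrable_unit_leb_iff]]) (use assms in auto)

text \<open>Dominated convergence along the exhausting intervals, on which \<open>ac_deriv\<close>
  applies. Boundary values enter as one-sided limits, since \<open>F\<close> is controlled only in
  the open interval.\<close>

lemma ac_deriv_FTC: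
  assumes F: "ac_deriv F f" and f: "integrable unit_leb f"
    and A: "(F \<longlongrightarrow> A) (at_right 0)" and B: "(F \<longlongrightarrow> B) (at_left 1)"
  shows "(LINT x|unit_leb. f x) = B - A"
proof (rule LIMSEQ_unique)
  show "(\<lambda>n. LINT x|unit_leb. indicator (exhaust n) x *\<^sub>R f x) \<longlonglongrightarrow> (LINT x|unit_leb. f x)"
  proof (rule integral_dominated_convergence[where w = "\<lambda>x. norm (f x)"])
    show "AE x in unit_leb. (\<lambda>n. indicator (exhaust n) x *\<^sub>R f x) \<longlonglongrightarrow> f x"
      by (intro AE_unit_lebI exhaust_indicator_tendsto)
    show "(\<lambda>x. indicator (exhaust n) x *\<^sub>R f x) \<in> borel_measurable unit_leb" for n
      using exhaust_bounds[of n]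
      by (intro borel_measurable_integrable exhaust_integral(1))
        (simp add: exhaust_def locally_integrableD[OF ac_deriv_locally_integrable[OF F]])
  qed (use f in \<open>auto simp: indicator_def\<close>)
  have "(LINT x|unit_leb. indicator (exhaust n) x *\<^sub>R f x) = F (1 - 1 / real (n + 2)) - F (1 / real (n + 2))" for n
    using exhaust_bounds[of n] ac_deriv_integral[OF F exhaust_bounds(1-3)]
    by (subst exhaust_integral(2))
      (simp_all add: exhaust_def locally_integrableD[OF ac_deriv_locally_integrable[OF F]])
  then show "(\<lambda>n. LINT x|unit_leb. indicator (exhaust n) x *\<^sub>R f x) \<longlonglongrightarrow> B - A"
    using tendsto_diff[OF filterlim_compose[OF B exhaust_limits(2)] filterlim_compose[OF A exhaust_limits(1)]]
    by simp
qed

text \<open>Monotone convergence along \<open>exhaust\<close> turns an a priori bound that is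
  uniform over compact subintervals into integrability; this is how Hardy's estimate becomes a
  statement about L2.\<close>

lemma integrable_unit_leb_of_bounded:
  fixes g :: "real \<Rightarrow> real"
  assumes g: "continuous_on {0<..<1} g" "\<And>x. 0 < x \<Longrightarrow> x < 1 \<Longrightarrow> g x \<ge> 0"
    and bound: "\<And>a b. 0 < a \<Longrightarrow> a \<le> b \<Longrightarrow> b < 1 \<Longrightarrow> integral {a..b} g \<le> C"
  shows "integrable unit_leb g"
proof -
  have abs: "g absolutely_integrable_on exhaust n" for n
    using exhaust_subset[of n] unfolding exhaust_def
    by (intro absolutely_integrable_continuous_real continuous_on_subset[OF g(1)])
  note int = exhaust_integral[OF abs]
  have mono: "indicator (exhaust m) x *\<^sub>R g x \<le> indicator (exhaust n) x *\<^sub>R g x"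
    if "0 < x" "x < 1" "m \<le> n" for m n x
    using exhaust_mono[OF that(3)] g(2)[OF that(1,2)] by (auto simp: indicator_def)
  have "convergent (\<lambda>n. LINT x|unit_leb. indicator (exhaust n) x *\<^sub>R g x)"
  proof (rule Bseq_mono_convergent)
    have "0 \<le> (LINT x|unit_leb. indicator (exhaust n) x *\<^sub>R g x)" for n
      by (rule integral_nonneg_AE, rule AE_unit_lebI) (simp add: g(2))
    moreover have "(LINT x|unit_leb. indicator (exhaust n) x *\<^sub>R g x) \<le> C" for n
      unfolding int(2) unfolding exhaust_def by (intro bound exhaust_bounds)
    ultimately show "Bseq (\<lambda>n. LINT x|unit_leb. indicator (exhaust n) x *\<^sub>R g x)"
      by (intro BseqI'[of _ C]) simp
    show "\<forall>m. \<forall>n\<ge>m. (LINT x|unit_leb. indicator (exhaust m) x *\<^sub>R g x) \<le> (LINT x|unit_leb. indicator (exhaust n) x *\<^sub>R g x)"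
      by (intro allI impI integral_mono_AE int AE_unit_lebI mono)
  qed
  then obtain l where l: "(\<lambda>n. LINT x|unit_leb. indicator (exhaust n) x *\<^sub>R g x) \<longlonglongrightarrow> l"
    by (auto simp: convergent_def)
  show ?thesis
  proof (rule integrable_monotone_convergence[OF int(1) _ _ l])
    show "AE x in unit_leb. mono (\<lambda>n. indicator (exhaust n) x *\<^sub>R g x)"
      by (intro AE_unit_lebI monoI mono)
    show "AE x in unit_leb. (\<lambda>n. indicator (exhaust n) x *\<^sub>R g x) \<longlonglongrightarrow> g x"
      by (intro AE_unit_lebI exhaust_indicator_tendsto)
    show "g \<in> borel_measurable unit_leb"
      by (rule continuous_borel_measurable_unit_leb[OF g(1)])
  qed
qed

text \<open>Cauchy-Schwarz for the factorization \<open>f = p k\<close>. Keeping the weight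
  \<open>p\<close> apart allows its square to be integrated explicitly, even when it blows up at
  0.\<close>

lemma ac_deriv_square_bound:
  fixes p :: "real \<Rightarrow> real"
  assumes F: "ac_deriv F f" and k: "square_integrable k" and ab: "0 < a" "a \<le> b" "b < 1"
    and p: "continuous_on {a..b} p" and f: "\<And>x. x \<in> {a..b} \<Longrightarrow> f x = of_real (p x) * k x"
  shows "(cmod (F b - F a))\<^sup>2 \<le> integral {a..b} (\<lambda>x. (p x)\<^sup>2) * (LINT x|unit_leb. (cmod (k x))\<^sup>2)"
proof -
  have S: "{a..b} \<in> sets lebesgue" "{a..b} \<subseteq> {0<..<1}" using ab by auto
  define q where "q x = indicator {a..b} x *\<^sub>R complex_of_real (p x)" for x
  have p2: "(\<lambda>x. (p x)\<^sup>2) absolutely_integrable_on {a..b}"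
    by (intro absolutely_integrable_continuous_real continuous_intros p)
  have p1: "(\<lambda>x. complex_of_real (p x)) absolutely_integrable_on {a..b}"
    by (intro absolutely_integrable_continuous_real continuous_intros p)
  have eq: "(cmod (q x))\<^sup>2 = indicator {a..b} x *\<^sub>R (p x)\<^sup>2" for x
    by (simp add: q_def indicator_def)
  have "square_integrable q"
    unfolding square_integrable_def eq
    using indicator_integral_unit_leb(1)[OF p2 S] indicator_integral_unit_leb(1)[OF p1 S]
    by (auto simp: q_def[abs_def] intro: borel_measurable_integrable)
  from integral_Cauchy_Schwarz[OF this k]
  have "(cmod (LINT x|unit_leb. cnj (q x) * k x))\<^sup>2
      \<le> integral {a..b} (\<lambda>x. (p x)\<^sup>2) * (LINT x|unit_leb. (cmod (k x))\<^sup>2)"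
    unfolding eq indicator_integral_unit_leb(2)[OF p2 S] .
  also have "(\<lambda>x. cnj (q x) * k x) = (\<lambda>x. indicator {a..b} x *\<^sub>R f x)"
    using f by (auto simp: fun_eq_iff indicator_def q_def)
  also have "(LINT x|unit_leb. indicator {a..b} x *\<^sub>R f x) = F b - F a"
    using ac_deriv_integral[OF F ab] ab
    by (subst indicator_integral_unit_leb(2)[OF _ S])
      (auto intro: locally_integrableD[OF ac_deriv_locally_integrable[OF F]])
  finally show ?thesis .
qed

lemma ac_deriv_continuous_extension:
  assumes F: "ac_deriv F f" and f: "integrable unit_leb f"
  obtains G where "continuous_on {0..1} G" "\<And>x. 0 < x \<Longrightarrow> x < 1 \<Longrightarrow> F x = G x"
    "(F \<longlongrightarrow> G 0) (at_right 0)" "(F \<longlongrightarrow> G 1) (at_left 1)"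
proof -
  have "f absolutely_integrable_on {0..1}"
    using f by (simp add: integrable_unit_leb_iff absolutely_integrable_on_Icc_iff_Ioo)
  then have i: "f integrable_on {0..1}"
    by (rule set_lebesgue_integral_eq_integral(1))
  define G where "G x = F (1/2) - integral {0..1/2} f + integral {0..x} f" for x
  have c: "continuous_on {0..1} G"
    unfolding G_def by (intro continuous_intros indefinite_integral_continuous_1 i)
  have eq: "F x = G x" if x: "0 < x" "x < 1" for x
  proof -
    have comb: "integral {0..y} f + integral {y..z} f = integral {0..z} f" if "0 < y" "y \<le> z" "z < 1" for y z
      by (rule Henstock_Kurzweil_Integration.integral_combine)
        (use that in \<open>auto intro: integrable_on_subinterval[OF i]\<close>)
    show ?thesis
    proof (cases "x \<le> 1/2")
      case True
      then show ?thesis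
        using comb[of x "1/2"] ac_deriv_integral[OF F, of x "1/2"] x by (simp add: G_def algebra_simps)
    next
      case False
      then show ?thesis
        using comb[of "1/2" x] ac_deriv_integral[OF F, of "1/2" x] x by (simp add: G_def algebra_simps)
    qed
  qed
  have "(G \<longlongrightarrow> G 0) (at_right 0)" "(G \<longlongrightarrow> G 1) (at_left 1)"
    using c[unfolded continuous_on, rule_format, of 0] c[unfolded continuous_on, rule_format, of 1]
    by (simp_all add: at_within_Icc_at_right at_within_Icc_at_left)
  moreover have "\<forall>\<^sub>F x in at_right 0. G x = F x" "\<forall>\<^sub>F x in at_left 1. G x = F x"
    using eventually_at_right_real[of 0 1] eventually_at_left_real[of 0 1]
    by (auto elim!: eventually_mono simp: eq)
  ultimately have "(F \<longlongrightarrow> G 0) (at_right 0)" "(F \<longlongrightarrow> G 1) (at_left 1)"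
    using filterlim_cong[OF refl refl] by (metis (mono_tags, lifting))+
  then show thesis using that[OF c eq] by blast
qed

text \<open>Let the left end of the interval tend to 0. The weight is required only on
  \<open>{0<..x}\<close> and may depend on the fixed \<open>x\<close>, so a quotient normalized at
  \<open>x\<close> is admissible.\<close>

lemma ac_deriv_bound_at_zero:
  fixes p :: "real \<Rightarrow> real"
  assumes F: "ac_deriv F f" and k: "square_integrable k" and F0: "(F \<longlongrightarrow> 0) (at_right 0)"
    and x: "0 < x" "x < 1"
    and p: "continuous_on {0<..x} p" "\<And>y. 0 < y \<Longrightarrow> y \<le> x \<Longrightarrow> \<bar>p y\<bar> \<le> 1"
    and f: "\<And>y. 0 < y \<Longrightarrow> y \<le> x \<Longrightarrow> f y = of_real (p y) * k y"
  shows "(cmod (F x))\<^sup>2 \<le> (LINT x|unit_leb. (cmod (k x))\<^sup>2) * x"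
proof (rule tendsto_le[of "at_right 0"])
  define K where "K = (LINT x|unit_leb. (cmod (k x))\<^sup>2)"
  have K: "K \<ge> 0" unfolding K_def by (rule Bochner_Integration.integral_nonneg) simp
  show "((\<lambda>a. (cmod (F x - F a))\<^sup>2) \<longlongrightarrow> (cmod (F x))\<^sup>2) (at_right 0)"
    by (rule tendsto_eq_intros F0 refl | simp)+
  show "((\<lambda>a. K * (x - a)) \<longlongrightarrow> (LINT x|unit_leb. (cmod (k x))\<^sup>2) * x) (at_right 0)"
    unfolding K_def[symmetric] by (rule tendsto_eq_intros refl | simp)+
  have "(cmod (F x - F a))\<^sup>2 \<le> K * (x - a)" if a: "0 < a" "a < x" for a
  proof -
    have pa: "continuous_on {a..x} p"
      by (rule continuous_on_subset[OF p(1)]) (use a in auto)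
    have "(cmod (F x - F a))\<^sup>2 \<le> integral {a..x} (\<lambda>y. (p y)\<^sup>2) * K"
      unfolding K_def by (rule ac_deriv_square_bound[OF F k _ _ _ pa f]) (use a x in auto)
    also have "integral {a..x} (\<lambda>y. (p y)\<^sup>2) \<le> integral {a..x} (\<lambda>y. 1)"
    proof (rule integral_le)
      show "(p y)\<^sup>2 \<le> 1" if "y \<in> {a..x}" for y
        using p(2)[of y] that a power_mono[of "\<bar>p y\<bar>" 1 2] by simp
    qed (auto intro!: integrable_continuous_real continuous_intros pa)
    also have "\<dots> = x - a" using a by simp
    finally show ?thesis using K by (simp add: mult.commute mult_left_mono mult_right_mono)
  qed
  then show "\<forall>\<^sub>F a in at_right 0. (cmod (F x - F a))\<^sup>2 \<le> K * (x - a)"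
    using eventually_at_right_real[OF x(1)] by (auto elim: eventually_mono)
qed simp

section \<open>Hardy's inequality\<close>

text \<open>Both Hardy's inequality and its dual come from integrating the derivative of \<open>\<bar>F\<bar>\<^sup>2 / x\<close>,
  in which \<open>\<bar>F\<bar>\<^sup>2 / x\<^sup>2\<close> occurs with the factor \<open>2 \<alpha> - 1\<close>.\<close>

lemma hardy_square_integrable:
  assumes F: "ac_deriv F f" and k: "square_integrable (\<lambda>x. f x - of_real (\<alpha> / x) * F x)"
    and M: "\<And>x. 0 < x \<Longrightarrow> x < 1 \<Longrightarrow> (cmod (F x))\<^sup>2 \<le> M * x" and \<alpha>: "\<alpha> \<noteq> 1/2"
  shows "square_integrable (\<lambda>x. F x / of_real x)"
proof -
  define k where "k x = f x - of_real (\<alpha> / x) * F x" for x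
  define c where "c = \<bar>2 * \<alpha> - 1\<bar>"
  have c: "c > 0" using \<alpha> by (simp add: c_def)
  \<comment> \<open>The derivative of \<open>|F|^2 / x\<close>, from which the whole estimate is
    read off.\<close>
  define D where "D x = of_real (- 1 / x\<^sup>2) * (F x * cnj (F x)) + of_real (1 / x) * (f x * cnj (F x) + F x * cnj (f x))" for x
  have "ac_deriv (\<lambda>x. of_real (1 / x)) (\<lambda>x. of_real (- 1 / x\<^sup>2))"
    by (rule ac_deriv_of_real)
      (auto intro!: derivative_eq_intros continuous_intros simp: power2_eq_square)
  from ac_deriv_mult[OF this ac_deriv_mult[OF F ac_deriv_cnj[OF F]]]
  have D: "ac_deriv (\<lambda>x. of_real (1 / x) * (F x * cnj (F x))) D"
    by (simp add: D_def[abs_def])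
  define u where "u x = (cmod (F x) / x)\<^sup>2" for x
  have cu: "continuous_on {0<..<1} u"
    unfolding u_def by (intro continuous_intros ac_deriv_continuous[OF F]) auto
  have ki: "integrable unit_leb (\<lambda>x. (cmod (k x))\<^sup>2)"
    using k by (simp add: square_integrable_def k_def)
  define K where "K = (LINT x|unit_leb. (cmod (k x))\<^sup>2)"
  have ReD: "Re (D x) = (2 * \<alpha> - 1) * u x + 2 / x * Re (cnj (F x) * k x)" if "0 < x" "x < 1" for x
  proof -
    have e: "f x * cnj (F x) + F x * cnj (f x) = of_real (2 * Re (cnj (F x) * f x))"
      using complex_add_cnj[of "cnj (F x) * f x"] by (simp add: mult.commute)
    have f: "f x = k x + of_real (\<alpha> / x) * F x" by (simp add: k_def)
    have g: "Re (cnj (F x) * f x) = Re (cnj (F x) * k x) + \<alpha> / x * (cmod (F x))\<^sup>2"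
    proof -
      have "cnj (F x) * f x = cnj (F x) * k x + of_real (\<alpha> / x) * (F x * cnj (F x))"
        unfolding f by (simp add: algebra_simps)
      also have "\<dots> = cnj (F x) * k x + of_real (\<alpha> / x * (cmod (F x))\<^sup>2)"
        unfolding complex_norm_square[symmetric] by simp
      finally show ?thesis by (simp only: plus_complex.sel Re_complex_of_real)
    qed
    have "D x = of_real (- 1 / x\<^sup>2 * (cmod (F x))\<^sup>2 + 1 / x * (2 * Re (cnj (F x) * f x)))"
      unfolding D_def e complex_norm_square[symmetric] by simp
    then have "Re (D x) = - 1 / x\<^sup>2 * (cmod (F x))\<^sup>2 + 1 / x * (2 * Re (cnj (F x) * f x))"
      by (simp only: Re_complex_of_real)
    moreover have "- 1 / x\<^sup>2 * m + 1 / x * (2 * (q + \<alpha> / x * m)) = (2 * \<alpha> - 1) * (m / x\<^sup>2) + 2 / x * q" for m q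
      using that by (simp add: field_simps power2_eq_square)
    ultimately show ?thesis
      unfolding g u_def power_divide by (simp only:)
  qed
  \<comment> \<open>The sign makes the coefficient of \<open>u\<close> equal to
    \<open>c > 0\<close>, so Hardy's inequality and its dual are treated together.\<close>
  define s where "s = sgn (2 * \<alpha> - 1)"
  have s: "s * (2 * \<alpha> - 1) = c" "\<bar>s\<bar> = 1"
    using \<alpha> by (auto simp: s_def c_def sgn_if)
  \<comment> \<open>Young's inequality with weight \<open>c\<close> bounds the mixed term by half of
    \<open>c u\<close> plus a multiple of \<open>|k|^2\<close>; the other half survives.\<close>
  have point: "c / 2 * u x - 2 / c * (cmod (k x))\<^sup>2 \<le> s * Re (D x)" if x: "0 < x" "x < 1" for x
  proof -
    define p where "p = cmod (F x) / x"
    have "\<bar>Re (cnj (F x) * k x)\<bar> \<le> cmod (F x) * cmod (k x)"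
      using abs_Re_le_cmod[of "cnj (F x) * k x"] by (simp add: norm_mult)
    then have "\<bar>2 / x * Re (cnj (F x) * k x)\<bar> \<le> 2 / x * (cmod (F x) * cmod (k x))"
      unfolding abs_mult using x by (intro mult_mono) auto
    also have "\<dots> = 2 * p * cmod (k x)" by (simp add: p_def)
    also have "\<dots> \<le> c / 2 * p\<^sup>2 + 2 / c * (cmod (k x))\<^sup>2"
      using zero_le_power2[of "c * p - 2 * cmod (k x)"] c
      by (simp add: field_simps power2_eq_square)
    finally have "\<bar>s * (2 / x * Re (cnj (F x) * k x))\<bar> \<le> c / 2 * u x + 2 / c * (cmod (k x))\<^sup>2"
      by (simp only: abs_mult[of s] s(2) u_def p_def mult_1_left)
    moreover have "s * Re (D x) = c * u x + s * (2 / x * Re (cnj (F x) * k x))"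
      unfolding ReD[OF x] distrib_left s(1)[symmetric] by (simp only: mult.assoc)
    moreover have "A / 2 - B \<le> R" if "\<bar>z\<bar> \<le> A / 2 + B" "R = A + z" for z A B R :: real
      using that by linarith
    ultimately show ?thesis by (metis (no_types) times_divide_eq_left)
  qed
  have M0: "M \<ge> 0" using M[of "1/2"] zero_le_power2[of "cmod (F (1/2))"] by linarith
  have "integral {a..b} u \<le> 2 / c * (M + 2 / c * K)" if ab: "0 < a" "a \<le> b" "b < 1" for a b
  proof -
    have ui: "u integrable_on {a..b}"
      by (rule integrable_continuous_real, rule continuous_on_subset[OF cu]) (use ab in auto)
    have ka: "(\<lambda>x. (cmod (k x))\<^sup>2) integrable_on {a..b}"
      by (intro set_lebesgue_integral_eq_integral(1) integrable_absolutely_integrable_on_Icc[OF ki]) (use ab in auto)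
    have kK: "integral {a..b} (\<lambda>x. (cmod (k x))\<^sup>2) \<le> K"
      unfolding K_def integral_unit_leb[OF ki]
      using ab ka set_lebesgue_integral_eq_integral(1)[OF ki[unfolded integrable_unit_leb_iff]]
      by (intro integral_subset_le) auto
    have Di: "D integrable_on {a..b}"
      using ab by (intro locally_integrable_integrable_on ac_deriv_locally_integrable[OF D]) auto
    have Dint: "((\<lambda>x. Re (D x)) has_integral Re (integral {a..b} D)) {a..b}"
      using has_integral_linear[OF integrable_integral[OF Di] bounded_linear_Re] by (simp add: o_def)
    have "integral {a..b} D = of_real ((cmod (F b))\<^sup>2 / b - (cmod (F a))\<^sup>2 / a)"
      unfolding ac_deriv_integral[OF D ab, symmetric] complex_norm_square[symmetric] by simp
    then have Re: "Re (integral {a..b} D) = (cmod (F b))\<^sup>2 / b - (cmod (F a))\<^sup>2 / a"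
      by (simp only: Re_complex_of_real)
    \<comment> \<open>Both boundary terms lie in \<open>[0, M]\<close>, so their difference is at
      most \<open>M\<close> in absolute value for either sign \<open>s\<close>.\<close>
    have between: "0 \<le> (cmod (F x))\<^sup>2 / x \<and> (cmod (F x))\<^sup>2 / x \<le> M" if "0 < x" "x < 1" for x
      using M[OF that] that by (simp add: divide_le_eq)
    have "\<bar>Re (integral {a..b} D)\<bar> \<le> M"
      unfolding Re using between[OF ab(1) le_less_trans[OF ab(2,3)]] between[OF less_le_trans[OF ab(1,2)] ab(3)]
      by linarith
    then have "s * Re (integral {a..b} D) \<le> M"
      using abs_ge_self[of "s * Re (integral {a..b} D)"] by (simp add: abs_mult s(2))
    moreover have "c / 2 * integral {a..b} u - 2 / c * integral {a..b} (\<lambda>x. (cmod (k x))\<^sup>2)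
        \<le> s * Re (integral {a..b} D)"
    proof (rule has_integral_le)
      show "((\<lambda>x. c / 2 * u x - 2 / c * (cmod (k x))\<^sup>2) has_integral
          (c / 2 * integral {a..b} u - 2 / c * integral {a..b} (\<lambda>x. (cmod (k x))\<^sup>2))) {a..b}"
        by (intro has_integral_diff has_integral_mult_right integrable_integral ui ka)
      show "((\<lambda>x. s * Re (D x)) has_integral s * Re (integral {a..b} D)) {a..b}"
        by (intro has_integral_mult_right Dint)
    qed (use point ab in auto)
    moreover have "2 / c * integral {a..b} (\<lambda>x. (cmod (k x))\<^sup>2) \<le> 2 / c * K"
      using kK c by (intro mult_left_mono) auto
    ultimately have "c / 2 * integral {a..b} u \<le> M + 2 / c * K" by linarith
    then show ?thesis using c by (simp add: field_simps)
  qed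
  then have "integrable unit_leb u"
    by (intro integrable_unit_leb_of_bounded[OF cu]) (auto simp: u_def)
  moreover have "continuous_on {0<..<1} (\<lambda>x. F x / of_real x)"
    by (intro continuous_intros ac_deriv_continuous[OF F]) auto
  moreover have "integrable unit_leb (\<lambda>x. (cmod (F x / of_real x))\<^sup>2) = integrable unit_leb u"
    by (rule Bochner_Integration.integrable_cong) (auto simp: u_def norm_divide power_divide)
  ultimately show ?thesis
    unfolding square_integrable_def by (auto intro: continuous_borel_measurable_unit_leb)
qed

section \<open>Changes of representative on null sets\<close>

text \<open>Completeness of Lebesgue measure, carried over to the unit interval by extending with
  0.\<close>

lemma borel_measurable_unit_leb_AE:
  fixes f g :: "real \<Rightarrow> complex"
  assumes f: "f \<in> borel_measurable unit_leb" and fg: "AE x in unit_leb. f x = g x"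
  shows "g \<in> borel_measurable unit_leb"
proof -
  have S: "{0<..<1::real} \<in> sets lebesgue" by simp
  have "(\<lambda>x. if x \<in> {0<..<1} then f x else 0) \<in> borel_measurable lebesgue"
    by (rule borel_measurable_if_I[OF f S])
  moreover have "AE x in lebesgue. (if x \<in> {0<..<1} then f x else 0) = (if x \<in> {0<..<1} then g x else 0)"
    using fg by (subst (asm) AE_restrict_space_iff) (auto elim: eventually_mono)
  ultimately have "(\<lambda>x. if x \<in> {0<..<1} then g x else 0) \<in> borel_measurable lebesgue"
    by (rule borel_measurable_AE)
  then show ?thesis
    by (rule borel_measurable_if_D)
qed

lemma square_integrable_AE_cong:
  assumes "square_integrable f" "AE x in unit_leb. f x = g x"
  shows "square_integrable g"
  by (rule square_integrable_bound[OF assms(1) borel_measurable_unit_leb_AE[OF square_integrable_measurable[OF assms(1)] assms(2)], of 1])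
    (use assms(2) in \<open>auto elim: eventually_mono\<close>)

text \<open>For expressions built from arbitrary representatives, as in \<open>A_fun\<close> and
  \<open>hat\<close>, whose square-integrability is known only through an almost everywhere equal
  function.\<close>

lemma l2_fun_l2_of_AE:
  assumes "square_integrable f" "AE x in unit_leb. g x = f x"
  shows "AE x in unit_leb. l2_fun (l2_of g) x = f x"
proof -
  have "square_integrable g"
    by (rule square_integrable_AE_cong[OF assms(1)]) (use assms(2) in \<open>auto elim: eventually_mono\<close>)
  from l2_fun_l2_of[OF this] assms(2) show ?thesis
    by eventually_elim simp
qed

section \<open>The space of functions vanishing at the boundary\<close>

text \<open>A class with its absolutely continuous representative and derivative. Boundary values
  are one-sided limits because \<open>ac_deriv\<close> says nothing about the points 0 and
  1.\<close>

definition H10_rep :: "l2 \<Rightarrow> (real \<Rightarrow> complex) \<Rightarrow> (real \<Rightarrow> complex) \<Rightarrow> bool" where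
  "H10_rep f F g \<longleftrightarrow> ac_deriv F g \<and> square_integrable g \<and> (AE x in unit_leb. l2_fun f x = F x) \<and>
     (F \<longlongrightarrow> 0) (at_right 0) \<and> (F \<longlongrightarrow> 0) (at_left 1)"

lemma H10_repD:
  assumes "H10_rep f F g"
  shows "ac_deriv F g" "square_integrable g" "AE x in unit_leb. l2_fun f x = F x"
    "(F \<longlongrightarrow> 0) (at_right 0)" "(F \<longlongrightarrow> 0) (at_left 1)" "F \<in> borel_measurable unit_leb"
    "continuous_on {0<..<1} F"
  using assms ac_deriv_continuous[of F g] continuous_borel_measurable_unit_leb[of F]
  by (auto simp: H10_rep_def)

text \<open>The continuous representative on the closed interval and the absolutely continuous one
  on the open interval agree inside by continuity, so each boundary condition transfers to the other
  form. Conversely an integrable derivative gives a continuous extension.\<close>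

lemma H10_iff: "f \<in> H10 \<longleftrightarrow> (\<exists>F g. H10_rep f F g)"
proof
  assume f: "f \<in> H10"
  then obtain g C where g: "square_integrable g" "has_weak_deriv (l2_fun f) g"
    and C: "continuous_on {0..1} C" "AE x in unit_leb. l2_fun f x = C x" "C 0 = 0" "C 1 = 0"
    by (auto simp: H10_def H1_def)
  obtain F where F: "ac_deriv F g" "AE x in unit_leb. l2_fun f x = F x"
    using ac_deriv_of_has_weak_deriv[OF g(2)] by blast
  have AE: "AE x in unit_leb. F x = C x"
    using F(2) C(2) by eventually_elim simp
  have FC: "F x = C x" if "0 < x" "x < 1" for x
    by (rule continuous_AE_eq[OF ac_deriv_continuous[OF F(1)] continuous_on_subset[OF C(1)] AE that]) auto
  have "(C \<longlongrightarrow> 0) (at_right 0)" "(C \<longlongrightarrow> 0) (at_left 1)"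
    using C(1)[unfolded continuous_on, rule_format, of 0] C(1)[unfolded continuous_on, rule_format, of 1] C(3,4)
    by (simp_all add: at_within_Icc_at_right at_within_Icc_at_left)
  moreover have "\<forall>\<^sub>F x in at_right 0. C x = F x" "\<forall>\<^sub>F x in at_left 1. C x = F x"
    using eventually_at_right_real[of 0 1] eventually_at_left_real[of 0 1]
    by (auto elim!: eventually_mono simp: FC)
  ultimately have "(F \<longlongrightarrow> 0) (at_right 0)" "(F \<longlongrightarrow> 0) (at_left 1)"
    using filterlim_cong[OF refl refl] by (metis (mono_tags, lifting))+
  then show "\<exists>F g. H10_rep f F g"
    using F g by (auto simp: H10_rep_def)
next
  assume "\<exists>F g. H10_rep f F g"
  then obtain F g where F: "H10_rep f F g" by blast
  note F = H10_repD[OF F]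
  obtain G where G: "continuous_on {0..1} G" "\<And>x. 0 < x \<Longrightarrow> x < 1 \<Longrightarrow> F x = G x"
    "(F \<longlongrightarrow> G 0) (at_right 0)" "(F \<longlongrightarrow> G 1) (at_left 1)"
    using ac_deriv_continuous_extension[OF F(1) square_integrable_integrable[OF F(2)]] by blast
  have "G 0 = 0" "G 1 = 0"
    using tendsto_unique[OF _ G(3) F(4)] tendsto_unique[OF _ G(4) F(5)] by simp_all
  moreover have "AE x in unit_leb. F x = G x"
    by (rule AE_unit_lebI) (rule G(2))
  then have "AE x in unit_leb. l2_fun f x = G x"
    using F(3) by eventually_elim simp
  moreover have "f \<in> H1"
    unfolding H1_def
    using F(2) has_weak_deriv_AE_cong[OF has_weak_deriv_of_ac_deriv[OF F(1)] F(3)] by blast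
  ultimately show "f \<in> H10"
    unfolding H10_def using G(1) by blast
qed

lemma H10_rep_bound:
  assumes "H10_rep f F g" "0 < x" "x < 1"
  shows "(cmod (F x))\<^sup>2 \<le> (LINT x|unit_leb. (cmod (g x))\<^sup>2) * x"
  by (rule ac_deriv_bound_at_zero[OF H10_repD(1)[OF assms(1)] H10_repD(2)[OF assms(1)]
        H10_repD(4)[OF assms(1)] assms(2,3), of "\<lambda>_. 1"]) auto

lemma square_integrable_of_bound:
  assumes F: "continuous_on {0<..<1} F" and M: "\<And>x. 0 < x \<Longrightarrow> x < 1 \<Longrightarrow> (cmod (F x))\<^sup>2 \<le> M * x"
  shows "square_integrable F"
proof -
  have "square_integrable (\<lambda>x. F x * 1)"
  proof (rule square_integrable_mult_continuous[OF square_integrable_const F])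
    fix x :: real assume x: "0 < x" "x < 1"
    have M0: "M \<ge> 0" using M[of "1/2"] zero_le_power2[of "cmod (F (1/2))"] by linarith
    have "(cmod (F x))\<^sup>2 \<le> M * x" by (rule M[OF x])
    also have "\<dots> \<le> M" using M0 x by (simp add: mult_left_le)
    also have "\<dots> = (sqrt M)\<^sup>2" using M0 by simp
    finally show "cmod (F x) \<le> sqrt M" by (rule power2_le_imp_le) (use M0 in simp)
  qed
  then show ?thesis by simp
qed

text \<open>Hardy's inequality proper, the case \<alpha> = 0.\<close>

lemma H10_rep_hardy: "H10_rep f F g \<Longrightarrow> square_integrable (\<lambda>x. F x / of_real x)"
  by (rule hardy_square_integrable[of F g 0]) (auto simp: H10_repD intro: H10_rep_bound)

lemma H10_repI:
  assumes "ac_deriv F g" "square_integrable g" "(F \<longlongrightarrow> 0) (at_right 0)" "(F \<longlongrightarrow> 0) (at_left 1)"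
  shows "H10_rep (l2_of F) F g"
proof -
  have "square_integrable F"
    by (rule square_integrable_of_bound[OF ac_deriv_continuous[OF assms(1)]
          ac_deriv_bound_at_zero[OF assms(1-3), of _ "\<lambda>_. 1"]]) auto
  then show ?thesis
    using assms by (simp add: H10_rep_def l2_fun_l2_of)
qed

lemma H10_rep_add:
  assumes "H10_rep f F g" "H10_rep f' F' g'"
  shows "H10_rep (f + f') (\<lambda>x. F x + F' x) (\<lambda>x. g x + g' x)"
proof -
  have "AE x in unit_leb. l2_fun (f + f') x = F x + F' x"
    using l2_fun_add[of f f'] H10_repD(3)[OF assms(1)] H10_repD(3)[OF assms(2)]
    by eventually_elim simp
  moreover have "((\<lambda>x. F x + F' x) \<longlongrightarrow> 0) (at_right 0)" "((\<lambda>x. F x + F' x) \<longlongrightarrow> 0) (at_left 1)"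
    using tendsto_add[OF H10_repD(4)[OF assms(1)] H10_repD(4)[OF assms(2)]]
      tendsto_add[OF H10_repD(5)[OF assms(1)] H10_repD(5)[OF assms(2)]] by simp_all
  ultimately show ?thesis
    using assms unfolding H10_rep_def by (simp add: ac_deriv_add square_integrable_add)
qed

lemma H10_rep_scale:
  assumes "H10_rep f F g"
  shows "H10_rep (c *\<^sub>C f) (\<lambda>x. c * F x) (\<lambda>x. c * g x)"
proof -
  have "AE x in unit_leb. l2_fun (c *\<^sub>C f) x = c * F x"
    using l2_fun_scale[of c f] H10_repD(3)[OF assms] by eventually_elim simp
  moreover have "((\<lambda>x. c * F x) \<longlongrightarrow> 0) (at_right 0)" "((\<lambda>x. c * F x) \<longlongrightarrow> 0) (at_left 1)"
    using tendsto_mult_right_zero[OF H10_repD(4)[OF assms]]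
      tendsto_mult_right_zero[OF H10_repD(5)[OF assms]] by simp_all
  ultimately show ?thesis
    using assms unfolding H10_rep_def by (simp add: ac_deriv_cmult square_integrable_scale)
qed

lemma H10_zero: "0 \<in> H10"
  unfolding H10_iff
  by (rule exI[of _ "\<lambda>_. 0"], rule exI[of _ "\<lambda>_. 0"])
    (auto simp: H10_rep_def ac_deriv_const square_integrable_zero l2_fun_zero)

lemma H10_add: "f \<in> H10 \<Longrightarrow> g \<in> H10 \<Longrightarrow> f + g \<in> H10"
  unfolding H10_iff by (blast intro: H10_rep_add)

lemma H10_scale: "f \<in> H10 \<Longrightarrow> c *\<^sub>C f \<in> H10"
  unfolding H10_iff by (blast intro: H10_rep_scale)

lemma H10_diff: "f \<in> H10 \<Longrightarrow> g \<in> H10 \<Longrightarrow> f - g \<in> H10"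
  unfolding minus_l2_def uminus_l2_def by (intro H10_add H10_scale)

lemma H10_subspace: "subspace H10"
  by (auto simp: subspace_def scaleR_l2_def H10_zero H10_add H10_scale)

section \<open>The operator on its minimal domain\<close>

lemma A_fun_square_integrable:
  assumes "H10_rep f F g"
  shows "square_integrable (\<lambda>x. \<i> * g x + \<i> * of_real \<gamma> * (F x / of_real x))"
  by (intro square_integrable_add square_integrable_scale H10_rep_hardy[OF assms] H10_repD(2)[OF assms])

lemma A_fun_AE:
  assumes "H10_rep f F g"
  shows "AE x in unit_leb. l2_fun (A_fun \<gamma> f) x = \<i> * g x + \<i> * of_real \<gamma> * (F x / of_real x)"
  unfolding A_fun_def
proof (rule l2_fun_l2_of_AE[OF A_fun_square_integrable[OF assms]])
  show "AE x in unit_leb. \<i> * weak_deriv (l2_fun f) x + \<i> * of_real (\<gamma> / x) * l2_fun f x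
      = \<i> * g x + \<i> * of_real \<gamma> * (F x / of_real x)"
    using weak_deriv_eq[OF H10_repD(1,3)[OF assms]] H10_repD(3)[OF assms]
    by eventually_elim simp
qed

lemma A_fun_add:
  assumes "f \<in> H10" "g \<in> H10"
  shows "A_fun \<gamma> (f + g) = A_fun \<gamma> f + A_fun \<gamma> g"
proof -
  obtain F f' G g' where r: "H10_rep f F f'" "H10_rep g G g'"
    using assms by (auto simp: H10_iff)
  show ?thesis
    by (rule l2_eqI)
      (use A_fun_AE[OF H10_rep_add[OF r], of \<gamma>] A_fun_AE[OF r(1), of \<gamma>] A_fun_AE[OF r(2), of \<gamma>]
        l2_fun_add[of "A_fun \<gamma> f" "A_fun \<gamma> g"] in
        \<open>eventually_elim, simp add: algebra_simps add_divide_distrib\<close>)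
qed

lemma A_fun_scale:
  assumes "f \<in> H10"
  shows "A_fun \<gamma> (c *\<^sub>C f) = c *\<^sub>C A_fun \<gamma> f"
proof -
  obtain F f' where r: "H10_rep f F f'"
    using assms by (auto simp: H10_iff)
  show ?thesis
    by (rule l2_eqI)
      (use A_fun_AE[OF H10_rep_scale[OF r], of \<gamma> c] A_fun_AE[OF r, of \<gamma>]
        l2_fun_scale[of c "A_fun \<gamma> f"] in
        \<open>eventually_elim, simp add: algebra_simps\<close>)
qed

lemma A_fun_diff: "f \<in> H10 \<Longrightarrow> g \<in> H10 \<Longrightarrow> A_fun \<gamma> (f - g) = A_fun \<gamma> f - A_fun \<gamma> g"
  unfolding minus_l2_def uminus_l2_def by (simp add: A_fun_add A_fun_scale H10_scale)

text \<open>Its squared norm is the quadratic form \<open>Im <f, A f>\<close>, so it carries the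
  seminorm in which the boundary form of an extension is bounded.\<close>

definition hat :: "real \<Rightarrow> l2 \<Rightarrow> l2" where
  "hat \<gamma> f = l2_of (\<lambda>x. of_real (sqrt (\<gamma> / x)) * l2_fun f x)"

text \<open>\<open>(\<gamma> / x)^(1/2) F = (\<gamma> x)^(1/2) (F / x)\<close> is a bounded multiple
  of the function controlled by Hardy's inequality.\<close>

lemma hat_AE:
  assumes r: "H10_rep f F g" and \<gamma>: "\<gamma> > 0"
  shows "square_integrable (\<lambda>x. of_real (sqrt (\<gamma> / x)) * F x)"
    "AE x in unit_leb. l2_fun (hat \<gamma> f) x = of_real (sqrt (\<gamma> / x)) * F x"
proof -
  have "square_integrable (\<lambda>x. of_real (sqrt (\<gamma> * x)) * (F x / of_real x))"
  proof (rule square_integrable_mult_continuous[OF H10_rep_hardy[OF r]])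
    show "continuous_on {0<..<1} (\<lambda>x. complex_of_real (sqrt (\<gamma> * x)))"
      by (intro continuous_intros)
    show "cmod (complex_of_real (sqrt (\<gamma> * x))) \<le> sqrt \<gamma>" if "0 < x" "x < 1" for x
      using that \<gamma> by (simp add: mult_left_le)
  qed
  moreover have "AE x in unit_leb. of_real (sqrt (\<gamma> * x)) * (F x / of_real x) = of_real (sqrt (\<gamma> / x)) * F x"
  proof (rule AE_unit_lebI)
    fix x :: real assume x: "0 < x" "x < 1"
    have "sqrt (\<gamma> * x) / x = sqrt (\<gamma> / x)"
      using x by (simp add: real_sqrt_mult real_sqrt_divide field_simps)
    then have "complex_of_real (sqrt (\<gamma> * x)) / of_real x = of_real (sqrt (\<gamma> / x))"
      by (simp flip: of_real_divide)
    moreover have "of_real (sqrt (\<gamma> * x)) * (F x / of_real x) = (of_real (sqrt (\<gamma> * x)) / of_real x) * F x"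
      by simp
    ultimately show "of_real (sqrt (\<gamma> * x)) * (F x / of_real x) = of_real (sqrt (\<gamma> / x)) * F x"
      by (simp only:)
  qed
  ultimately show sq: "square_integrable (\<lambda>x. of_real (sqrt (\<gamma> / x)) * F x)"
    by (rule square_integrable_AE_cong)
  show "AE x in unit_leb. l2_fun (hat \<gamma> f) x = of_real (sqrt (\<gamma> / x)) * F x"
    unfolding hat_def
    by (rule l2_fun_l2_of_AE[OF sq], use H10_repD(3)[OF r] in eventually_elim) simp
qed

lemma hat_add:
  assumes "f \<in> H10" "g \<in> H10" "\<gamma> > 0"
  shows "hat \<gamma> (f + g) = hat \<gamma> f + hat \<gamma> g"
proof -
  obtain F f' G g' where r: "H10_rep f F f'" "H10_rep g G g'"
    using assms by (auto simp: H10_iff)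
  show ?thesis
    by (rule l2_eqI)
      (use hat_AE(2)[OF H10_rep_add[OF r] assms(3)] hat_AE(2)[OF r(1) assms(3)]
        hat_AE(2)[OF r(2) assms(3)] l2_fun_add[of "hat \<gamma> f" "hat \<gamma> g"] in
        \<open>eventually_elim, simp add: algebra_simps\<close>)
qed

lemma hat_scale:
  assumes "f \<in> H10" "\<gamma> > 0"
  shows "hat \<gamma> (c *\<^sub>C f) = c *\<^sub>C hat \<gamma> f"
proof -
  obtain F f' where r: "H10_rep f F f'"
    using assms by (auto simp: H10_iff)
  show ?thesis
    by (rule l2_eqI)
      (use hat_AE(2)[OF H10_rep_scale[OF r] assms(2), of c] hat_AE(2)[OF r assms(2)]
        l2_fun_scale[of c "hat \<gamma> f"] in \<open>eventually_elim, simp add: algebra_simps\<close>)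
qed

text \<open>Twice the real part of the integral of \<open>cnj F * g\<close> is the integral of the
  derivative of \<open>|F|^2\<close>, which vanishes. So the derivative term of \<open>A\<close>
  contributes a real number, and the imaginary part comes from the potential alone.\<close>

lemma Im_A_fun:
  assumes "f \<in> H10" and \<gamma>: "\<gamma> > 0"
  shows "Im (l2_inner f (A_fun \<gamma> f)) = (norm (hat \<gamma> f))\<^sup>2"
proof -
  obtain F g where r: "H10_rep f F g" using assms by (auto simp: H10_iff)
  note F = H10_repD[OF r]
  have Fsq: "square_integrable F"
    by (rule square_integrable_of_bound[OF F(7) H10_rep_bound[OF r]])
  have Fx: "square_integrable (\<lambda>x. F x / of_real x)"
    by (rule H10_rep_hardy[OF r])
  define p where "p x = cnj (F x) * g x" for x
  define q where "q x = cnj (F x) * (F x / of_real x)" for x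
  have p: "integrable unit_leb p" unfolding p_def by (rule integrable_cnj_mult[OF Fsq F(2)])
  have q: "integrable unit_leb q" unfolding q_def by (rule integrable_cnj_mult[OF Fsq Fx])
  have "l2_inner f (A_fun \<gamma> f) = (LINT x|unit_leb. cnj (F x) * (\<i> * g x + \<i> * of_real \<gamma> * (F x / of_real x)))"
    by (rule l2_inner_AE[OF F(3) A_fun_AE[OF r] F(6)
          square_integrable_measurable[OF A_fun_square_integrable[OF r]]])
  also have "(\<lambda>x. cnj (F x) * (\<i> * g x + \<i> * of_real \<gamma> * (F x / of_real x)))
      = (\<lambda>x. \<i> * p x + \<i> * of_real \<gamma> * q x)"
    by (simp add: fun_eq_iff p_def q_def algebra_simps)
  also have "(LINT x|unit_leb. \<i> * p x + \<i> * of_real \<gamma> * q x)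
      = \<i> * (LINT x|unit_leb. p x) + \<i> * of_real \<gamma> * (LINT x|unit_leb. q x)"
    using p q by simp
  finally have inner: "l2_inner f (A_fun \<gamma> f)
      = \<i> * (LINT x|unit_leb. p x) + \<i> * of_real \<gamma> * (LINT x|unit_leb. q x)" .
  have "(LINT x|unit_leb. g x * cnj (F x) + F x * cnj (g x)) = 0 * cnj 0 - 0 * cnj 0"
  proof (rule ac_deriv_FTC[OF ac_deriv_mult[OF F(1) ac_deriv_cnj[OF F(1)]]])
    show "integrable unit_leb (\<lambda>x. g x * cnj (F x) + F x * cnj (g x))"
      using p Bochner_Integration.integrable_add[OF p integrable_cnj[OF p]]
      by (simp add: p_def mult.commute)
  qed (intro tendsto_intros F)+
  moreover have "(\<lambda>x. g x * cnj (F x) + F x * cnj (g x)) = (\<lambda>x. p x + cnj (p x))"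
    by (simp add: fun_eq_iff p_def mult.commute)
  ultimately have "(LINT x|unit_leb. p x) + cnj (LINT x|unit_leb. p x) = 0"
    using p by (simp add: Bochner_Integration.integral_cnj)
  then have "Re (LINT x|unit_leb. p x) = 0"
    by (simp add: complex_add_cnj)
  moreover have "of_real \<gamma> * (LINT x|unit_leb. q x) = of_real ((norm (hat \<gamma> f))\<^sup>2)"
  proof -
    have "(norm (hat \<gamma> f))\<^sup>2 = (LINT x|unit_leb. (cmod (of_real (sqrt (\<gamma> / x)) * F x))\<^sup>2)"
      by (rule l2_norm_power2_AE[OF hat_AE(2)[OF r \<gamma>] square_integrable_measurable[OF hat_AE(1)[OF r \<gamma>]]])
    then have "complex_of_real ((norm (hat \<gamma> f))\<^sup>2)
        = (LINT x|unit_leb. of_real ((cmod (of_real (sqrt (\<gamma> / x)) * F x))\<^sup>2))"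
      by (simp only: integral_complex_of_real)
    also have "\<dots> = (LINT x|unit_leb. of_real \<gamma> * q x)"
    proof (rule Bochner_Integration.integral_cong[OF refl])
      fix x assume "x \<in> space unit_leb"
      then have x: "0 < x" "x < 1" by (auto simp: space_restrict_space)
      have "(cmod (of_real (sqrt (\<gamma> / x)) * F x))\<^sup>2 = \<gamma> / x * (cmod (F x))\<^sup>2"
        using x \<gamma> by (simp add: norm_mult power_mult_distrib)
      then show "complex_of_real ((cmod (of_real (sqrt (\<gamma> / x)) * F x))\<^sup>2) = of_real \<gamma> * q x"
        using complex_norm_square[of "F x"] by (simp add: q_def mult_ac)
    qed
    also have "\<dots> = of_real \<gamma> * (LINT x|unit_leb. q x)" by simp
    finally show ?thesis by simp
  qed
  ultimately show ?thesis
    unfolding inner by (simp add: mult.assoc)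
qed

text \<open>The summand \<open>i\<close> adds \<open>norm f ^ 2\<close> to the nonnegative form
  \<open>Im <f, A f>\<close>, and Cauchy-Schwarz bounds the sum. This is the bounded inverse of
  \<open>A + i\<close> behind the closedness of \<open>A\<close>.\<close>

lemma norm_le_norm_A_fun_plus:
  assumes "f \<in> H10" "\<gamma> > 0"
  shows "norm f \<le> norm (A_fun \<gamma> f + \<i> *\<^sub>C f)"
proof (cases "norm f = 0")
  case False
  have "(norm f)\<^sup>2 \<le> Im (l2_inner f (A_fun \<gamma> f)) + (norm f)\<^sup>2"
    unfolding Im_A_fun[OF assms] by simp
  also have "\<dots> = Im (l2_inner f (A_fun \<gamma> f + \<i> *\<^sub>C f))"
    by (simp add: l2_inner_add_right l2_inner_scale_right l2_inner_self_norm)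
  also have "\<dots> \<le> norm f * norm (A_fun \<gamma> f + \<i> *\<^sub>C f)"
    using abs_Im_le_cmod[of "l2_inner f (A_fun \<gamma> f + \<i> *\<^sub>C f)"]
      l2_Cauchy_Schwarz[of f "A_fun \<gamma> f + \<i> *\<^sub>C f"] by linarith
  finally show ?thesis using False by (simp add: power2_eq_square)
qed simp

section \<open>Range and density\<close>

definition range_normal :: "real \<Rightarrow> l2" where
  "range_normal \<gamma> = l2_of (\<lambda>x. of_real (x powr \<gamma> * exp x))"

lemma range_normal_AE:
  assumes \<gamma>: "\<gamma> > 0"
  shows "square_integrable (\<lambda>x. of_real (x powr \<gamma> * exp x))"
    "AE x in unit_leb. l2_fun (range_normal \<gamma>) x = of_real (x powr \<gamma> * exp x)"
proof -
  have "square_integrable (\<lambda>x. of_real (x powr \<gamma> * exp x) * 1)"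
  proof (rule square_integrable_mult_continuous[OF square_integrable_const])
    show "continuous_on {0<..<1} (\<lambda>x. complex_of_real (x powr \<gamma> * exp x))"
      by (intro continuous_intros) auto
    show "cmod (complex_of_real (x powr \<gamma> * exp x)) \<le> exp 1" if "0 < x" "x < 1" for x
      unfolding norm_of_real abs_mult
      using that \<gamma> powr_le1[of \<gamma> x] mult_mono[of "x powr \<gamma>" 1 "exp x" "exp 1"] by simp
  qed
  then show "square_integrable (\<lambda>x. of_real (x powr \<gamma> * exp x))" by simp
  then show "AE x in unit_leb. l2_fun (range_normal \<gamma>) x = of_real (x powr \<gamma> * exp x)"
    unfolding range_normal_def by (rule l2_fun_l2_of)
qed

lemma ac_deriv_weight:
  "ac_deriv (\<lambda>x. of_real (x powr a * exp (b * x)))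
     (\<lambda>x. of_real ((a / x + b) * (x powr a * exp (b * x))))"
  by (rule ac_deriv_of_real)
    (auto intro!: derivative_eq_intros continuous_intros simp: field_simps powr_diff)

text \<open>Multiplying by \<open>x^\<gamma> exp x\<close> turns \<open>A + i\<close> into \<open>i\<close> times the derivative.\<close>

lemma range_normal_orthogonal:
  assumes "f \<in> H10" and \<gamma>: "\<gamma> > 0"
  shows "l2_inner (range_normal \<gamma>) (A_fun \<gamma> f + \<i> *\<^sub>C f) = 0"
proof -
  obtain F g where r: "H10_rep f F g" using assms by (auto simp: H10_iff)
  note F = H10_repD[OF r]
  have Fsq: "square_integrable F"
    by (rule square_integrable_of_bound[OF F(7) H10_rep_bound[OF r]])
  define h where "h x = (\<i> * g x + \<i> * of_real \<gamma> * (F x / of_real x)) + \<i> * F x" for x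
  have h: "square_integrable h"
    unfolding h_def by (intro square_integrable_add[OF A_fun_square_integrable[OF r]] square_integrable_scale Fsq)
  have hAE: "AE x in unit_leb. l2_fun (A_fun \<gamma> f + \<i> *\<^sub>C f) x = h x"
    using l2_fun_add[of "A_fun \<gamma> f" "\<i> *\<^sub>C f"] A_fun_AE[OF r, of \<gamma>] l2_fun_scale[of \<i> f] F(3)
    by eventually_elim (simp add: h_def)
  define m where "m x = complex_of_real (x powr \<gamma> * exp (1 * x))" for x
  define m' where "m' x = complex_of_real ((\<gamma> / x + 1) * (x powr \<gamma> * exp (1 * x)))" for x
  have m: "ac_deriv m m'"
    using ac_deriv_weight[of \<gamma> 1] by (simp add: m_def[abs_def] m'_def[abs_def])
  have "l2_inner (range_normal \<gamma>) (A_fun \<gamma> f + \<i> *\<^sub>C f) = (LINT x|unit_leb. cnj (of_real (x powr \<gamma> * exp x)) * h x)"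
    by (rule l2_inner_AE[OF range_normal_AE(2)[OF \<gamma>] hAE])
      (intro square_integrable_measurable range_normal_AE(1)[OF \<gamma>] h)+
  also have "\<dots> = (LINT x|unit_leb. \<i> * (m' x * F x + m x * g x))"
    by (rule Bochner_Integration.integral_cong[OF refl])
      (auto simp: h_def m_def m'_def space_restrict_space field_simps)
  also have "\<dots> = \<i> * (LINT x|unit_leb. m' x * F x + m x * g x)" by simp
  also have "(LINT x|unit_leb. m' x * F x + m x * g x) = 0 - 0"
  proof (rule ac_deriv_FTC[OF ac_deriv_mult[OF m F(1)]])
    have "integrable unit_leb (\<lambda>x. (- \<i>) * (cnj (of_real (x powr \<gamma> * exp x)) * h x))"
      using integrable_cnj_mult[OF range_normal_AE(1)[OF \<gamma>] h] by (rule integrable_mult_right)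
    also have "?this \<longleftrightarrow> integrable unit_leb (\<lambda>x. m' x * F x + m x * g x)"
      by (rule Bochner_Integration.integrable_cong[OF refl])
        (auto simp: h_def m_def m'_def space_restrict_space field_simps)
    finally show "integrable unit_leb (\<lambda>x. m' x * F x + m x * g x)" .
    have bound: "cmod (m x * F x) \<le> exp 1 * cmod (F x)" if "0 < x" "x < 1" for x
      unfolding norm_mult m_def norm_of_real abs_mult
      using that \<gamma> powr_le1[of \<gamma> x] mult_mono[of "x powr \<gamma>" 1 "exp x" "exp 1"]
      by (intro mult_right_mono) auto
    show "((\<lambda>x. m x * F x) \<longlongrightarrow> 0) (at_right 0)"
    proof (rule Lim_null_comparison)
      show "((\<lambda>x. exp 1 * cmod (F x)) \<longlongrightarrow> 0) (at_right 0)"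
        using tendsto_mult_right_zero[OF tendsto_norm_zero[OF F(4)]] .
      show "\<forall>\<^sub>F x in at_right 0. cmod (m x * F x) \<le> exp 1 * cmod (F x)"
        using eventually_at_right_real[of 0 1] by (auto elim!: eventually_mono intro: bound)
    qed
    show "((\<lambda>x. m x * F x) \<longlongrightarrow> 0) (at_left 1)"
    proof (rule Lim_null_comparison)
      show "((\<lambda>x. exp 1 * cmod (F x)) \<longlongrightarrow> 0) (at_left 1)"
        using tendsto_mult_right_zero[OF tendsto_norm_zero[OF F(5)]] .
      show "\<forall>\<^sub>F x in at_left 1. cmod (m x * F x) \<le> exp 1 * cmod (F x)"
        using eventually_at_left_real[of 0 1] by (auto elim!: eventually_mono intro: bound)
    qed
  qed
  finally show ?thesis by simp
qed

text \<open>With \<open>m = x^\<gamma> exp x\<close> the equation reads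
  \<open>(m f)' = - i m g\<close>, so \<open>f = - i P / m\<close> for a primitive \<open>P\<close>
  of \<open>m g\<close>. Normalizing \<open>P\<close> to vanish at 0, orthogonality is exactly the
  vanishing at 1. At 0 the factor \<open>1 / m\<close> is singular; there monotonicity of
  \<open>m\<close> gives \<open>|f|^2 \<le> K x\<close>, and the Hardy estimate with
  \<open>\<alpha> = - \<gamma>\<close> puts \<open>f / x\<close>, hence \<open>f'\<close>, into
  L2.\<close>

lemma range_A_fun_plus:
  assumes \<gamma>: "\<gamma> > 0" and g: "l2_inner (range_normal \<gamma>) g = 0"
  obtains f where "f \<in> H10" "A_fun \<gamma> f + \<i> *\<^sub>C f = g"
proof -
  define g0 where "g0 = l2_fun g"
  have g0: "square_integrable g0" unfolding g0_def by (rule square_integrable_l2_fun)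
  define m where "m x = x powr \<gamma> * exp x" for x :: real
  have mpos: "m x > 0" if "0 < x" for x using that by (simp add: m_def)
  define h where "h x = of_real (m x) * g0 x" for x
  have hi: "integrable unit_leb h"
    using integrable_cnj_mult[OF range_normal_AE(1)[OF \<gamma>] g0] by (simp add: h_def[abs_def] m_def)
  have h0: "(LINT x|unit_leb. h x) = 0"
    using g l2_inner_AE[OF range_normal_AE(2)[OF \<gamma>] _ square_integrable_measurable[OF range_normal_AE(1)[OF \<gamma>]]
        square_integrable_measurable[OF g0], of g]
    by (simp add: g0_def h_def[abs_def] m_def)
  have hl: "locally_integrable h"
    unfolding locally_integrable_iff using integrable_absolutely_integrable_on_Icc[OF hi] by blast
  obtain H where H: "ac_deriv H h" using ac_deriv_exists[OF hl] by blast
  obtain G where G: "continuous_on {0..1} G" "\<And>x. 0 < x \<Longrightarrow> x < 1 \<Longrightarrow> H x = G x"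
    "(H \<longlongrightarrow> G 0) (at_right 0)" "(H \<longlongrightarrow> G 1) (at_left 1)"
    using ac_deriv_continuous_extension[OF H hi] by blast
  have G01: "G 1 = G 0"
    using ac_deriv_FTC[OF H hi G(3,4)] h0 by simp
  define P where "P x = H x + (- G 0)" for x
  have P: "ac_deriv P h"
    using ac_deriv_add[OF H ac_deriv_const[of "- G 0"]] by (simp add: P_def[abs_def])
  have P0: "(P \<longlongrightarrow> 0) (at_right 0)" and P1: "(P \<longlongrightarrow> 0) (at_left 1)"
    unfolding P_def by (rule tendsto_eq_intros G refl | simp add: G01)+
  define w where "w x = complex_of_real (x powr (- \<gamma>) * exp ((- 1) * x))" for x
  define w' where "w' x = complex_of_real ((- \<gamma> / x + (- 1)) * (x powr (- \<gamma>) * exp ((- 1) * x)))" for x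
  have w: "ac_deriv w w'"
    using ac_deriv_weight[of "- \<gamma>" "- 1"] by (simp add: w_def[abs_def] w'_def[abs_def])
  have wm: "w x = of_real (1 / m x)" if "x > 0" for x
    using that by (simp add: w_def m_def powr_minus exp_minus divide_inverse mult.commute)
  define F where "F x = - \<i> * (w x * P x)" for x
  define k where "k x = - F x - \<i> * g0 x" for x
  have F: "ac_deriv F (\<lambda>x. of_real (- \<gamma> / x) * F x + k x)"
  proof (rule ac_deriv_cong[OF ac_deriv_cmult[OF ac_deriv_mult[OF w P], of "- \<i>"]])
    show "AE x in unit_leb. - \<i> * (w' x * P x + w x * h x) = of_real (- \<gamma> / x) * F x + k x"
    proof (rule AE_unit_lebI)
      fix x :: real assume x: "0 < x" "x < 1"
      have "w' x = of_real (- \<gamma> / x + (- 1)) * w x"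
        by (simp add: w'_def w_def)
      moreover have "w x * h x = g0 x"
        using mpos[OF x(1)] by (simp add: wm[OF x(1)] h_def)
      ultimately have "w' x * P x + w x * h x = of_real (- \<gamma> / x + (- 1)) * w x * P x + g0 x"
        by (simp only:)
      then show "- \<i> * (w' x * P x + w x * h x) = of_real (- \<gamma> / x) * F x + k x"
        by (simp only: F_def k_def) (simp add: algebra_simps)
    qed
  qed (simp add: F_def)
  define K where "K = (LINT x|unit_leb. (cmod (g0 x))\<^sup>2)"
  have bound: "(cmod (F x))\<^sup>2 \<le> K * x" if x: "0 < x" "x < 1" for x
  proof -
    \<comment> \<open>Normalizing at the fixed point \<open>x\<close> leaves the weight
      \<open>m y / m x\<close>, which is at most 1 because \<open>m\<close> increases.\<close>
    have "ac_deriv (\<lambda>y. of_real (1 / m x) * P y) (\<lambda>y. of_real (1 / m x) * h y)"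
      by (rule ac_deriv_cmult[OF P])
    then have "(cmod (of_real (1 / m x) * P x))\<^sup>2 \<le> K * x"
      unfolding K_def
    proof (rule ac_deriv_bound_at_zero[OF _ g0 _ x, of _ _ "\<lambda>y. m y / m x"])
      show "((\<lambda>y. of_real (1 / m x) * P y) \<longlongrightarrow> 0) (at_right 0)"
        by (rule tendsto_mult_right_zero[OF P0])
      show "continuous_on {0<..x} (\<lambda>y. m y / m x)"
        unfolding m_def using x by (intro continuous_intros) auto
      show "\<bar>m y / m x\<bar> \<le> 1" if "0 < y" "y \<le> x" for y
      proof -
        have "m y \<le> m x"
          unfolding m_def using that \<gamma> by (intro mult_mono powr_mono2) auto
        then show ?thesis
          using mpos[of y] mpos[of x] that x by simp
      qed
      show "of_real (1 / m x) * h y = of_real (m y / m x) * g0 y" for y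
        by (simp add: h_def)
    qed
    then show ?thesis
      by (simp add: F_def wm[OF x(1)] norm_mult norm_divide)
  qed
  have Fsq: "square_integrable F"
    by (rule square_integrable_of_bound[OF ac_deriv_continuous[OF F] bound])
  have k: "square_integrable k"
    unfolding k_def by (intro square_integrable_diff square_integrable_uminus square_integrable_scale Fsq g0)
  have Fx: "square_integrable (\<lambda>x. F x / of_real x)"
    by (rule hardy_square_integrable[OF F _ bound, of "- \<gamma>"]) (use k \<gamma> in simp_all)
  have F': "square_integrable (\<lambda>x. of_real (- \<gamma> / x) * F x + k x)"
    using square_integrable_add[OF square_integrable_scale[OF Fx, of "of_real (- \<gamma>)"] k] by simp
  have F0: "(F \<longlongrightarrow> 0) (at_right 0)"
  proof (rule Lim_null_comparison)
    show "((\<lambda>x. sqrt (K * x)) \<longlongrightarrow> 0) (at_right 0)"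
      by (rule tendsto_eq_intros refl | simp)+
    show "\<forall>\<^sub>F x in at_right 0. cmod (F x) \<le> sqrt (K * x)"
      using eventually_at_right_real[of 0 1]
      by (auto elim!: eventually_mono intro: real_le_rsqrt bound)
  qed
  have F1: "(F \<longlongrightarrow> 0) (at_left 1)"
  proof -
    have "((\<lambda>x. - \<i> * (w x * P x)) \<longlongrightarrow> - \<i> * (of_real (1 powr (- \<gamma>) * exp ((- 1) * 1)) * 0)) (at_left 1)"
      unfolding w_def by (intro tendsto_intros P1) auto
    then show ?thesis by (simp add: F_def[abs_def])
  qed
  have r: "H10_rep (l2_of F) F (\<lambda>x. of_real (- \<gamma> / x) * F x + k x)"
    by (rule H10_repI[OF F F' F0 F1])
  show thesis
  proof (rule that)
    show "l2_of F \<in> H10" using r by (auto simp: H10_iff)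
    show "A_fun \<gamma> (l2_of F) + \<i> *\<^sub>C l2_of F = g"
    proof (rule l2_eqI)
      show "AE x in unit_leb. l2_fun (A_fun \<gamma> (l2_of F) + \<i> *\<^sub>C l2_of F) x = l2_fun g x"
        using l2_fun_add[of "A_fun \<gamma> (l2_of F)" "\<i> *\<^sub>C l2_of F"] A_fun_AE[OF r, of \<gamma>]
          l2_fun_scale[of \<i> "l2_of F"] H10_repD(3)[OF r]
        by eventually_elim (simp add: k_def g0_def algebra_simps)
    qed
  qed
qed

section \<open>Density of the domain, closedness and dissipativity of A\<close>

text \<open>The support stays away from 0, so every real power is an admissible factor:
  \<open>a = 0\<close> serves for density, \<open>a = - \<gamma>\<close> for the differential
  equation of the extension vector.\<close>

lemma test_function_H10_rep:
  assumes \<phi>: "test_function \<phi>"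
  shows "H10_rep (l2_of (\<lambda>x. of_real (x powr a * \<phi> x))) (\<lambda>x. of_real (x powr a * \<phi> x))
     (\<lambda>x. of_real (a * x powr (a - 1) * \<phi> x + x powr a * deriv \<phi> x))"
proof (rule H10_repI)
  obtain c d where cd: "0 < c" "c < d" "d < 1"
    "\<And>x. x \<notin> {c<..<d} \<Longrightarrow> \<phi> x = 0" "\<And>x. x \<notin> {c<..<d} \<Longrightarrow> deriv \<phi> x = 0"
    using test_function_support[OF \<phi>] by blast
  define f where "f x = x powr a * \<phi> x" for x
  define g where "g x = a * x powr (a - 1) * \<phi> x + x powr a * deriv \<phi> x" for x
  show "ac_deriv (\<lambda>x. of_real (x powr a * \<phi> x)) (\<lambda>x. of_real (a * x powr (a - 1) * \<phi> x + x powr a * deriv \<phi> x))"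
    using ac_deriv_mult[OF ac_deriv_powr[of a] test_function_ac_deriv[OF \<phi>]] by simp
  have g0: "g x = 0" if "x \<notin> {c<..<d}" for x
    using cd(4,5)[OF that] by (simp add: g_def)
  have cont: "continuous_on {0<..<1} g"
    unfolding g_def
    by (intro continuous_intros continuous_on_subset[OF test_function_has_deriv(2)[OF \<phi>]]
        continuous_at_imp_continuous_on ballI DERIV_isCont[OF test_function_has_deriv(1)[OF \<phi>]]) auto
  have "bounded (g ` {c..d})"
    by (intro compact_imp_bounded compact_continuous_image continuous_on_subset[OF cont])
      (use cd in auto)
  then obtain B where B: "\<And>x. x \<in> {c..d} \<Longrightarrow> \<bar>g x\<bar> \<le> B"
    unfolding bounded_iff by (metis imageI real_norm_def)
  have B': "\<bar>g x\<bar> \<le> max B 0" for x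
    using B[of x] g0[of x] by (cases "x \<in> {c<..<d}") auto
  have "square_integrable (\<lambda>x. of_real (g x) * 1)"
    by (rule square_integrable_mult_continuous[OF square_integrable_const])
      (use B' in \<open>auto intro!: continuous_intros cont\<close>)
  then show "square_integrable (\<lambda>x. of_real (a * x powr (a - 1) * \<phi> x + x powr a * deriv \<phi> x))"
    by (simp only: g_def mult_1_right)
  have "\<forall>\<^sub>F x in at_right 0. complex_of_real (x powr a * \<phi> x) = 0"
    using eventually_at_right_real[OF cd(1)] by eventually_elim (use cd(4) in auto)
  then show "((\<lambda>x. complex_of_real (x powr a * \<phi> x)) \<longlongrightarrow> 0) (at_right 0)"
    by (rule tendsto_eventually)
  have "\<forall>\<^sub>F x in at_left 1. complex_of_real (x powr a * \<phi> x) = 0"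
    using eventually_at_left_real[OF cd(3)] by eventually_elim (use cd(4) in auto)
  then show "((\<lambda>x. complex_of_real (x powr a * \<phi> x)) \<longlongrightarrow> 0) (at_left 1)"
    by (rule tendsto_eventually)
qed

text \<open>Pairing with test functions makes \<open>z\<close> a weak derivative of the zero
  function, so it vanishes by uniqueness of derivatives.\<close>

lemma H10_orthogonal_imp_zero:
  assumes "\<And>f. f \<in> H10 \<Longrightarrow> l2_inner f z = 0"
  shows "z = 0"
proof -
  have z: "square_integrable (l2_fun z)" by (rule square_integrable_l2_fun)
  have "has_weak_deriv (\<lambda>_. 0) (l2_fun z)"
    unfolding has_weak_deriv_def
  proof (intro conjI allI impI)
    show "locally_integrable (\<lambda>_. 0)" by (simp add: locally_integrable_iff)
    show "locally_integrable (l2_fun z)" by (rule square_integrable_locally_integrable[OF z])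
    fix \<phi> assume \<phi>: "test_function \<phi>"
    note r = test_function_H10_rep[OF \<phi>, of 0]
    have "l2_of (\<lambda>x. of_real (x powr 0 * \<phi> x)) \<in> H10"
      unfolding H10_iff using r by blast
    then have "0 = l2_inner (l2_of (\<lambda>x. of_real (x powr 0 * \<phi> x))) z"
      by (rule assms[symmetric])
    also have "\<dots> = (LINT x|unit_leb. cnj (of_real (x powr 0 * \<phi> x)) * l2_fun z x)"
      by (rule l2_inner_AE[OF H10_repD(3)[OF r] _ H10_repD(6)[OF r] square_integrable_measurable[OF z]]) simp
    also have "\<dots> = (LINT x|unit_leb. \<phi> x *\<^sub>R l2_fun z x)"
      by (rule Bochner_Integration.integral_cong[OF refl])
        (auto simp: space_restrict_space scaleR_conv_of_real)
    finally show "(LINT x|unit_leb. deriv \<phi> x *\<^sub>R 0) = - (LINT x|unit_leb. \<phi> x *\<^sub>R l2_fun z x)"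
      by simp
  qed
  then obtain F where F: "ac_deriv F (l2_fun z)" "AE x in unit_leb. 0 = F x"
    by (rule ac_deriv_of_has_weak_deriv)
  have "AE x in unit_leb. F x = 0" using F(2) by eventually_elim simp
  then have "AE x in unit_leb. l2_fun z x = 0"
    by (rule ac_deriv_unique(2)[OF F(1) ac_deriv_const])
  then have "AE x in unit_leb. l2_fun z x = l2_fun 0 x"
    using l2_fun_zero by eventually_elim simp
  then show ?thesis by (rule l2_eqI)
qed

text \<open>For the identity map, \<open>l2_riesz\<close> produces an orthogonal projection: a
  \<open>w\<close> in the closure with \<open>u - w\<close> orthogonal to \<open>H10\<close>. It
  controls real parts only; multiplying by \<open>i\<close> inside \<open>H10\<close> gives the
  imaginary parts.\<close>

lemma closure_H10: "closure H10 = UNIV"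
proof (rule UNIV_eq_I[symmetric])
  fix u :: l2
  obtain w where w: "\<And>x. x \<in> H10 \<Longrightarrow> inner x u = inner x w" "w \<in> closure ((\<lambda>x. x) ` H10)"
  proof (rule l2_riesz[OF H10_subspace, of "\<lambda>x. x" "\<lambda>x. inner x u" "norm u"])
    show "\<bar>inner x u\<bar> \<le> norm u * norm x" for x
      using Cauchy_Schwarz_ineq2[of x u] by (simp add: mult.commute)
  qed (auto simp: inner_add_left)
  have re: "Re (l2_inner x (u - w)) = 0" if "x \<in> H10" for x
    using w(1)[OF that] by (simp add: inner_l2_def l2_inner_diff_right)
  have "u - w = 0"
  proof (rule H10_orthogonal_imp_zero)
    fix f assume f: "f \<in> H10"
    show "l2_inner f (u - w) = 0"
      using re[OF f] re[OF H10_scale[OF f, of \<i>]] by (simp add: l2_inner_scale_left complex_eq_iff)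
  qed
  then show "u \<in> closure H10" using w(2) by simp
qed

lemma bounded_linear_l2_scale: "bounded_linear ((*\<^sub>C) c)"
  by (rule bounded_linear_intro[of _ "cmod c"])
    (simp_all add: l2_scale_add scaleR_l2_def l2_scale_scale mult.commute l2_norm_scale)

lemma bounded_linear_l2_inner: "bounded_linear (l2_inner u)"
  by (rule bounded_linear_intro[of _ "norm u"])
    (simp_all add: l2_inner_add_right scaleR_l2_def l2_inner_scale_right scaleR_conv_of_real
      l2_Cauchy_Schwarz mult.commute[of "norm _" "norm u"])

lemma A_op_iff: "(f, g) \<in> A_op \<gamma> \<longleftrightarrow> f \<in> H10 \<and> g = A_fun \<gamma> f"
  by (auto simp: A_op_def)

text \<open>The range of \<open>A + i\<close> is an orthogonal complement and therefore closed, so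
  the limit of \<open>(A + i) f n\<close> equals \<open>(A + i) f0\<close> for some
  \<open>f0\<close> in the domain. The lower bound for \<open>A + i\<close> then forces
  \<open>f n\<close> to converge to \<open>f0\<close>.\<close>

lemma closed_A_op:
  assumes \<gamma>: "\<gamma> > 0"
  shows "closed (A_op \<gamma>)"
  unfolding closed_sequential_limits
proof (intro allI impI)
  fix x l assume x: "(\<forall>n. x n \<in> A_op \<gamma>) \<and> x \<longlonglongrightarrow> l"
  define f where "f n = fst (x n)" for n
  have f: "f n \<in> H10" "snd (x n) = A_fun \<gamma> (f n)" for n
    using x by (auto simp: f_def A_op_def dest!: spec[of _ n])
  have "f \<longlonglongrightarrow> fst l"
    unfolding f_def by (intro tendsto_fst) (use x in blast)
  moreover have "(\<lambda>n. snd (x n)) \<longlonglongrightarrow> snd l"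
    by (intro tendsto_snd) (use x in blast)
  ultimately have lim: "f \<longlonglongrightarrow> fst l" "(\<lambda>n. A_fun \<gamma> (f n)) \<longlonglongrightarrow> snd l"
    by (simp_all only: f(2))
  define g where "g = snd l + \<i> *\<^sub>C fst l"
  have g: "(\<lambda>n. A_fun \<gamma> (f n) + \<i> *\<^sub>C f n) \<longlonglongrightarrow> g"
    unfolding g_def by (intro tendsto_add lim bounded_linear.tendsto[OF bounded_linear_l2_scale])
  have "(\<lambda>n. l2_inner (range_normal \<gamma>) (A_fun \<gamma> (f n) + \<i> *\<^sub>C f n)) \<longlonglongrightarrow> l2_inner (range_normal \<gamma>) g"
    by (rule bounded_linear.tendsto[OF bounded_linear_l2_inner g])
  then have "l2_inner (range_normal \<gamma>) g = 0"
    by (simp add: range_normal_orthogonal[OF f(1) \<gamma>] LIMSEQ_const_iff)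
  then obtain f0 where f0: "f0 \<in> H10" "A_fun \<gamma> f0 + \<i> *\<^sub>C f0 = g"
    by (rule range_A_fun_plus[OF \<gamma>])
  have "norm (f n - f0) \<le> norm ((A_fun \<gamma> (f n) + \<i> *\<^sub>C f n) - g)" for n
  proof -
    have "A_fun \<gamma> (f n - f0) + \<i> *\<^sub>C (f n - f0) = (A_fun \<gamma> (f n) + \<i> *\<^sub>C f n) - g"
      by (simp add: A_fun_diff[OF f(1) f0(1)] l2_scale_diff algebra_simps flip: f0(2))
    then show ?thesis
      using norm_le_norm_A_fun_plus[OF H10_diff[OF f(1)[of n] f0(1)] \<gamma>] by simp
  qed
  then have "(\<lambda>n. f n - f0) \<longlonglongrightarrow> 0"
    by (intro Lim_null_comparison[OF _ tendsto_norm_zero[OF LIM_zero[OF g]]]) simp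
  then have "f \<longlonglongrightarrow> f0" by (simp add: LIM_zero_iff)
  then have "fst l = f0" by (rule LIMSEQ_unique[OF lim(1)])
  then have "l = (f0, A_fun \<gamma> f0)"
    using f0(2) by (cases l) (simp add: g_def)
  then show "l \<in> A_op \<gamma>" using f0(1) by (simp add: A_op_iff)
qed

lemma dissipative_A_op:
  assumes \<gamma>: "\<gamma> > 0"
  shows "dissipative (A_op \<gamma>)"
  unfolding dissipative_def
proof (intro conjI)
  have "A_fun \<gamma> 0 = 0"
    using A_fun_scale[OF H10_zero, of \<gamma> 0] by (simp add: l2_scale_zero)
  then show "linear_op (A_op \<gamma>)"
    unfolding linear_op_def single_valued_def
    by (auto simp: A_op_iff H10_zero H10_add H10_scale A_fun_add A_fun_scale)
  have "Domain (A_op \<gamma>) = H10" by (auto simp: A_op_def)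
  then show "densely_defined (A_op \<gamma>)" by (simp add: densely_defined_def closure_H10)
  show "\<forall>(f, g)\<in>A_op \<gamma>. 0 \<le> Im (l2_inner f g)"
    by (auto simp: A_op_iff Im_A_fun[OF _ \<gamma>])
qed

text \<open>The range of \<open>A + i\<close> has codimension one, and \<open>S + i\<close> is injective for dissipative \<open>S\<close>.\<close>

lemma dissipative_extension_dependent:
  assumes \<gamma>: "\<gamma> > 0" and S: "dissipative S" "A_op \<gamma> \<subseteq> S" and el: "(v, l) \<in> S" "(z, q) \<in> S"
  obtains a b f where "a \<noteq> 0 \<or> b \<noteq> 0" "f \<in> H10" "a *\<^sub>C v + b *\<^sub>C z = f" "a *\<^sub>C l + b *\<^sub>C q = A_fun \<gamma> f"
proof -
  define p where "p = l2_inner (range_normal \<gamma>) (l + \<i> *\<^sub>C v)"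
  define r where "r = l2_inner (range_normal \<gamma>) (q + \<i> *\<^sub>C z)"
  \<comment> \<open>The coefficients are chosen so that the combination pairs to 0 with
    \<open>range_normal\<close>.\<close>
  obtain a b where ab: "a \<noteq> 0 \<or> b \<noteq> 0" "a * p + b * r = 0"
  proof (cases "p = 0")
    case True
    then show ?thesis using that[of 1 0] by simp
  next
    case False
    then show ?thesis using that[of "- r" p] by simp
  qed
  define y where "y = a *\<^sub>C v + b *\<^sub>C z"
  define s where "s = a *\<^sub>C l + b *\<^sub>C q"
  have lin: "linear_op S" using S by (simp add: dissipative_def)
  have add: "(f + f', g + g') \<in> S" if "(f, g) \<in> S" "(f', g') \<in> S" for f f' g g'
    using lin that unfolding linear_op_def by blast
  have scale: "(c *\<^sub>C f, c *\<^sub>C g) \<in> S" if "(f, g) \<in> S" for f g c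
    using lin that unfolding linear_op_def by blast
  have ys: "(y, s) \<in> S" unfolding y_def s_def by (intro add scale el)
  have "s + \<i> *\<^sub>C y = a *\<^sub>C (l + \<i> *\<^sub>C v) + b *\<^sub>C (q + \<i> *\<^sub>C z)"
    by (simp add: y_def s_def l2_scale_add l2_scale_scale mult.commute)
  then have "l2_inner (range_normal \<gamma>) (s + \<i> *\<^sub>C y) = 0"
    using ab(2) by (simp add: l2_inner_add_right l2_inner_scale_right p_def r_def)
  then obtain f where f: "f \<in> H10" "A_fun \<gamma> f + \<i> *\<^sub>C f = s + \<i> *\<^sub>C y"
    by (rule range_A_fun_plus[OF \<gamma>])
  have "(f, A_fun \<gamma> f) \<in> S" using S(2) f(1) by (auto simp: A_op_def)
  from add[OF ys scale[OF this, of "- 1"]]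
  have d: "(y - f, s - A_fun \<gamma> f) \<in> S" by (simp add: minus_l2_def uminus_l2_def)
  \<comment> \<open>If nonzero, \<open>y - f\<close> would be an eigenvector of \<open>S\<close>
    with eigenvalue \<open>- i\<close>, where the form has the negative imaginary part
    \<open>- norm (y - f) ^ 2\<close>.\<close>
  have eq: "s - A_fun \<gamma> f = (- \<i>) *\<^sub>C (y - f)"
  proof -
    have "s - A_fun \<gamma> f = \<i> *\<^sub>C f - \<i> *\<^sub>C y"
      using f(2) by (simp add: algebra_simps)
    also have "\<dots> = \<i> *\<^sub>C (f - y)" by (simp add: l2_scale_diff)
    also have "f - y = (- 1) *\<^sub>C (y - f)" by (simp flip: uminus_l2_def)
    finally show ?thesis by (simp add: l2_scale_scale)
  qed
  have "0 \<le> Im (l2_inner (y - f) (s - A_fun \<gamma> f))"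
    using S(1) d by (auto simp: dissipative_def)
  then have "(norm (y - f))\<^sup>2 \<le> 0"
    unfolding eq l2_inner_scale_right l2_inner_self_norm by simp
  then have "y = f" by simp
  moreover have "s = A_fun \<gamma> f" using eq \<open>y = f\<close> by (simp add: l2_scale_zero)
  ultimately show thesis
    using that[OF ab(1) f(1)] by (simp add: y_def s_def)
qed

section \<open>The space of admissible extension vectors\<close>

lemma ac_deriv_limit_at_one:
  assumes "ac_deriv U U'" "square_integrable U'"
  obtains c where "(U \<longlongrightarrow> c) (at_left 1)"
  by (rule ac_deriv_continuous_extension[OF assms(1) square_integrable_integrable[OF assms(2)]])
    (rule that)

text \<open>Membership in \<open>W\<close> read off a representative of \<open>x^(1/2) v\<close>.
  The limit at 1 exists because \<open>U'\<close> is integrable, and it is unrestricted because the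
  power in \<open>W\<close> equals 1 there and absorbs it.\<close>

definition W_rep :: "l2 \<Rightarrow> (real \<Rightarrow> complex) \<Rightarrow> (real \<Rightarrow> complex) \<Rightarrow> bool" where
  "W_rep v U U' \<longleftrightarrow> ac_deriv U U' \<and> square_integrable U' \<and>
     (AE x in unit_leb. of_real (sqrt x) * l2_fun v x = U x) \<and> (U \<longlongrightarrow> 0) (at_right 0)"

lemma powr_half_facts:
  fixes \<gamma> :: real
  assumes \<gamma>: "\<gamma> > 0"
  defines "p \<equiv> \<lambda>x. complex_of_real (x powr (\<gamma> + 1/2))"
    and "p' \<equiv> \<lambda>x. complex_of_real ((\<gamma> + 1/2) * x powr (\<gamma> + 1/2 - 1))"
  shows "ac_deriv p p'" "square_integrable p'" "square_integrable p"
    "(p \<longlongrightarrow> 0) (at_right 0)" "(p \<longlongrightarrow> 1) (at_left 1)"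
    "\<And>x. 0 < x \<Longrightarrow> p' x = of_real ((\<gamma> + 1/2) / x) * p x"
proof -
  show ac: "ac_deriv p p'" unfolding p_def p'_def by (rule ac_deriv_powr)
  show eq: "p' x = of_real ((\<gamma> + 1/2) / x) * p x" if "0 < x" for x
    unfolding p_def p'_def of_real_mult[symmetric] of_real_eq_iff powr_diff[of x "\<gamma> + 1/2" 1]
    using that by simp
  have bound: "(cmod (p x))\<^sup>2 \<le> 1 * x" if x: "0 < x" "x < 1" for x
  proof -
    have "(cmod (p x))\<^sup>2 = (x powr \<gamma>)\<^sup>2 * x"
      using x by (simp add: p_def powr_add power_mult_distrib powr_half_sqrt norm_mult)
    also have "\<dots> \<le> 1 * x"
      using x \<gamma> powr_le1[of \<gamma> x] by (intro mult_right_mono power_le_one) auto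
    finally show ?thesis .
  qed
  show "square_integrable p"
    by (rule square_integrable_of_bound[OF ac_deriv_continuous[OF ac] bound])
  \<comment> \<open>For small \<gamma> the derivative is unbounded at 0. The Hardy estimate applies
    with \<open>\<alpha> = \<gamma> + 1/2\<close> and \<open>k = 0\<close>, since \<open>p\<close>
    solves the homogeneous equation.\<close>
  have "square_integrable (\<lambda>x. p x / of_real x)"
  proof (rule hardy_square_integrable[OF ac _ bound, of "\<gamma> + 1/2"])
    have "AE x in unit_leb. 0 = p' x - of_real ((\<gamma> + 1/2) / x) * p x"
      by (rule AE_unit_lebI) (simp add: eq)
    then show "square_integrable (\<lambda>x. p' x - of_real ((\<gamma> + 1/2) / x) * p x)"
      by (rule square_integrable_AE_cong[OF square_integrable_zero])
  qed (use \<gamma> in auto)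
  from square_integrable_scale[OF this, of "of_real (\<gamma> + 1/2)"]
  show "square_integrable p'"
    by (rule square_integrable_AE_cong) (rule AE_unit_lebI, simp add: eq)
  show "(p \<longlongrightarrow> 0) (at_right 0)"
  proof (rule Lim_null_comparison)
    show "((\<lambda>x. sqrt x) \<longlongrightarrow> 0) (at_right 0)"
      by (rule tendsto_eq_intros refl | simp)+
    show "\<forall>\<^sub>F x in at_right 0. cmod (p x) \<le> sqrt x"
      using eventually_at_right_real[of 0 1]
      by (auto elim!: eventually_mono intro!: real_le_rsqrt) (use bound in auto)
  qed
  have "(p \<longlongrightarrow> of_real (1 powr (\<gamma> + 1/2))) (at_left 1)"
    unfolding p_def by (intro tendsto_intros) auto
  then show "(p \<longlongrightarrow> 1) (at_left 1)" by simp
qed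

lemma square_integrable_sqrt_l2_fun: "square_integrable (\<lambda>x. of_real (sqrt x) * l2_fun v x)"
  by (rule square_integrable_mult_continuous[OF square_integrable_l2_fun, of _ 1])
    (auto intro!: continuous_intros)

lemma W_iff:
  assumes \<gamma>: "\<gamma> > 0"
  shows "v \<in> W \<gamma> \<longleftrightarrow> (\<exists>U U'. W_rep v U U')"
proof
  note pw = powr_half_facts[OF \<gamma>]
  assume "v \<in> W \<gamma>"
  then obtain h c where h: "h \<in> H10"
    "l2_of (\<lambda>x. of_real (sqrt x) * l2_fun v x) = h + c *\<^sub>C l2_of (\<lambda>x. of_real (x powr (\<gamma> + 1/2)))"
    by (auto simp: W_def)
  obtain H H' where r: "H10_rep h H H'" using h(1) by (auto simp: H10_iff)
  have "AE x in unit_leb. of_real (sqrt x) * l2_fun v x = H x + c * of_real (x powr (\<gamma> + 1/2))"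
    using l2_fun_l2_of[OF square_integrable_sqrt_l2_fun[of v], unfolded h(2)]
      l2_fun_add[of h "c *\<^sub>C l2_of (\<lambda>x. of_real (x powr (\<gamma> + 1/2)))"]
      l2_fun_scale[of c "l2_of (\<lambda>x. of_real (x powr (\<gamma> + 1/2)))"]
      l2_fun_l2_of[OF pw(3)] H10_repD(3)[OF r]
    by eventually_elim simp
  moreover have "((\<lambda>x. H x + c * of_real (x powr (\<gamma> + 1/2))) \<longlongrightarrow> 0 + c * 0) (at_right 0)"
    by (intro tendsto_intros H10_repD(4)[OF r] pw(4))
  ultimately show "\<exists>U U'. W_rep v U U'"
    unfolding W_rep_def
    using ac_deriv_add[OF H10_repD(1)[OF r] ac_deriv_cmult[OF pw(1)], of c]
      square_integrable_add[OF H10_repD(2)[OF r] square_integrable_scale[OF pw(2)], of c]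
    by auto
next
  note pw = powr_half_facts[OF \<gamma>]
  define p where "p x = complex_of_real (x powr (\<gamma> + 1/2))" for x
  assume "\<exists>U U'. W_rep v U U'"
  then obtain U U' where U: "ac_deriv U U'" "square_integrable U'"
    "AE x in unit_leb. of_real (sqrt x) * l2_fun v x = U x" "(U \<longlongrightarrow> 0) (at_right 0)"
    by (auto simp: W_rep_def)
  obtain c where c: "(U \<longlongrightarrow> c) (at_left 1)"
    by (rule ac_deriv_limit_at_one[OF U(1,2)])
  \<comment> \<open>Subtracting \<open>c\<close> times the power cancels the limit at 1 and leaves
    an element of \<open>H10\<close>.\<close>
  define H where "H x = U x + (- c) * p x" for x
  have ac: "ac_deriv H (\<lambda>x. U' x + (- c) * of_real ((\<gamma> + 1/2) * x powr (\<gamma> + 1/2 - 1)))"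
    using ac_deriv_add[OF U(1) ac_deriv_cmult[OF pw(1)], of "- c"] by (simp add: H_def[abs_def] p_def)
  have "(H \<longlongrightarrow> 0 + (- c) * 0) (at_right 0)"
    unfolding H_def p_def by (intro tendsto_intros U(4) pw(4))
  moreover have "(H \<longlongrightarrow> c + (- c) * 1) (at_left 1)"
    unfolding H_def p_def by (intro tendsto_intros c pw(5))
  ultimately have r: "H10_rep (l2_of H) H (\<lambda>x. U' x + (- c) * of_real ((\<gamma> + 1/2) * x powr (\<gamma> + 1/2 - 1)))"
    by (intro H10_repI[OF ac] square_integrable_add[OF U(2)] square_integrable_scale pw(2)) simp_all
  have "l2_of (\<lambda>x. of_real (sqrt x) * l2_fun v x) = l2_of H + c *\<^sub>C l2_of p"
    unfolding p_def
    by (rule l2_eqI)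
      (use l2_fun_l2_of[OF square_integrable_sqrt_l2_fun[of v]] U(3)
        l2_fun_add[of "l2_of H" "c *\<^sub>C l2_of (\<lambda>x. of_real (x powr (\<gamma> + 1/2)))"]
        l2_fun_scale[of c "l2_of (\<lambda>x. of_real (x powr (\<gamma> + 1/2)))"]
        l2_fun_l2_of[OF pw(3)] H10_repD(3)[OF r] in
        \<open>eventually_elim, simp add: H_def p_def\<close>)
  then show "v \<in> W \<gamma>"
    unfolding W_def p_def using r by (auto simp: H10_iff)
qed

lemma W_rep_hardy:
  assumes "W_rep v U U'"
  shows "square_integrable (\<lambda>x. U x / of_real x)"
proof (rule hardy_square_integrable[of U U' 0])
  show "(cmod (U x))\<^sup>2 \<le> (LINT x|unit_leb. (cmod (U' x))\<^sup>2) * x" if "0 < x" "x < 1" for x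
    using assms that by (intro ac_deriv_bound_at_zero[of U U' U' x "\<lambda>_. 1"]) (auto simp: W_rep_def)
qed (use assms in \<open>auto simp: W_rep_def\<close>)

section \<open>The defect and Green's identity\<close>

text \<open>The integrand of \<open>defect\<close> in terms of \<open>U = x^(1/2) v\<close>, using
  \<open>v / x^(1/2) = U / x\<close>; each summand is then visibly in L2.\<close>

definition defect_fun :: "real \<Rightarrow> (real \<Rightarrow> complex) \<Rightarrow> (real \<Rightarrow> complex) \<Rightarrow> l2 \<Rightarrow> real \<Rightarrow> complex" where
  "defect_fun \<gamma> U U' l x = of_real (sqrt (x / \<gamma>)) * l2_fun l x - \<i> * (of_real (1 / sqrt \<gamma>) * U' x)
     + \<i> * (of_real ((2 * \<gamma> + 1) / (2 * sqrt \<gamma>)) * (U x / of_real x))"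

lemma defect_fun_square_integrable:
  assumes \<gamma>: "\<gamma> > 0" and W: "W_rep v U U'"
  shows "square_integrable (defect_fun \<gamma> U U' l)"
proof -
  have "square_integrable (\<lambda>x. of_real (sqrt (x / \<gamma>)) * l2_fun l x)"
    by (rule square_integrable_mult_continuous[OF square_integrable_l2_fun, of _ "sqrt (1 / \<gamma>)"])
      (use \<gamma> in \<open>auto intro!: continuous_intros simp: divide_right_mono\<close>)
  then have "square_integrable (\<lambda>x. of_real (sqrt (x / \<gamma>)) * l2_fun l x - \<i> * (of_real (1 / sqrt \<gamma>) * U' x)
     + \<i> * (of_real ((2 * \<gamma> + 1) / (2 * sqrt \<gamma>)) * (U x / of_real x)))"
    using W by (intro square_integrable_add square_integrable_diff square_integrable_scale W_rep_hardy[OF W])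
      (auto simp: W_rep_def)
  then show ?thesis by (simp add: defect_fun_def[abs_def])
qed

lemma defect_eq:
  assumes \<gamma>: "\<gamma> > 0" and W: "W_rep v U U'"
  shows "defect \<gamma> v l = (norm (l2_of (defect_fun \<gamma> U U' l)))\<^sup>2"
proof -
  note dsq = defect_fun_square_integrable[OF \<gamma> W, of l]
  define D where "D x = of_real (sqrt (x / \<gamma>)) * l2_fun l x
       - \<i> * weak_deriv (\<lambda>y. of_real (sqrt (y / \<gamma>)) * l2_fun v y) x
       + \<i> * of_real ((2 * \<gamma> + 1) / (2 * sqrt (\<gamma> * x))) * l2_fun v x" for x
  have U: "ac_deriv U U'" "AE x in unit_leb. of_real (sqrt x) * l2_fun v x = U x"
    using W by (auto simp: W_rep_def)
  have AE: "AE x in unit_leb. of_real (sqrt (x / \<gamma>)) * l2_fun v x = of_real (1 / sqrt \<gamma>) * U x"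
    using U(2) by eventually_elim (auto simp: real_sqrt_divide field_simps)
  have wd: "AE x in unit_leb. weak_deriv (\<lambda>y. of_real (sqrt (y / \<gamma>)) * l2_fun v y) x = of_real (1 / sqrt \<gamma>) * U' x"
    by (rule weak_deriv_eq[OF ac_deriv_cmult[OF U(1)] AE])
  have pos: "AE x in unit_leb. 0 < x" by (rule AE_unit_lebI)
  have DAE: "AE x in unit_leb. defect_fun \<gamma> U U' l x = D x"
    using wd U(2) pos
  proof eventually_elim
    case (elim x)
    have s: "complex_of_real x = of_real (sqrt x) * of_real (sqrt x)"
      using elim(3) by (simp flip: of_real_mult)
    have eq: "of_real ((2 * \<gamma> + 1) / (2 * sqrt (\<gamma> * x))) * l2_fun v x
        = of_real ((2 * \<gamma> + 1) / (2 * sqrt \<gamma>)) * (U x / of_real x)"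
      unfolding elim(2)[symmetric] s using elim(3) \<gamma> by (simp add: real_sqrt_mult field_simps)
    show ?case
      by (simp only: D_def defect_fun_def elim(1) mult.assoc eq)
  qed
  have "(norm (l2_of (defect_fun \<gamma> U U' l)))\<^sup>2 = (LINT x|unit_leb. (cmod (D x))\<^sup>2)"
  proof (rule l2_norm_power2_AE)
    show "AE x in unit_leb. l2_fun (l2_of (defect_fun \<gamma> U U' l)) x = D x"
      using l2_fun_l2_of[OF dsq] DAE by eventually_elim simp
    show "D \<in> borel_measurable unit_leb"
      by (rule borel_measurable_unit_leb_AE[OF square_integrable_measurable[OF dsq] DAE])
  qed
  then show ?thesis by (simp add: defect_def D_def)
qed

lemma powr_minus_half: "0 < x \<Longrightarrow> x powr (- 1/2) = 1 / sqrt x"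
  using powr_minus_divide[of x "1/2"] by (simp add: powr_half_sqrt)

text \<open>Green's identity; the boundary terms of \<open>x^(-1/2) cnj f (x^(1/2) v)\<close> vanish.\<close>

lemma green_identity:
  assumes \<gamma>: "\<gamma> > 0" and W: "W_rep v U U'" and f: "f \<in> H10"
  shows "l2_inner f l - l2_inner (A_fun \<gamma> f) v = l2_inner (hat \<gamma> f) (l2_of (defect_fun \<gamma> U U' l))"
proof -
  obtain F g where r: "H10_rep f F g" using f by (auto simp: H10_iff)
  note F = H10_repD[OF r]
  have Fsq: "square_integrable F"
    by (rule square_integrable_of_bound[OF F(7) H10_rep_bound[OF r]])
  have U: "ac_deriv U U'" "square_integrable U'" "AE x in unit_leb. of_real (sqrt x) * l2_fun v x = U x"
    "(U \<longlongrightarrow> 0) (at_right 0)"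
    using W by (auto simp: W_rep_def)
  note dsq = defect_fun_square_integrable[OF \<gamma> W, of l]
  define a where "a x = \<i> * g x + \<i> * of_real \<gamma> * (F x / of_real x)" for x
  have asq: "square_integrable a" unfolding a_def by (rule A_fun_square_integrable[OF r])
  define e where "e x = complex_of_real (sqrt (\<gamma> / x)) * F x" for x
  have esq: "square_integrable e" unfolding e_def by (rule hat_AE(1)[OF r \<gamma>])
  note lsq = square_integrable_l2_fun[of l] and vsq = square_integrable_l2_fun[of v]
  have i1: "l2_inner f l = (LINT x|unit_leb. cnj (F x) * l2_fun l x)"
    by (rule l2_inner_AE[OF F(3) _ F(6) square_integrable_measurable[OF lsq]]) simp
  have i2: "l2_inner (A_fun \<gamma> f) v = (LINT x|unit_leb. cnj (a x) * l2_fun v x)"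
    by (rule l2_inner_AE[OF A_fun_AE[OF r, of \<gamma>, folded a_def] _ square_integrable_measurable[OF asq]
          square_integrable_measurable[OF vsq]]) simp
  have i3: "l2_inner (hat \<gamma> f) (l2_of (defect_fun \<gamma> U U' l)) = (LINT x|unit_leb. cnj (e x) * defect_fun \<gamma> U U' l x)"
    by (rule l2_inner_AE[OF hat_AE(2)[OF r \<gamma>, folded e_def] l2_fun_l2_of[OF dsq]
          square_integrable_measurable[OF esq] square_integrable_measurable[OF dsq]])
  note int = integrable_cnj_mult[OF Fsq lsq] integrable_cnj_mult[OF asq vsq] integrable_cnj_mult[OF esq dsq]
  define D where "D x = cnj (F x) * l2_fun l x - cnj (a x) * l2_fun v x - cnj (e x) * defect_fun \<gamma> U U' l x" for x
  have Di: "integrable unit_leb D"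
    unfolding D_def using int by simp
  have LD: "(LINT x|unit_leb. D x) = l2_inner f l - l2_inner (A_fun \<gamma> f) v
      - l2_inner (hat \<gamma> f) (l2_of (defect_fun \<gamma> U U' l))"
    unfolding D_def i1 i2 i3 using int by simp
  define p where "p x = complex_of_real (x powr (- 1/2))" for x
  define p' where "p' x = complex_of_real (- 1/2 * x powr (- 1/2 - 1))" for x
  have p: "ac_deriv p p'" unfolding p_def p'_def by (rule ac_deriv_powr)
  define E where "E x = p' x * (cnj (F x) * U x) + p x * (cnj (g x) * U x + cnj (F x) * U' x)" for x
  have E: "ac_deriv (\<lambda>x. p x * (cnj (F x) * U x)) E"
    unfolding E_def by (rule ac_deriv_mult[OF p ac_deriv_mult[OF ac_deriv_cnj[OF F(1)] U(1)]])
  have pos: "AE x in unit_leb. 0 < x" by (rule AE_unit_lebI)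
  \<comment> \<open>The terms with \<open>l\<close> and those with \<gamma> cancel. The remaining
    1/2 of \<open>\<gamma> + 1/2\<close> is what differentiating \<open>x^(-1/2)\<close>
    produces.\<close>
  have DE: "AE x in unit_leb. \<i> * E x = D x"
    using U(3) pos
  proof eventually_elim
    case (elim x)
    define q where "q = complex_of_real (1 / sqrt x)"
    define y where "y = complex_of_real x"
    have y: "y \<noteq> 0" using elim by (simp add: y_def)
    have px: "p x = q"
      unfolding p_def q_def using powr_minus_half[of x] elim(2) by simp
    have p'x: "p' x = - (q / (2 * y))"
    proof -
      have "x powr (- 1/2 - 1) = 1 / sqrt x / x"
        unfolding powr_diff using powr_minus_half[of x] elim(2) by simp
      then show ?thesis by (simp only: p'_def q_def y_def) simp
    qed
    have "complex_of_real (sqrt x) * q = 1" using elim(2) by (simp add: q_def)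
    then have v: "l2_fun v x = q * U x"
      unfolding elim(1)[symmetric] by (simp add: mult_ac)
    have s1: "sqrt (\<gamma> / x) * sqrt (x / \<gamma>) = 1"
      using elim(2) \<gamma> by (simp only: real_sqrt_mult[symmetric]) simp
    have s2: "sqrt (\<gamma> / x) * (1 / sqrt \<gamma>) = 1 / sqrt x"
      using elim(2) \<gamma> by (simp add: real_sqrt_divide)
    have s3: "sqrt (\<gamma> / x) * ((2 * \<gamma> + 1) / (2 * sqrt \<gamma>)) = (\<gamma> + 1/2) * (1 / sqrt x)"
      using elim(2) \<gamma> by (simp add: real_sqrt_divide field_simps)
    have alg: "(s0 * z) * (c1 * L - \<i> * (c2 * V) + \<i> * (c3 * N))
        = z * ((s0 * c1) * L - \<i> * ((s0 * c2) * V) + \<i> * ((s0 * c3) * N))" for s0 z c1 c2 c3 L V N :: complex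
      by (simp add: algebra_simps)
    have "cnj (e x) * defect_fun \<gamma> U U' l x
        = cnj (F x) * (of_real (sqrt (\<gamma> / x) * sqrt (x / \<gamma>)) * l2_fun l x
            - \<i> * (of_real (sqrt (\<gamma> / x) * (1 / sqrt \<gamma>)) * U' x)
            + \<i> * (of_real (sqrt (\<gamma> / x) * ((2 * \<gamma> + 1) / (2 * sqrt \<gamma>))) * (U x / y)))"
      unfolding e_def defect_fun_def y_def of_real_mult complex_cnj_mult complex_cnj_complex_of_real
      by (rule alg)
    also have "\<dots> = cnj (F x) * (l2_fun l x - \<i> * (q * U' x) + \<i> * ((of_real \<gamma> + 1/2) * q * (U x / y)))"
      unfolding s1 s2 s3 by (simp add: q_def)
    finally have d: "cnj (e x) * defect_fun \<gamma> U U' l x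
        = cnj (F x) * (l2_fun l x - \<i> * (q * U' x) + \<i> * ((of_real \<gamma> + 1/2) * q * (U x / y)))" .
    have ca: "cnj (a x) = - \<i> * cnj (g x) - \<i> * of_real \<gamma> * (cnj (F x) / y)"
      by (simp add: a_def y_def)
    show ?case
      unfolding D_def E_def d ca v px p'x using y by (simp add: field_simps)
  qed
  have "ac_deriv (\<lambda>x. \<i> * (p x * (cnj (F x) * U x))) D"
    by (rule ac_deriv_cong[OF ac_deriv_cmult[OF E] refl DE])
  then have "(LINT x|unit_leb. D x) = 0 - 0"
  proof (rule ac_deriv_FTC[OF _ Di])
    define K where "K = (LINT x|unit_leb. (cmod (g x))\<^sup>2)"
    show "((\<lambda>x. \<i> * (p x * (cnj (F x) * U x))) \<longlongrightarrow> 0) (at_right 0)"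
    proof (rule Lim_null_comparison)
      show "((\<lambda>x. sqrt K * cmod (U x)) \<longlongrightarrow> 0) (at_right 0)"
        using tendsto_mult_right_zero[OF tendsto_norm_zero[OF U(4)]] .
      \<comment> \<open>The bound \<open>|F| \<le> (K x)^(1/2)\<close> just compensates
        \<open>x^(-1/2)\<close>, leaving a multiple of \<open>U\<close>, which tends to 0.\<close>
      have "cmod (\<i> * (p x * (cnj (F x) * U x))) \<le> sqrt K * cmod (U x)" if x: "0 < x" "x < 1" for x
      proof -
        have "cmod (F x) \<le> sqrt (K * x)"
          using H10_rep_bound[OF r x] by (intro real_le_rsqrt) (simp add: K_def)
        then have "1 / sqrt x * cmod (F x) \<le> 1 / sqrt x * (sqrt K * sqrt x)"
          unfolding real_sqrt_mult using x by (intro mult_left_mono) auto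
        also have "\<dots> = sqrt K" using x by simp
        finally have "1 / sqrt x * cmod (F x) * cmod (U x) \<le> sqrt K * cmod (U x)"
          by (rule mult_right_mono) simp
        then show ?thesis
          using x powr_minus_half[of x] by (simp add: norm_mult norm_divide p_def mult_ac)
      qed
      then show "\<forall>\<^sub>F x in at_right 0. cmod (\<i> * (p x * (cnj (F x) * U x))) \<le> sqrt K * cmod (U x)"
        using eventually_at_right_real[of 0 1] by (auto elim!: eventually_mono)
    qed
    obtain c where c: "(U \<longlongrightarrow> c) (at_left 1)"
      by (rule ac_deriv_limit_at_one[OF U(1,2)])
    have "((\<lambda>x. \<i> * (p x * (cnj (F x) * U x))) \<longlongrightarrow> \<i> * (of_real (1 powr (- 1/2)) * (cnj 0 * c))) (at_left 1)"
      unfolding p_def by (intro tendsto_intros F(5) c) auto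
    then show "((\<lambda>x. \<i> * (p x * (cnj (F x) * U x))) \<longlongrightarrow> 0) (at_left 1)" by simp
  qed
  then show ?thesis using LD by simp
qed

section \<open>One-dimensional extensions\<close>

text \<open>One of the two mixed terms enters conjugated, which reverses its sign in the imaginary
  part; so the sum of mixed terms becomes the boundary form
  \<open><f, l> - <A f, v>\<close>.\<close>

lemma Im_A_ext:
  assumes \<gamma>: "\<gamma> > 0" and f: "f \<in> H10"
  shows "Im (l2_inner (f + c *\<^sub>C v) (A_fun \<gamma> f + c *\<^sub>C l))
    = (norm (hat \<gamma> f))\<^sup>2 + (cmod c)\<^sup>2 * Im (l2_inner v l)
      + Im (c * (l2_inner f l - l2_inner (A_fun \<gamma> f) v))"
proof -
  have "l2_inner (f + c *\<^sub>C v) (A_fun \<gamma> f + c *\<^sub>C l)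
      = l2_inner f (A_fun \<gamma> f) + (c * cnj c) * l2_inner v l + c * l2_inner f l + cnj (c * l2_inner (A_fun \<gamma> f) v)"
    by (simp add: l2_inner_add_left l2_inner_add_right l2_inner_scale_left l2_inner_scale_right
        l2_inner_commute[of v "A_fun \<gamma> f"] algebra_simps)
  also have "c * cnj c = of_real ((cmod c)\<^sup>2)" by (simp only: complex_norm_square)
  finally show ?thesis
    by (simp add: Im_A_fun[OF f \<gamma>] right_diff_distrib)
qed

lemma linear_op_A_ext:
  assumes v: "v \<notin> H10"
  shows "linear_op (A_ext \<gamma> v l)"
  unfolding linear_op_def
proof (intro conjI)
  show "single_valued (A_ext \<gamma> v l)"
  proof (rule single_valuedI)
    fix x y z assume xyz: "(x, y) \<in> A_ext \<gamma> v l" "(x, z) \<in> A_ext \<gamma> v l"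
    obtain f c where f: "f \<in> H10" "x = f + c *\<^sub>C v" "y = A_fun \<gamma> f + c *\<^sub>C l"
      using xyz(1) unfolding A_ext_def by blast
    obtain g d where g: "g \<in> H10" "x = g + d *\<^sub>C v" "z = A_fun \<gamma> g + d *\<^sub>C l"
      using xyz(2) unfolding A_ext_def by blast
    note fg = f(1) g(1) f(2) g(2) f(3) g(3)
    have "c = d"
    proof (rule ccontr)
      assume "c \<noteq> d"
      have "(c - d) *\<^sub>C v = g - f"
      proof -
        have "f + (c - d) *\<^sub>C v + d *\<^sub>C v = f + ((c - d) + d) *\<^sub>C v"
          by (simp only: l2_add_scale add.assoc)
        also have "\<dots> = g + d *\<^sub>C v" using fg(3,4) by simp
        finally have "f + (c - d) *\<^sub>C v = g" by (rule add_right_imp_eq)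
        then show ?thesis by (rule subst) simp
      qed
      then have "inverse (c - d) *\<^sub>C (c - d) *\<^sub>C v \<in> H10"
        by (simp add: H10_scale H10_diff fg)
      then show False using \<open>c \<noteq> d\<close> v by (simp add: l2_scale_scale l2_scale_one)
    qed
    then show "y = z" using fg by simp
  qed
  have "A_fun \<gamma> 0 = 0"
    using A_fun_scale[OF H10_zero, of \<gamma> 0] by (simp add: l2_scale_zero)
  then show "(0, 0) \<in> A_ext \<gamma> v l"
    unfolding A_ext_def using H10_zero by (auto intro!: exI[of _ 0] simp: l2_scale_zero)
  have "\<exists>h e. f + c *\<^sub>C v + (g + d *\<^sub>C v) = h + e *\<^sub>C v \<and>
      A_fun \<gamma> f + c *\<^sub>C l + (A_fun \<gamma> g + d *\<^sub>C l) = A_fun \<gamma> h + e *\<^sub>C l \<and> h \<in> H10"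
    if "f \<in> H10" "g \<in> H10" for f g c d
    by (rule exI[of _ "f + g"], rule exI[of _ "c + d"])
      (use that in \<open>simp add: H10_add A_fun_add l2_add_scale\<close>)
  then show "\<forall>(f, g)\<in>A_ext \<gamma> v l. \<forall>(f', g')\<in>A_ext \<gamma> v l. (f + f', g + g') \<in> A_ext \<gamma> v l"
    unfolding A_ext_def by fastforce
  have "\<exists>h e. b *\<^sub>C (f + c *\<^sub>C v) = h + e *\<^sub>C v \<and>
      b *\<^sub>C (A_fun \<gamma> f + c *\<^sub>C l) = A_fun \<gamma> h + e *\<^sub>C l \<and> h \<in> H10"
    if "f \<in> H10" for f b c
    by (rule exI[of _ "b *\<^sub>C f"], rule exI[of _ "b * c"])
      (use that in \<open>simp add: H10_scale A_fun_scale l2_scale_add l2_scale_scale\<close>)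
  then show "\<forall>(f, g)\<in>A_ext \<gamma> v l. \<forall>c. (c *\<^sub>C f, c *\<^sub>C g) \<in> A_ext \<gamma> v l"
    unfolding A_ext_def by fastforce
qed

lemma A_op_subset_A_ext: "A_op \<gamma> \<subseteq> A_ext \<gamma> v l"
proof -
  have "\<exists>g c. f = g + c *\<^sub>C v \<and> A_fun \<gamma> f = A_fun \<gamma> g + c *\<^sub>C l \<and> g \<in> H10" if "f \<in> H10" for f
    by (rule exI[of _ f], rule exI[of _ 0]) (simp add: that l2_scale_zero)
  then show ?thesis unfolding A_op_def A_ext_def by fastforce
qed

lemma extension_vector_in_A_ext: "\<gamma> > 0 \<Longrightarrow> (v, l) \<in> A_ext \<gamma> v l"
proof -
  have "A_fun \<gamma> 0 = 0"
    using A_fun_scale[OF H10_zero, of \<gamma> 0] by (simp add: l2_scale_zero)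
  then show ?thesis
    unfolding A_ext_def using H10_zero by (auto intro!: exI[of _ 0] exI[of _ 1] simp: l2_scale_one)
qed

text \<open>Modulo the graph of \<open>A\<close>, any element of \<open>S\<close> is linearly
  dependent on \<open>(v, l)\<close>. Since \<open>v\<close> is outside \<open>H10\<close>, the
  coefficient of the new element is nonzero and the relation can be solved for it. In particular a
  dissipative \<open>A_ext\<close> with \<open>v\<close> outside \<open>H10\<close> has no proper
  dissipative extension.\<close>

lemma dissipative_extension_eq_A_ext:
  assumes \<gamma>: "\<gamma> > 0" and S: "dissipative S" "A_op \<gamma> \<subseteq> S" and vl: "(v, l) \<in> S" and v: "v \<notin> H10"
  shows "S = A_ext \<gamma> v l"
proof
  have lin: "linear_op S" using S by (simp add: dissipative_def)
  show "A_ext \<gamma> v l \<subseteq> S"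
  proof
    fix x assume "x \<in> A_ext \<gamma> v l"
    then obtain f c where x: "x = (f + c *\<^sub>C v, A_fun \<gamma> f + c *\<^sub>C l)" "f \<in> H10"
      by (auto simp: A_ext_def)
    have "(f, A_fun \<gamma> f) \<in> S" using S(2) x(2) by (auto simp: A_op_def)
    moreover have "(c *\<^sub>C v, c *\<^sub>C l) \<in> S" using lin vl unfolding linear_op_def by blast
    ultimately show "x \<in> S" using lin unfolding x(1) linear_op_def by blast
  qed
  show "S \<subseteq> A_ext \<gamma> v l"
  proof
    fix x assume "x \<in> S"
    then obtain z q where zq: "x = (z, q)" "(z, q) \<in> S" by (cases x) auto
    obtain a b f where ab: "a \<noteq> 0 \<or> b \<noteq> 0" "f \<in> H10" "a *\<^sub>C v + b *\<^sub>C z = f" "a *\<^sub>C l + b *\<^sub>C q = A_fun \<gamma> f"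
      by (rule dissipative_extension_dependent[OF \<gamma> S vl zq(2)])
    have b: "b \<noteq> 0"
    proof
      assume "b = 0"
      then have av: "a *\<^sub>C v \<in> H10" "a \<noteq> 0" using ab by (auto simp: l2_scale_zero)
      have "inverse a *\<^sub>C a *\<^sub>C v \<in> H10" by (rule H10_scale[OF av(1)])
      then show False using v av(2) by (simp add: l2_scale_scale l2_scale_one)
    qed
    have solve: "t = inverse b *\<^sub>C g + (- inverse b * a) *\<^sub>C u" if "a *\<^sub>C u + b *\<^sub>C t = g" for t g u
    proof -
      have "inverse b *\<^sub>C g + (- inverse b * a) *\<^sub>C u = ((inverse b * a) *\<^sub>C u + (- inverse b * a) *\<^sub>C u) + t"
        unfolding that[symmetric] using b by (simp add: l2_scale_add l2_scale_scale l2_scale_one algebra_simps)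
      then show ?thesis by (simp add: l2_scale_zero flip: l2_add_scale)
    qed
    show "x \<in> A_ext \<gamma> v l"
      unfolding zq(1) A_ext_def
      using solve[OF ab(3)] solve[OF ab(4)] A_fun_scale[OF ab(2), of \<gamma> "inverse b"] H10_scale[OF ab(2), of "inverse b"]
      by (auto intro!: exI[of _ "inverse b *\<^sub>C f"] exI[of _ "- inverse b * a"])
  qed
qed

text \<open>By Green's identity the form is at least \<open>N^2 - |c| N d + |c|^2 d^2 / 4\<close>
  with \<open>N = norm (hat \<gamma> f)\<close> and \<open>d = norm w\<close>, a perfect square; the
  factor 1/4 in the inequality is what completes it.\<close>

lemma maximally_dissipative_A_ext:
  assumes \<gamma>: "\<gamma> > 0" and v: "v \<in> W \<gamma> - H10" and defect: "Im (l2_inner v l) \<ge> 1/4 * defect \<gamma> v l"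
  shows "maximally_dissipative (A_ext \<gamma> v l)"
proof -
  obtain U U' where W: "W_rep v U U'" using v W_iff[OF \<gamma>] by blast
  define w where "w = l2_of (defect_fun \<gamma> U U' l)"
  have w: "Im (l2_inner v l) \<ge> 1/4 * (norm w)\<^sup>2"
    using defect defect_eq[OF \<gamma> W, of l] by (simp add: w_def)
  have diss: "dissipative (A_ext \<gamma> v l)"
    unfolding dissipative_def
  proof (intro conjI)
    show "linear_op (A_ext \<gamma> v l)" using v by (intro linear_op_A_ext) simp
    have "H10 \<subseteq> Domain (A_ext \<gamma> v l)"
      using A_op_subset_A_ext[of \<gamma> v l] by (auto simp: A_op_def)
    then show "densely_defined (A_ext \<gamma> v l)"
      unfolding densely_defined_def using closure_mono closure_H10 by blast
    have "0 \<le> Im (l2_inner (f + c *\<^sub>C v) (A_fun \<gamma> f + c *\<^sub>C l))" if f: "f \<in> H10" for f c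
    proof -
      have "cmod (c * l2_inner (hat \<gamma> f) w) \<le> cmod c * (norm (hat \<gamma> f) * norm w)"
        unfolding norm_mult by (intro mult_left_mono l2_Cauchy_Schwarz) simp
      then have "- (cmod c * (norm (hat \<gamma> f) * norm w)) \<le> Im (c * l2_inner (hat \<gamma> f) w)"
        using abs_Im_le_cmod[of "c * l2_inner (hat \<gamma> f) w"] by linarith
      moreover have "(cmod c)\<^sup>2 * (1/4 * (norm w)\<^sup>2) \<le> (cmod c)\<^sup>2 * Im (l2_inner v l)"
        using w by (intro mult_left_mono) auto
      moreover have "0 \<le> (norm (hat \<gamma> f) - 1/2 * (cmod c * norm w))\<^sup>2" by simp
      then have "0 \<le> (norm (hat \<gamma> f))\<^sup>2 - cmod c * (norm (hat \<gamma> f) * norm w) + (cmod c)\<^sup>2 * (1/4 * (norm w)\<^sup>2)"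
        by (simp add: power2_eq_square algebra_simps)
      ultimately show ?thesis
        unfolding Im_A_ext[OF \<gamma> f] green_identity[OF \<gamma> W f] w_def[symmetric] by linarith
    qed
    then show "\<forall>(f, g)\<in>A_ext \<gamma> v l. 0 \<le> Im (l2_inner f g)"
      by (auto simp: A_ext_def)
  qed
  have "S = A_ext \<gamma> v l" if S: "dissipative S" "A_ext \<gamma> v l \<subseteq> S" for S
    using S extension_vector_in_A_ext[OF \<gamma>, of v l] A_op_subset_A_ext[of \<gamma> v l] v
    by (intro dissipative_extension_eq_A_ext[OF \<gamma>]) auto
  with diss show ?thesis by (auto simp: maximally_dissipative_def)
qed

text \<open>The extension sending \<open>x^\<gamma>\<close> to 0 has defect zero.\<close>

lemma A_op_not_maximal:
  assumes \<gamma>: "\<gamma> > 0"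
  shows "\<not> maximally_dissipative (A_op \<gamma>)"
proof
  assume max: "maximally_dissipative (A_op \<gamma>)"
  define h where "h x = complex_of_real (x powr \<gamma>)" for x
  have hc: "continuous_on {0<..<1} h" unfolding h_def by (intro continuous_intros) auto
  have "square_integrable (\<lambda>x. h x * 1)"
    by (rule square_integrable_mult_continuous[OF square_integrable_const hc, of 1])
      (use \<gamma> in \<open>auto simp: h_def intro!: powr_le1\<close>)
  then have h: "square_integrable h" by simp
  define v where "v = l2_of h"
  note pw = powr_half_facts[OF \<gamma>]
  have pos: "AE x in unit_leb. 0 < x" by (rule AE_unit_lebI)
  have "AE x in unit_leb. of_real (sqrt x) * l2_fun v x = of_real (x powr (\<gamma> + 1/2))"
    using l2_fun_l2_of[OF h] pos
    by eventually_elim (simp add: v_def h_def powr_add powr_half_sqrt mult.commute)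
  then have W: "W_rep v (\<lambda>x. of_real (x powr (\<gamma> + 1/2))) (\<lambda>x. of_real ((\<gamma> + 1/2) * x powr (\<gamma> + 1/2 - 1)))"
    using pw by (simp add: W_rep_def)
  \<comment> \<open>\<open>x^\<gamma>\<close> tends to 1 at the right end.\<close>
  have v: "v \<notin> H10"
  proof
    assume "v \<in> H10"
    then obtain F g where r: "H10_rep v F g" by (auto simp: H10_iff)
    have AE: "AE x in unit_leb. h x = F x"
      using H10_repD(3)[OF r] l2_fun_l2_of[OF h] by eventually_elim (simp add: v_def)
    have eq: "h x = F x" if "0 < x" "x < 1" for x
      by (rule continuous_AE_eq[OF hc H10_repD(7)[OF r] AE that])
    have "\<forall>\<^sub>F x in at_left 1. F x = h x"
      using eventually_at_left_real[of 0 1] by (auto elim!: eventually_mono simp: eq)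
    then have "(h \<longlongrightarrow> 0) (at_left 1)"
      using Lim_transform_eventually[OF H10_repD(5)[OF r]] by blast
    moreover have "(h \<longlongrightarrow> of_real (1 powr \<gamma>)) (at_left 1)"
      unfolding h_def by (intro tendsto_intros) auto
    ultimately show False
      using tendsto_unique[of "at_left (1::real)" h 0 "of_real (1 powr \<gamma>)"] by simp
  qed
  define D where "D = defect_fun \<gamma> (\<lambda>x. of_real (x powr (\<gamma> + 1/2)))
      (\<lambda>x. of_real ((\<gamma> + 1/2) * x powr (\<gamma> + 1/2 - 1))) 0"
  have "AE x in unit_leb. l2_fun (l2_of D) x = l2_fun 0 x"
    using l2_fun_l2_of[OF defect_fun_square_integrable[OF \<gamma> W, of 0], folded D_def] l2_fun_zero pos
  proof eventually_elim
    case (elim x)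
    \<comment> \<open>For \<open>l = 0\<close> the two remaining terms cancel, because
      \<open>U' = ((\<gamma> + 1/2) / x) U\<close> for this power.\<close>
    have "D x = 0"
      using elim(2) unfolding D_def defect_fun_def pw(6)[OF elim(3)] by (simp add: field_simps)
    then show ?case using elim by simp
  qed
  then have "l2_of D = 0" by (rule l2_eqI)
  then have "defect \<gamma> v 0 = 0"
    using defect_eq[OF \<gamma> W, of 0] by (simp add: D_def)
  then have "maximally_dissipative (A_ext \<gamma> v 0)"
    using v W W_iff[OF \<gamma>] by (intro maximally_dissipative_A_ext[OF \<gamma>]) (auto simp: l2_inner_zero_right)
  then have "A_ext \<gamma> v 0 = A_op \<gamma>"
    using max A_op_subset_A_ext[of \<gamma> v 0] by (auto simp: maximally_dissipative_def)
  then show False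
    using extension_vector_in_A_ext[OF \<gamma>, of v 0] v by (simp add: A_op_iff)
qed

section \<open>Necessity of the defect inequality\<close>

text \<open>The discriminant condition, obtained at the vertex \<open>t = - p / (2 N^2)\<close>. For
  \<open>N = 0\<close> the polynomial is affine and bounded below, so \<open>p = 0\<close>.\<close>

lemma nonneg_quadratic_bound:
  fixes p N E :: real
  assumes "\<And>t. 0 \<le> t\<^sup>2 * N\<^sup>2 + E + t * p" "N \<ge> 0" "E \<ge> 0"
  shows "\<bar>p\<bar> \<le> 2 * sqrt E * N"
proof (cases "N = 0")
  case True
  have "p = 0"
  proof (rule ccontr)
    assume "p \<noteq> 0"
    then show False using assms(1)[of "- (E + 1) / p"] True by simp
  qed
  then show ?thesis using True by simp
next
  case False
  have "0 \<le> (- p / (2 * N\<^sup>2))\<^sup>2 * N\<^sup>2 + E + (- p / (2 * N\<^sup>2)) * p" by (rule assms(1))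
  also have "\<dots> = E - p\<^sup>2 / (4 * N\<^sup>2)"
    using False by (simp add: field_simps power2_eq_square)
  finally have "p\<^sup>2 \<le> 4 * E * N\<^sup>2"
    using False by (simp add: field_simps)
  also have "\<dots> = (2 * sqrt E * N)\<^sup>2"
    using assms(3) by (simp add: power_mult_distrib)
  finally have "\<bar>p\<bar> \<le> \<bar>2 * sqrt E * N\<bar>"
    by (simp only: abs_le_square_iff)
  then show ?thesis using assms(2,3) by simp
qed

text \<open>Testing the form on \<open>t f + v\<close> with real \<open>t\<close> bounds only
  \<open>Im (\<Lambda> f)\<close>. That is a real-linear functional, which suits the real form of
  \<open>l2_riesz\<close>; replacing \<open>f\<close> by \<open>i f\<close> then determines the real
  part of the antilinear \<open>\<Lambda>\<close> as well.\<close>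

lemma dissipative_boundary_form:
  assumes \<gamma>: "\<gamma> > 0" and S: "dissipative S" "A_op \<gamma> \<subseteq> S" and vl: "(v, l) \<in> S"
  obtains w where "\<And>f. f \<in> H10 \<Longrightarrow> l2_inner f l - l2_inner (A_fun \<gamma> f) v = l2_inner (hat \<gamma> f) w"
    "(norm w)\<^sup>2 \<le> 4 * Im (l2_inner v l)"
proof -
  define \<Lambda> where "\<Lambda> f = l2_inner f l - l2_inner (A_fun \<gamma> f) v" for f
  define E where "E = Im (l2_inner v l)"
  have E: "E \<ge> 0" using S(1) vl by (auto simp: dissipative_def E_def)
  have lin: "linear_op S" using S by (simp add: dissipative_def)
  have add: "\<Lambda> (f + g) = \<Lambda> f + \<Lambda> g" if "f \<in> H10" "g \<in> H10" for f g
    using that by (simp add: \<Lambda>_def A_fun_add l2_inner_add_left)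
  have scale: "\<Lambda> (c *\<^sub>C f) = cnj c * \<Lambda> f" if "f \<in> H10" for f c
    using that by (simp add: \<Lambda>_def A_fun_scale l2_inner_scale_left right_diff_distrib)
  have bound: "\<bar>Im (\<Lambda> f)\<bar> \<le> 2 * sqrt E * norm (hat \<gamma> f)" if f: "f \<in> H10" for f
  proof (rule nonneg_quadratic_bound[OF _ norm_ge_zero E])
    fix t :: real
    define g where "g = of_real t *\<^sub>C f"
    have g: "g \<in> H10" unfolding g_def by (rule H10_scale[OF f])
    have "(g, A_fun \<gamma> g) \<in> S" using S(2) g by (auto simp: A_op_def)
    then have "(g + v, A_fun \<gamma> g + l) \<in> S" using lin vl unfolding linear_op_def by blast
    then have "0 \<le> Im (l2_inner (g + v) (A_fun \<gamma> g + l))"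
      using S(1) by (auto simp: dissipative_def)
    also have "\<dots> = (norm (hat \<gamma> g))\<^sup>2 + E + Im (\<Lambda> g)"
      using Im_A_ext[OF \<gamma> g, of 1 v l] by (simp add: l2_scale_one E_def \<Lambda>_def)
    also have "\<dots> = t\<^sup>2 * (norm (hat \<gamma> f))\<^sup>2 + E + t * Im (\<Lambda> f)"
      unfolding g_def hat_scale[OF f \<gamma>] scale[OF f] by (simp add: l2_norm_scale power_mult_distrib)
    finally show "0 \<le> t\<^sup>2 * (norm (hat \<gamma> f))\<^sup>2 + E + t * Im (\<Lambda> f)" .
  qed
  obtain w where w: "\<And>f. f \<in> H10 \<Longrightarrow> Im (\<Lambda> f) = inner (hat \<gamma> f) w" "norm w \<le> 2 * sqrt E \<or> w = 0"
  proof (rule l2_riesz[OF H10_subspace, of "hat \<gamma>" "\<lambda>f. Im (\<Lambda> f)" "2 * sqrt E"])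
    show "hat \<gamma> (f + g) = hat \<gamma> f + hat \<gamma> g" if "f \<in> H10" "g \<in> H10" for f g
      by (rule hat_add[OF that \<gamma>])
    show "hat \<gamma> (c *\<^sub>R f) = c *\<^sub>R hat \<gamma> f" if "f \<in> H10" for f c
      unfolding scaleR_l2_def by (rule hat_scale[OF that \<gamma>])
    show "Im (\<Lambda> (f + g)) = Im (\<Lambda> f) + Im (\<Lambda> g)" if "f \<in> H10" "g \<in> H10" for f g
      by (simp add: add[OF that])
    show "Im (\<Lambda> (c *\<^sub>R f)) = c * Im (\<Lambda> f)" if "f \<in> H10" for f c
      unfolding scaleR_l2_def scale[OF that] by simp
  qed (use bound in blast)+
  \<comment> \<open>The vector \<open>w\<close> represents the imaginary part of
    \<open>\<Lambda>\<close> through a real part, and the factor \<open>i\<close> exchanges the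
    two.\<close>
  show thesis
  proof (rule that[of "\<i> *\<^sub>C w"])
    fix f assume f: "f \<in> H10"
    have "Im (\<Lambda> f) = Re (l2_inner (hat \<gamma> f) w)"
      using w(1)[OF f] by (simp add: inner_l2_def)
    moreover have "- Re (\<Lambda> f) = Im (l2_inner (hat \<gamma> f) w)"
      using w(1)[OF H10_scale[OF f, of \<i>]] unfolding hat_scale[OF f \<gamma>] scale[OF f]
      by (simp add: inner_l2_def l2_inner_scale_left)
    ultimately show "l2_inner f l - l2_inner (A_fun \<gamma> f) v = l2_inner (hat \<gamma> f) (\<i> *\<^sub>C w)"
      by (simp add: \<Lambda>_def[symmetric] l2_inner_scale_right complex_eq_iff)
  next
    have "norm w \<le> 2 * sqrt E" using w(2) E by auto
    then have "(norm w)\<^sup>2 \<le> (2 * sqrt E)\<^sup>2" by (rule power_mono) simp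
    then show "(norm (\<i> *\<^sub>C w))\<^sup>2 \<le> 4 * Im (l2_inner v l)"
      using E by (simp add: l2_norm_scale power_mult_distrib E_def[symmetric])
  qed
qed

text \<open>Testing the boundary form with \<open>x^(-\<gamma>) \<phi>\<close> removes the zeroth-order term of \<open>A\<close> and
  exhibits the weak derivative of \<open>x^(-\<gamma>) v\<close>.\<close>

lemma weak_deriv_of_boundary_form:
  assumes \<gamma>: "\<gamma> > 0"
    and w: "\<And>f. f \<in> H10 \<Longrightarrow> l2_inner f l - l2_inner (A_fun \<gamma> f) v = l2_inner (hat \<gamma> f) w"
  shows "has_weak_deriv (\<lambda>x. of_real (x powr (- \<gamma>)) * l2_fun v x)
    (\<lambda>x. \<i> * of_real (x powr (- \<gamma>)) * (of_real (sqrt (\<gamma> / x)) * l2_fun w x - l2_fun l x))"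
  unfolding has_weak_deriv_def
proof (intro conjI allI impI)
  define s where "s x = complex_of_real (x powr (- \<gamma>))" for x
  define e where "e x = complex_of_real (sqrt (\<gamma> / x))" for x
  have s: "continuous_on {0<..<1} s" unfolding s_def by (intro continuous_intros) auto
  have e: "continuous_on {0<..<1} e" unfolding e_def by (intro continuous_intros) auto
  note li = square_integrable_locally_integrable[OF square_integrable_l2_fun]
  have lv: "locally_integrable (\<lambda>x. s x * l2_fun v x)" and ll: "locally_integrable (\<lambda>x. s x * l2_fun l x)"
    using locally_integrable_mult_continuous[OF li s] by (simp_all add: mult.commute)
  have lw: "locally_integrable (\<lambda>x. s x * (e x * l2_fun w x))"
    using locally_integrable_mult_continuous[OF locally_integrable_mult_continuous[OF li e] s]
    by (simp add: mult_ac)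
  have lp: "locally_integrable (\<lambda>x. \<i> * (s x * (e x * l2_fun w x) - s x * l2_fun l x))"
    by (intro locally_integrable_cmult locally_integrable_diff lw ll)
  show "locally_integrable (\<lambda>x. of_real (x powr (- \<gamma>)) * l2_fun v x)"
    using lv by (simp add: s_def)
  show "locally_integrable (\<lambda>x. \<i> * of_real (x powr (- \<gamma>)) * (of_real (sqrt (\<gamma> / x)) * l2_fun w x - l2_fun l x))"
    using lp by (simp add: s_def e_def algebra_simps)
  fix \<phi> assume \<phi>: "test_function \<phi>"
  define F where "F x = complex_of_real (x powr (- \<gamma>) * \<phi> x)" for x
  define g where "g x = complex_of_real (- \<gamma> * x powr (- \<gamma> - 1) * \<phi> x + x powr (- \<gamma>) * deriv \<phi> x)" for x
  have r: "H10_rep (l2_of F) F g"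
    using test_function_H10_rep[OF \<phi>, of "- \<gamma>"] by (simp only: F_def[abs_def] g_def[abs_def])
  note sq = square_integrable_measurable[OF square_integrable_l2_fun]
  have a: "l2_inner (l2_of F) l = (LINT x|unit_leb. \<phi> x *\<^sub>R (s x * l2_fun l x))"
  proof -
    have "l2_inner (l2_of F) l = (LINT x|unit_leb. cnj (F x) * l2_fun l x)"
      by (rule l2_inner_AE[OF H10_repD(3)[OF r] _ H10_repD(6)[OF r] sq]) simp
    then show ?thesis by (simp add: F_def s_def scaleR_conv_of_real mult_ac)
  qed
  have b: "l2_inner (A_fun \<gamma> (l2_of F)) v = - \<i> * (LINT x|unit_leb. deriv \<phi> x *\<^sub>R (s x * l2_fun v x))"
  proof -
    have "l2_inner (A_fun \<gamma> (l2_of F)) v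
        = (LINT x|unit_leb. cnj (\<i> * g x + \<i> * of_real \<gamma> * (F x / of_real x)) * l2_fun v x)"
      by (rule l2_inner_AE[OF A_fun_AE[OF r] _ square_integrable_measurable[OF A_fun_square_integrable[OF r]] sq]) simp
    also have "\<dots> = (LINT x|unit_leb. - \<i> * (deriv \<phi> x *\<^sub>R (s x * l2_fun v x)))"
    proof (rule Bochner_Integration.integral_cong[OF refl])
      fix x assume "x \<in> space unit_leb"
      then have x: "0 < x" by (simp add: space_restrict_space)
      have "g x + of_real \<gamma> * (F x / of_real x) = of_real (deriv \<phi> x) * s x"
        using x by (simp add: g_def F_def s_def powr_diff)
      then have "\<i> * g x + \<i> * of_real \<gamma> * (F x / of_real x) = \<i> * (of_real (deriv \<phi> x) * s x)"
        by (metis distrib_left mult.assoc)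
      then show "cnj (\<i> * g x + \<i> * of_real \<gamma> * (F x / of_real x)) * l2_fun v x = - \<i> * (deriv \<phi> x *\<^sub>R (s x * l2_fun v x))"
        by (simp add: s_def scaleR_conv_of_real)
    qed
    also have "\<dots> = - \<i> * (LINT x|unit_leb. deriv \<phi> x *\<^sub>R (s x * l2_fun v x))"
      by (rule integral_mult_right_zero)
    finally show ?thesis .
  qed
  have c: "l2_inner (hat \<gamma> (l2_of F)) w = (LINT x|unit_leb. \<phi> x *\<^sub>R (s x * (e x * l2_fun w x)))"
  proof -
    have "l2_inner (hat \<gamma> (l2_of F)) w = (LINT x|unit_leb. cnj (of_real (sqrt (\<gamma> / x)) * F x) * l2_fun w x)"
      by (rule l2_inner_AE[OF hat_AE(2)[OF r \<gamma>] _ square_integrable_measurable[OF hat_AE(1)[OF r \<gamma>]] sq]) simp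
    then show ?thesis by (simp add: F_def s_def e_def scaleR_conv_of_real mult_ac)
  qed
  define I where "I = (LINT x|unit_leb. deriv \<phi> x *\<^sub>R (s x * l2_fun v x))"
  define J where "J = (LINT x|unit_leb. \<phi> x *\<^sub>R (s x * (e x * l2_fun w x)))"
  define L where "L = (LINT x|unit_leb. \<phi> x *\<^sub>R (s x * l2_fun l x))"
  have "L - (- \<i> * I) = J"
    using w[of "l2_of F"] r unfolding a b c I_def J_def L_def by (auto simp: H10_iff)
  then have "J - L = \<i> * I" by (simp add: algebra_simps)
  then have "I = - (\<i> * (J - L))" by simp
  also have "\<i> * (J - L) = (LINT x|unit_leb. \<i> * (\<phi> x *\<^sub>R (s x * (e x * l2_fun w x)) - \<phi> x *\<^sub>R (s x * l2_fun l x)))"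
    unfolding J_def L_def using test_function_integrable(1)[OF \<phi> lw] test_function_integrable(1)[OF \<phi> ll] by simp
  also have "\<dots> = (LINT x|unit_leb. \<phi> x *\<^sub>R (\<i> * of_real (x powr (- \<gamma>)) * (of_real (sqrt (\<gamma> / x)) * l2_fun w x - l2_fun l x)))"
    by (rule Bochner_Integration.integral_cong[OF refl])
      (simp add: s_def e_def scaleR_conv_of_real algebra_simps)
  finally show "(LINT x|unit_leb. deriv \<phi> x *\<^sub>R (of_real (x powr (- \<gamma>)) * l2_fun v x))
      = - (LINT x|unit_leb. \<phi> x *\<^sub>R (\<i> * of_real (x powr (- \<gamma>)) * (of_real (sqrt (\<gamma> / x)) * l2_fun w x - l2_fun l x)))"
    by (simp add: I_def s_def)
qed

text \<open>Dropping the contribution of the upper end leaves a bound in \<open>a\<close> alone, of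
  the order \<open>a^(-2 \<gamma>)\<close> that the factor \<open>x^(2 \<gamma> + 1)\<close> later
  compensates.\<close>

lemma integral_powr_bound:
  fixes \<gamma> :: real
  assumes \<gamma>: "\<gamma> > 0" and ab: "0 < a" "a \<le> b"
  shows "integral {a..b} (\<lambda>x. (x powr (- \<gamma> - 1/2))\<^sup>2) \<le> a powr (- 2 * \<gamma>) / (2 * \<gamma>)"
proof -
  have "((\<lambda>x. (x powr (- \<gamma> - 1/2))\<^sup>2) has_integral
      (- (b powr (- 2 * \<gamma>) / (2 * \<gamma>)) - - (a powr (- 2 * \<gamma>) / (2 * \<gamma>)))) {a..b}"
  proof (rule fundamental_theorem_of_calculus[OF ab(2)])
    fix x assume "x \<in> {a..b}"
    then have x: "x > 0" using ab by auto
    have "((\<lambda>x. - (x powr (- 2 * \<gamma>) / (2 * \<gamma>))) has_real_derivative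
        - ((- 2 * \<gamma>) * x powr (- 2 * \<gamma> - 1) / (2 * \<gamma>))) (at x within {a..b})"
      by (intro DERIV_minus DERIV_cdivide has_field_derivative_at_within[OF has_real_derivative_powr[OF x]])
    moreover have "- ((- 2 * \<gamma>) * x powr (- 2 * \<gamma> - 1) / (2 * \<gamma>)) = (x powr (- \<gamma> - 1/2))\<^sup>2"
    proof -
      have "(x powr (- \<gamma> - 1/2))\<^sup>2 = x powr ((- \<gamma> - 1/2) + (- \<gamma> - 1/2))"
        unfolding powr_add by (rule power2_eq_square)
      also have "(- \<gamma> - 1/2) + (- \<gamma> - 1/2) = - 2 * \<gamma> - 1" by simp
      finally show ?thesis using \<gamma> by simp
    qed
    ultimately show "((\<lambda>x. - (x powr (- 2 * \<gamma>) / (2 * \<gamma>))) has_vector_derivative (x powr (- \<gamma> - 1/2))\<^sup>2) (at x within {a..b})"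
      by (simp only: has_real_derivative_iff_has_vector_derivative)
  qed
  then have "integral {a..b} (\<lambda>x. (x powr (- \<gamma> - 1/2))\<^sup>2)
      = - (b powr (- 2 * \<gamma>) / (2 * \<gamma>)) - - (a powr (- 2 * \<gamma>) / (2 * \<gamma>))"
    by (rule integral_unique)
  moreover have "b powr (- 2 * \<gamma>) / (2 * \<gamma>) \<ge> 0" using \<gamma> by simp
  ultimately show ?thesis by linarith
qed

text \<open>The function \<open>P = x^(-\<gamma>) v\<close> has derivative
  \<open>x^(-\<gamma> - 1/2) k\<close> with \<open>k\<close> in L2, so Cauchy-Schwarz gives
  \<open>|P|^2 = O(x^(-2 \<gamma>))\<close>. Hence \<open>U = x^(\<gamma> + 1/2) P\<close> satisfies
  \<open>|U|^2 \<le> M x\<close> and \<open>U' = ((\<gamma> + 1/2) / x) U + k\<close>. The Hardy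
  estimate with \<open>\<alpha> = \<gamma> + 1/2\<close>, where
  \<open>2 \<alpha> - 1 = 2 \<gamma>\<close>, gives \<open>U'\<close> in L2. Solving the equation
  for \<open>w\<close> shows that the given vector is the defect function.\<close>

lemma W_of_boundary_form:
  assumes \<gamma>: "\<gamma> > 0"
    and w: "\<And>f. f \<in> H10 \<Longrightarrow> l2_inner f l - l2_inner (A_fun \<gamma> f) v = l2_inner (hat \<gamma> f) w"
  obtains U U' where "W_rep v U U'" "l2_of (defect_fun \<gamma> U U' l) = w"
proof -
  define p where "p x = \<i> * of_real (x powr (- \<gamma>)) * (of_real (sqrt (\<gamma> / x)) * l2_fun w x - l2_fun l x)" for x
  define k where "k x = \<i> * (of_real (sqrt \<gamma>) * l2_fun w x - of_real (sqrt x) * l2_fun l x)" for x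
  have k: "square_integrable k"
    unfolding k_def
    by (intro square_integrable_scale square_integrable_diff square_integrable_sqrt_l2_fun square_integrable_l2_fun)
  have pk: "p x = of_real (x powr (- \<gamma> - 1/2)) * k x" if x: "0 < x" for x
  proof -
    have "sqrt (\<gamma> / x) = 1 / sqrt x * sqrt \<gamma>" by (simp add: real_sqrt_divide)
    moreover have "1 = 1 / sqrt x * sqrt x" using x by simp
    ultimately have "of_real (sqrt (\<gamma> / x)) * l2_fun w x - 1 * l2_fun l x
        = of_real (1 / sqrt x) * (of_real (sqrt \<gamma>) * l2_fun w x - of_real (sqrt x) * l2_fun l x)"
      using x by (simp add: right_diff_distrib)
    moreover have "x powr (- \<gamma> - 1/2) = x powr (- \<gamma>) * (1 / sqrt x)"
      using x by (simp add: powr_diff powr_half_sqrt)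
    ultimately show ?thesis
      by (simp add: p_def k_def)
  qed
  obtain P where P: "ac_deriv P p" "AE x in unit_leb. of_real (x powr (- \<gamma>)) * l2_fun v x = P x"
    using ac_deriv_of_has_weak_deriv[OF weak_deriv_of_boundary_form[OF \<gamma> w]] by (auto simp: p_def[abs_def])
  note pw = powr_half_facts[OF \<gamma>]
  define u where "u x = complex_of_real (x powr (\<gamma> + 1/2))" for x
  define U where "U x = u x * P x" for x
  define U' where "U' x = of_real ((\<gamma> + 1/2) / x) * U x + k x" for x
  have U: "ac_deriv U U'"
  proof (rule ac_deriv_cong[OF ac_deriv_mult[OF pw(1) P(1)]])
    show "AE x in unit_leb. of_real ((\<gamma> + 1/2) * x powr (\<gamma> + 1/2 - 1)) * P x + of_real (x powr (\<gamma> + 1/2)) * p x = U' x"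
    proof (rule AE_unit_lebI)
      fix x :: real assume x: "0 < x" "x < 1"
      have "x powr (\<gamma> + 1/2) * x powr (- \<gamma> - 1/2) = 1"
        using x by (simp flip: powr_add)
      then have "complex_of_real (x powr (\<gamma> + 1/2)) * (of_real (x powr (- \<gamma> - 1/2)) * k x) = k x"
        by (metis mult.assoc mult_1 of_real_1 of_real_mult)
      then show "of_real ((\<gamma> + 1/2) * x powr (\<gamma> + 1/2 - 1)) * P x + of_real (x powr (\<gamma> + 1/2)) * p x = U' x"
        unfolding pw(6)[OF x(1)] pk[OF x(1)] U'_def U_def u_def by (simp only: mult.assoc)
    qed
  qed (simp add: U_def u_def)
  define K where "K = (LINT x|unit_leb. (cmod (k x))\<^sup>2)"
  have K: "K \<ge> 0" unfolding K_def by (rule Bochner_Integration.integral_nonneg) simp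
  have inc: "(cmod (P b - P a))\<^sup>2 \<le> a powr (- 2 * \<gamma>) / (2 * \<gamma>) * K" if "0 < a" "a \<le> b" "b < 1" for a b
  proof -
    have "(cmod (P b - P a))\<^sup>2 \<le> integral {a..b} (\<lambda>x. (x powr (- \<gamma> - 1/2))\<^sup>2) * K"
      unfolding K_def
      by (rule ac_deriv_square_bound[OF P(1) k that]) (use that in \<open>auto intro!: continuous_intros simp: pk\<close>)
    also have "\<dots> \<le> a powr (- 2 * \<gamma>) / (2 * \<gamma>) * K"
      using integral_powr_bound[OF \<gamma> that(1,2)] K by (rule mult_right_mono)
    finally show ?thesis .
  qed
  \<comment> \<open>The increment constant for intervals starting at 1/2. Since
    \<open>(1/2) powr (- 2 * \<gamma>) \<ge> 1\<close>, the bound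
    \<open>R * x powr (- 2 * \<gamma>)\<close> also covers intervals from \<open>x\<close> up to
    1/2; \<open>M\<close> adds the value at 1/2 through
    \<open>(a + b)^2 \<le> 2 a^2 + 2 b^2\<close>.\<close>
  define R where "R = (1/2) powr (- 2 * \<gamma>) / (2 * \<gamma>) * K"
  define M where "M = 2 * R + 2 * (cmod (P (1/2)))\<^sup>2"
  have half: "1 \<le> (1/2::real) powr (- 2 * \<gamma>)"
    using \<gamma> by (simp add: powr_divide powr_minus_divide ge_one_powr_ge_zero)
  have bound: "(cmod (U x))\<^sup>2 \<le> M * x" if x: "0 < x" "x < 1" for x
  proof -
    have y: "1 \<le> x powr (- 2 * \<gamma>)"
      using x \<gamma> powr_le1[of "2 * \<gamma>" x] by (simp add: powr_minus_divide le_divide_eq)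
    have R: "R \<ge> 0" using K \<gamma> by (simp add: R_def)
    have "(cmod (P x - P (1/2)))\<^sup>2 \<le> R * x powr (- 2 * \<gamma>)"
    proof (cases "x \<le> 1/2")
      case True
      have "(cmod (P x - P (1/2)))\<^sup>2 \<le> x powr (- 2 * \<gamma>) / (2 * \<gamma>) * K"
        using inc[of x "1/2"] True x by (simp add: norm_minus_commute)
      also have "\<dots> = 1 * (K / (2 * \<gamma>) * x powr (- 2 * \<gamma>))" by simp
      also have "\<dots> \<le> (1/2) powr (- 2 * \<gamma>) * (K / (2 * \<gamma>) * x powr (- 2 * \<gamma>))"
        using half K \<gamma> by (intro mult_right_mono) auto
      also have "\<dots> = R * x powr (- 2 * \<gamma>)" by (simp add: R_def)
      finally show ?thesis .
    next
      case False
      have "(cmod (P x - P (1/2)))\<^sup>2 \<le> R * 1"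
        using inc[of "1/2" x] False x by (simp add: R_def)
      also have "\<dots> \<le> R * x powr (- 2 * \<gamma>)"
        using y R by (rule mult_left_mono)
      finally show ?thesis .
    qed
    moreover have "(cmod (P x))\<^sup>2 \<le> 2 * (cmod (P x - P (1/2)))\<^sup>2 + 2 * (cmod (P (1/2)))\<^sup>2"
    proof -
      have "(cmod (P x))\<^sup>2 \<le> (cmod (P x - P (1/2)) + cmod (P (1/2)))\<^sup>2"
        using norm_triangle_ineq[of "P x - P (1/2)" "P (1/2)"] by (intro power_mono) auto
      also have "\<dots> \<le> 2 * (cmod (P x - P (1/2)))\<^sup>2 + 2 * (cmod (P (1/2)))\<^sup>2"
        using zero_le_power2[of "cmod (P x - P (1/2)) - cmod (P (1/2))"]
        by (simp add: power2_eq_square algebra_simps)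
      finally show ?thesis .
    qed
    moreover have "2 * (cmod (P (1/2)))\<^sup>2 * 1 \<le> 2 * (cmod (P (1/2)))\<^sup>2 * x powr (- 2 * \<gamma>)"
      using y by (intro mult_left_mono) auto
    ultimately have "(cmod (P x))\<^sup>2 \<le> M * x powr (- 2 * \<gamma>)"
      unfolding M_def distrib_right by linarith
    then have "(x powr (\<gamma> + 1/2))\<^sup>2 * (cmod (P x))\<^sup>2 \<le> (x powr (\<gamma> + 1/2))\<^sup>2 * (M * x powr (- 2 * \<gamma>))"
      by (rule mult_left_mono) simp
    also have "(x powr (\<gamma> + 1/2))\<^sup>2 * (M * x powr (- 2 * \<gamma>))
        = M * x powr ((\<gamma> + 1/2) + (\<gamma> + 1/2) + (- 2 * \<gamma>))"
      unfolding powr_add by (simp only: power2_eq_square mult_ac)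
    also have "(\<gamma> + 1/2) + (\<gamma> + 1/2) + (- 2 * \<gamma>) = 1" by simp
    finally show ?thesis
      using x by (simp add: U_def u_def norm_mult power_mult_distrib)
  qed
  have Ux: "square_integrable (\<lambda>x. U x / of_real x)"
    by (rule hardy_square_integrable[OF U _ bound, of "\<gamma> + 1/2"]) (use k \<gamma> in \<open>simp_all add: U'_def\<close>)
  have U'sq: "square_integrable U'"
    using square_integrable_add[OF square_integrable_scale[OF Ux, of "of_real (\<gamma> + 1/2)"] k]
    by (simp add: U'_def[abs_def])
  have U0: "(U \<longlongrightarrow> 0) (at_right 0)"
  proof (rule Lim_null_comparison)
    show "((\<lambda>x. sqrt (M * x)) \<longlongrightarrow> 0) (at_right 0)"
      by (rule tendsto_eq_intros refl | simp)+
    show "\<forall>\<^sub>F x in at_right 0. cmod (U x) \<le> sqrt (M * x)"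
      using eventually_at_right_real[of 0 1]
      by (auto elim!: eventually_mono intro: real_le_rsqrt bound)
  qed
  have pos: "AE x in unit_leb. 0 < x" by (rule AE_unit_lebI)
  have "AE x in unit_leb. of_real (sqrt x) * l2_fun v x = U x"
    using P(2) pos
  proof eventually_elim
    case (elim x)
    have "x powr (\<gamma> + 1/2) * x powr (- \<gamma>) = x powr (1/2)"
      by (simp flip: powr_add)
    then have "complex_of_real (x powr (\<gamma> + 1/2)) * of_real (x powr (- \<gamma>)) = of_real (sqrt x)"
      using elim(2) by (simp add: powr_half_sqrt flip: of_real_mult)
    then show ?case
      unfolding U_def u_def elim(1)[symmetric] by (metis mult.assoc)
  qed
  then have W: "W_rep v U U'"
    using U U'sq U0 by (simp add: W_rep_def)
  have "AE x in unit_leb. l2_fun (l2_of (defect_fun \<gamma> U U' l)) x = l2_fun w x"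
    using l2_fun_l2_of[OF defect_fun_square_integrable[OF \<gamma> W, of l]] pos
  proof eventually_elim
    case (elim x)
    define y where "y = U x / of_real x"
    define t where "t = complex_of_real (1 / sqrt \<gamma>)"
    have t: "t * of_real (sqrt \<gamma>) = 1" using \<gamma> by (simp add: t_def)
    have c1: "complex_of_real (sqrt (x / \<gamma>)) = t * of_real (sqrt x)"
      by (simp add: t_def real_sqrt_divide)
    have c2: "complex_of_real ((2 * \<gamma> + 1) / (2 * sqrt \<gamma>)) = t * of_real (\<gamma> + 1/2)"
      unfolding t_def of_real_mult[symmetric] of_real_eq_iff using \<gamma> by (simp add: field_simps)
    have c3: "U' x = of_real (\<gamma> + 1/2) * y + k x"
      by (simp add: U'_def y_def)
    \<comment> \<open>The terms with \<open>y\<close> cancel, and inserting \<open>k\<close> cancels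
      \<open>l\<close>, so only \<open>w\<close> remains.\<close>
    have "defect_fun \<gamma> U U' l x = t * of_real (sqrt x) * l2_fun l x - \<i> * (t * (of_real (\<gamma> + 1/2) * y + k x))
        + \<i> * (t * of_real (\<gamma> + 1/2) * y)"
      unfolding defect_fun_def c1 c2 c3 y_def[symmetric] t_def[symmetric] ..
    also have "\<dots> = t * of_real (sqrt x) * l2_fun l x - \<i> * t * k x"
      by (simp add: algebra_simps)
    also have "\<dots> = t * of_real (sqrt \<gamma>) * l2_fun w x"
      by (simp add: k_def algebra_simps)
    finally show ?case
      using elim by (simp only: t mult_1_left)
  qed
  then have "l2_of (defect_fun \<gamma> U U' l) = w" by (rule l2_eqI)
  with W show thesis by (rule that)
qed

theorem proposition5p1:
  fixes \<gamma> :: real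
  assumes "\<gamma> > 0"
  shows "closed (A_op \<gamma>) \<and> dissipative (A_op \<gamma>) \<and>
    {T. maximally_dissipative T \<and> A_op \<gamma> \<subseteq> T} =
    {A_ext \<gamma> v l | v l. v \<in> W \<gamma> - H10 \<and> Im (l2_inner v l) \<ge> 1/4 * defect \<gamma> v l}"
proof (intro conjI)
  show "closed (A_op \<gamma>)" by (rule closed_A_op[OF assms])
  show "dissipative (A_op \<gamma>)" by (rule dissipative_A_op[OF assms])
  show "{T. maximally_dissipative T \<and> A_op \<gamma> \<subseteq> T} =
    {A_ext \<gamma> v l | v l. v \<in> W \<gamma> - H10 \<and> Im (l2_inner v l) \<ge> 1/4 * defect \<gamma> v l}" (is "?L = ?R")
  proof
    show "?R \<subseteq> ?L"
      using maximally_dissipative_A_ext[OF assms] A_op_subset_A_ext by blast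
    show "?L \<subseteq> ?R"
    proof
      fix T assume "T \<in> ?L"
      then have max: "maximally_dissipative T" and sub: "A_op \<gamma> \<subseteq> T" by auto
      then have diss: "dissipative T" by (simp add: maximally_dissipative_def)
      \<comment> \<open>\<open>A\<close> itself belongs to the left side only if it is maximal,
        which the extension along \<open>x^\<gamma>\<close> excludes.\<close>
      have "T \<noteq> A_op \<gamma>" using max A_op_not_maximal[OF assms] by blast
      then obtain v l where vl: "(v, l) \<in> T" "(v, l) \<notin> A_op \<gamma>" using sub by auto
      \<comment> \<open>\<open>T\<close> is single-valued and already prescribed on
        \<open>H10\<close>, so an element outside the graph of \<open>A\<close> has its first
        component outside \<open>H10\<close>.\<close>
      have v: "v \<notin> H10"
      proof
        assume v: "v \<in> H10"
        then have "(v, A_fun \<gamma> v) \<in> T" using sub by (auto simp: A_op_iff)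
        then have "l = A_fun \<gamma> v"
          using vl(1) diss by (auto simp: dissipative_def linear_op_def single_valued_def)
        then show False using vl(2) v by (simp add: A_op_iff)
      qed
      obtain w where w: "\<And>f. f \<in> H10 \<Longrightarrow> l2_inner f l - l2_inner (A_fun \<gamma> f) v = l2_inner (hat \<gamma> f) w"
        "(norm w)\<^sup>2 \<le> 4 * Im (l2_inner v l)"
        using dissipative_boundary_form[OF assms diss sub vl(1)] by blast
      obtain U U' where W: "W_rep v U U'" "l2_of (defect_fun \<gamma> U U' l) = w"
        using W_of_boundary_form[OF assms w(1)] by blast
      have "v \<in> W \<gamma> - H10" using W(1) W_iff[OF assms] v by blast
      moreover have "Im (l2_inner v l) \<ge> 1/4 * defect \<gamma> v l"
        using w(2) defect_eq[OF assms W(1), of l] W(2) by simp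
      moreover have "T = A_ext \<gamma> v l"
        by (rule dissipative_extension_eq_A_ext[OF assms diss sub vl(1) v])
      ultimately show "T \<in> ?R" by blast
    qed
  qed
qed

end
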